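(* Let $\pi$ be a finitely generated group, let $p$ be a prime and let $f\colon M\to N$ be a morphism of projective left $\mathbb{Z}[\pi]$-modules such that $$\mathrm{Id}\otimes f\colon \mathbb{Z}_p\otimes_{\mathbb{Z}[\pi]} M\to \mathbb{Z}_p\otimes_{\mathbb{Z}[\pi]} N$$ is injective. Let $\phi\colon\pi\to H$ be an epimorphism onto a torsion-free abelian group and let $\alpha\colon\pi\to \mathrm{GL}(k,Q)$ be a representation, with $Q$ a field of characteristic zero. If the restriction $\alpha|_{\ker(\phi)}$ factors through a $p$-group, then $$\mathrm{Id}\otimes f\colon Q[H]^k\otimes_{\mathbb{Z}[\pi]} M\to Q[H]^k\otimes_{\mathbb{Z}[\pi]} N$$ is also injective.
   Context: $\mathbb{Z}_p=\mathbb{Z}/p\mathbb{Z}$, regarded as a right $\mathbb{Z}[\pi]$-module via the augmentation $\mathbb{Z}[\pi]\to\mathbb{Z}\to\mathbb{Z}_p$ (so $\pi$ acts trivially). A $p$-group is a finite group whose order is a power of $p$. $Q^k$ is the space of row vectors, on which $\mathrm{GL}(k,Q)$ acts by right multiplication. The right $\mathbb{Z}[\pi]$-module structure on $Q[H]^k=Q^k\otimes_Q Q[H]$ is the one given by $\alpha\otimes\phi$: for $g\in\pi$, $v\in Q^k$, $q\in Q[H]$, $(v\otimes q)\cdot g=(v\cdot\alpha(g))\otimes(q\cdot\phi(g))$. Projective modules are not assumed finitely generated. *)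

theory Defs
  imports
    "HOL-Algebra.Free_Abelian_Groups"
    "HOL-Algebra.Generated_Groups"
    "HOL-Algebra.Module"
    "HOL-Number_Theory.Residues"
    "Jordan_Normal_Form.Matrix"
begin

section \<open>Groups\<close>

definition finitely_generated_group :: "('g, 'c) monoid_scheme \<Rightarrow> bool" where
  "finitely_generated_group G \<longleftrightarrow>
     group G \<and> (\<exists>S. finite S \<and> S \<subseteq> carrier G \<and> generate G S = carrier G)"

definition torsion_free_abelian_group :: "('h, 'c) monoid_scheme \<Rightarrow> bool" where
  "torsion_free_abelian_group H \<longleftrightarrow>
     comm_group H \<and>
     (\<forall>h\<in>carrier H. \<forall>n::nat. n > 0 \<longrightarrow> h [^]\<^bsub>H\<^esub> n = \<one>\<^bsub>H\<^esub> \<longrightarrow> h = \<one>\<^bsub>H\<^esub>)"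

definition p_group :: "nat \<Rightarrow> ('p, 'c) monoid_scheme \<Rightarrow> bool" where
  "p_group p P \<longleftrightarrow> group P \<and> finite (carrier P) \<and> (\<exists>n. order P = p ^ n)"

definition factors_through ::
    "('a, 'c) monoid_scheme \<Rightarrow> ('p, 'd) monoid_scheme \<Rightarrow> ('b, 'e) monoid_scheme \<Rightarrow>
     ('a \<Rightarrow> 'b) \<Rightarrow> bool" where
  "factors_through K P L f \<longleftrightarrow>
     (\<exists>\<beta>\<in>hom K P. \<exists>\<gamma>\<in>hom P L. \<forall>x\<in>carrier K. f x = \<gamma> (\<beta> x))"

definition GL :: "nat \<Rightarrow> ('q::field) mat monoid" where
  "GL k = units_of (ring_mat TYPE('q) k ())"


section \<open>Group rings\<close>

definition group_ring_mult ::
    "('g, 'c) monoid_scheme \<Rightarrow> ('g \<Rightarrow>\<^sub>0 'r::comm_ring_1) \<Rightarrow> ('g \<Rightarrow>\<^sub>0 'r) \<Rightarrow> ('g \<Rightarrow>\<^sub>0 'r)" where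
  "group_ring_mult G x y =
     (\<Sum>g\<in>Poly_Mapping.keys x. \<Sum>h\<in>Poly_Mapping.keys y.
        Poly_Mapping.single (g \<otimes>\<^bsub>G\<^esub> h) (Poly_Mapping.lookup x g * Poly_Mapping.lookup y h))"

definition group_ring :: "('g, 'c) monoid_scheme \<Rightarrow> ('g \<Rightarrow>\<^sub>0 'r::comm_ring_1) ring" where
  "group_ring G =
     \<lparr> carrier = {x. Poly_Mapping.keys x \<subseteq> carrier G},
       monoid.mult = group_ring_mult G,
       one = Poly_Mapping.single \<one>\<^bsub>G\<^esub> 1,
       ring.zero = 0,
       add = (+) \<rparr>"

abbreviation (input) pm_scale :: "'r \<Rightarrow> ('g \<Rightarrow>\<^sub>0 'r) \<Rightarrow> ('g \<Rightarrow>\<^sub>0 'r::comm_ring_1)" where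
  "pm_scale c x \<equiv> Poly_Mapping.map ((*) c) x"

definition augmentation :: "('g \<Rightarrow>\<^sub>0 'r::comm_ring_1) \<Rightarrow> 'r" where
  "augmentation x = (\<Sum>g\<in>Poly_Mapping.keys x. Poly_Mapping.lookup x g)"


section \<open>Modules over a not necessarily commutative ring\<close>

text \<open>The library locale \<^locale>\<open>module\<close> requires a commutative ring of scalars. As there, only the
  additive and scalar part of the module record matters; its multiplication and unit are junk.\<close>

locale left_module = R?: ring R + M?: abelian_group M
  for R :: "('r, 'c) ring_scheme" (structure) and M :: "('r, 'm, 'd) module_scheme" (structure) +
  assumes smult_closed:
      "\<lbrakk>r \<in> carrier R; x \<in> carrier M\<rbrakk> \<Longrightarrow> r \<odot>\<^bsub>M\<^esub> x \<in> carrier M"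
    and smult_l_distr:
      "\<lbrakk>r \<in> carrier R; s \<in> carrier R; x \<in> carrier M\<rbrakk> \<Longrightarrow>
        (r \<oplus>\<^bsub>R\<^esub> s) \<odot>\<^bsub>M\<^esub> x = (r \<odot>\<^bsub>M\<^esub> x) \<oplus>\<^bsub>M\<^esub> (s \<odot>\<^bsub>M\<^esub> x)"
    and smult_r_distr:
      "\<lbrakk>r \<in> carrier R; x \<in> carrier M; y \<in> carrier M\<rbrakk> \<Longrightarrow>
        r \<odot>\<^bsub>M\<^esub> (x \<oplus>\<^bsub>M\<^esub> y) = (r \<odot>\<^bsub>M\<^esub> x) \<oplus>\<^bsub>M\<^esub> (r \<odot>\<^bsub>M\<^esub> y)"
    and smult_assoc:
      "\<lbrakk>r \<in> carrier R; s \<in> carrier R; x \<in> carrier M\<rbrakk> \<Longrightarrow>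
        (r \<otimes>\<^bsub>R\<^esub> s) \<odot>\<^bsub>M\<^esub> x = r \<odot>\<^bsub>M\<^esub> (s \<odot>\<^bsub>M\<^esub> x)"
    and smult_one: "x \<in> carrier M \<Longrightarrow> \<one>\<^bsub>R\<^esub> \<odot>\<^bsub>M\<^esub> x = x"

text \<open>Right modules use the same record: there \<open>r \<odot> x\<close> stands for \<open>x \<cdot> r\<close>, which shows in the
  associativity law.\<close>

locale right_module = R?: ring R + M?: abelian_group M
  for R :: "('r, 'c) ring_scheme" (structure) and M :: "('r, 'm, 'd) module_scheme" (structure) +
  assumes smult_closed:
      "\<lbrakk>r \<in> carrier R; x \<in> carrier M\<rbrakk> \<Longrightarrow> r \<odot>\<^bsub>M\<^esub> x \<in> carrier M"
    and smult_l_distr: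
      "\<lbrakk>r \<in> carrier R; s \<in> carrier R; x \<in> carrier M\<rbrakk> \<Longrightarrow>
        (r \<oplus>\<^bsub>R\<^esub> s) \<odot>\<^bsub>M\<^esub> x = (r \<odot>\<^bsub>M\<^esub> x) \<oplus>\<^bsub>M\<^esub> (s \<odot>\<^bsub>M\<^esub> x)"
    and smult_r_distr:
      "\<lbrakk>r \<in> carrier R; x \<in> carrier M; y \<in> carrier M\<rbrakk> \<Longrightarrow>
        r \<odot>\<^bsub>M\<^esub> (x \<oplus>\<^bsub>M\<^esub> y) = (r \<odot>\<^bsub>M\<^esub> x) \<oplus>\<^bsub>M\<^esub> (r \<odot>\<^bsub>M\<^esub> y)"
    and smult_assoc:
      "\<lbrakk>r \<in> carrier R; s \<in> carrier R; x \<in> carrier M\<rbrakk> \<Longrightarrow>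
        (r \<otimes>\<^bsub>R\<^esub> s) \<odot>\<^bsub>M\<^esub> x = s \<odot>\<^bsub>M\<^esub> (r \<odot>\<^bsub>M\<^esub> x)"
    and smult_one: "x \<in> carrier M \<Longrightarrow> \<one>\<^bsub>R\<^esub> \<odot>\<^bsub>M\<^esub> x = x"

definition left_module_hom ::
    "('r, 'c) ring_scheme \<Rightarrow> ('r, 'm, 'd) module_scheme \<Rightarrow> ('r, 'n, 'e) module_scheme \<Rightarrow>
     ('m \<Rightarrow> 'n) set" where
  "left_module_hom R M N =
     {f \<in> carrier M \<rightarrow> carrier N.
        (\<forall>x\<in>carrier M. \<forall>y\<in>carrier M. f (x \<oplus>\<^bsub>M\<^esub> y) = f x \<oplus>\<^bsub>N\<^esub> f y) \<and>
        (\<forall>r\<in>carrier R. \<forall>x\<in>carrier M. f (r \<odot>\<^bsub>M\<^esub> x) = r \<odot>\<^bsub>N\<^esub> f x)}"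

definition free_left_module ::
    "('r, 'c) ring_scheme \<Rightarrow> 's set \<Rightarrow> ('r, 's \<Rightarrow> 'r) module" where
  "free_left_module R S =
     \<lparr> carrier = {x. (\<forall>s. x s \<in> carrier R) \<and> (\<forall>s. s \<notin> S \<longrightarrow> x s = \<zero>\<^bsub>R\<^esub>) \<and>
                      finite {s. x s \<noteq> \<zero>\<^bsub>R\<^esub>}},
       monoid.mult = undefined,
       one = undefined,
       ring.zero = (\<lambda>_. \<zero>\<^bsub>R\<^esub>),
       add = (\<lambda>x y s. x s \<oplus>\<^bsub>R\<^esub> y s),
       smult = (\<lambda>r x s. r \<otimes>\<^bsub>R\<^esub> x s) \<rparr>"

text \<open>Projective: a direct summand (retract) of a free module, with no finiteness assumption.
  Basis sets inside the type of elements of \<open>M\<close> suffice, since \<open>M\<close> is a quotient of the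
  free module on \<open>carrier M\<close>.\<close>

definition projective_left_module ::
    "('r, 'c) ring_scheme \<Rightarrow> ('r, 'm, 'd) module_scheme \<Rightarrow> bool" where
  "projective_left_module R M \<longleftrightarrow>
     left_module R M \<and>
     (\<exists>S :: 'm set.
        \<exists>i\<in>left_module_hom R M (free_left_module R S).
        \<exists>r\<in>left_module_hom R (free_left_module R S) M.
          \<forall>x\<in>carrier M. r (i x) = x)"


section \<open>Tensor products\<close>

text \<open>\<open>A \<otimes>\<^sub>R B\<close> for a right module \<open>A\<close> and a left module \<open>B\<close>: the free abelian group on
  \<open>A \<times> B\<close> modulo the subgroup generated by the relators.\<close>

definition tensor_relators ::
    "('r, 'c) ring_scheme \<Rightarrow> ('r, 'a, 'd) module_scheme \<Rightarrow> ('r, 'b, 'e) module_scheme \<Rightarrow>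
     ('a \<times> 'b \<Rightarrow>\<^sub>0 int) set" where
  "tensor_relators R A B =
     {frag_of (a \<oplus>\<^bsub>A\<^esub> a', b) - frag_of (a, b) - frag_of (a', b) | a a' b.
        a \<in> carrier A \<and> a' \<in> carrier A \<and> b \<in> carrier B} \<union>
     {frag_of (a, b \<oplus>\<^bsub>B\<^esub> b') - frag_of (a, b) - frag_of (a, b') | a b b'.
        a \<in> carrier A \<and> b \<in> carrier B \<and> b' \<in> carrier B} \<union>
     {frag_of (r \<odot>\<^bsub>A\<^esub> a, b) - frag_of (a, r \<odot>\<^bsub>B\<^esub> b) | r a b.
        r \<in> carrier R \<and> a \<in> carrier A \<and> b \<in> carrier B}"

definition tensor_kernel ::
    "('r, 'c) ring_scheme \<Rightarrow> ('r, 'a, 'd) module_scheme \<Rightarrow> ('r, 'b, 'e) module_scheme \<Rightarrow>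
     ('a \<times> 'b \<Rightarrow>\<^sub>0 int) set" where
  "tensor_kernel R A B =
     generate (free_Abelian_group (carrier A \<times> carrier B)) (tensor_relators R A B)"

definition tensor_product ::
    "('r, 'c) ring_scheme \<Rightarrow> ('r, 'a, 'd) module_scheme \<Rightarrow> ('r, 'b, 'e) module_scheme \<Rightarrow>
     ('a \<times> 'b \<Rightarrow>\<^sub>0 int) set monoid" where
  "tensor_product R A B =
     free_Abelian_group (carrier A \<times> carrier B) Mod tensor_kernel R A B"

definition pure_tensor ::
    "('r, 'c) ring_scheme \<Rightarrow> ('r, 'a, 'd) module_scheme \<Rightarrow> ('r, 'b, 'e) module_scheme \<Rightarrow>
     'a \<Rightarrow> 'b \<Rightarrow> ('a \<times> 'b \<Rightarrow>\<^sub>0 int) set" where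
  "pure_tensor R A B a b =
     tensor_kernel R A B #>\<^bsub>free_Abelian_group (carrier A \<times> carrier B)\<^esub> frag_of (a, b)"

text \<open>\<open>Id \<otimes> f\<close> from \<open>A \<otimes>\<^sub>R B\<close> to \<open>A \<otimes>\<^sub>R C\<close>: the image of a coset under the map of free abelian
  groups given by \<open>(a, b) \<mapsto> (a, f b)\<close> is enlarged to a coset of the kernel for \<open>C\<close>.\<close>

abbreviation (input) tensor_frag :: "('b \<Rightarrow> 'n) \<Rightarrow> ('a \<times> 'b \<Rightarrow>\<^sub>0 int) \<Rightarrow> ('a \<times> 'n \<Rightarrow>\<^sub>0 int)" where
  "tensor_frag f \<equiv> frag_extend (\<lambda>(a, b). frag_of (a, f b))"

definition id_tensor ::
    "('r, 'c) ring_scheme \<Rightarrow> ('r, 'a, 'd) module_scheme \<Rightarrow> ('r, 'n, 'e) module_scheme \<Rightarrow>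
     ('b \<Rightarrow> 'n) \<Rightarrow> ('a \<times> 'b \<Rightarrow>\<^sub>0 int) set \<Rightarrow> ('a \<times> 'n \<Rightarrow>\<^sub>0 int) set" where
  "id_tensor R A C f X =
     tensor_kernel R A C <#>\<^bsub>free_Abelian_group (carrier A \<times> carrier C)\<^esub>
       (tensor_frag f ` X)"


section \<open>The two coefficient modules\<close>

definition Zp_right_module :: "nat \<Rightarrow> ('g \<Rightarrow>\<^sub>0 int, int) module" where
  "Zp_right_module p =
     \<lparr> carrier = carrier (residue_ring (int p)),
       monoid.mult = monoid.mult (residue_ring (int p)),
       one = one (residue_ring (int p)),
       ring.zero = ring.zero (residue_ring (int p)),
       add = add (residue_ring (int p)),
       smult = (\<lambda>x a. a \<otimes>\<^bsub>residue_ring (int p)\<^esub> (augmentation x mod int p)) \<rparr>"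

text \<open>\<open>Q[H]\<^sup>k\<close> consists of the row vectors of length \<open>k\<close> over \<open>Q[H]\<close>, where \<open>v \<otimes> q\<close> is the vector
  with entries \<open>v\<^sub>i q\<close>.\<close>

definition row_tensor :: "'q::field vec \<Rightarrow> ('h \<Rightarrow>\<^sub>0 'q) \<Rightarrow> ('h \<Rightarrow>\<^sub>0 'q) vec" where
  "row_tensor v q = vec (dim_vec v) (\<lambda>i. pm_scale (v $ i) q)"

definition row_mult :: "'q::field vec \<Rightarrow> 'q mat \<Rightarrow> 'q vec" where
  "row_mult v A = row (mat_of_row v * A) 0"

text \<open>The action of a group element \<open>g\<close>: right multiplication by the \<open>k \<times> k\<close> matrix with entries
  \<open>\<alpha>(g)\<^sub>i\<^sub>j \<phi>(g)\<close> in \<open>Q[H]\<close>.\<close>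

definition twisted_act ::
    "('h, 'c) monoid_scheme \<Rightarrow> nat \<Rightarrow> ('g \<Rightarrow> 'q::field mat) \<Rightarrow> ('g \<Rightarrow> 'h) \<Rightarrow>
     ('h \<Rightarrow>\<^sub>0 'q) vec \<Rightarrow> 'g \<Rightarrow> ('h \<Rightarrow>\<^sub>0 'q) vec" where
  "twisted_act H k \<alpha> \<phi> w g =
     vec k (\<lambda>j. \<Sum>i<k. group_ring_mult H (w $ i) (Poly_Mapping.single (\<phi> g) (\<alpha> g $$ (i, j))))"

definition twisted_right_module ::
    "('h, 'c) monoid_scheme \<Rightarrow> nat \<Rightarrow> ('g \<Rightarrow> 'q::field mat) \<Rightarrow> ('g \<Rightarrow> 'h) \<Rightarrow>
     ('g \<Rightarrow>\<^sub>0 int, ('h \<Rightarrow>\<^sub>0 'q) vec) module" where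
  "twisted_right_module H k \<alpha> \<phi> =
     \<lparr> carrier = {w \<in> carrier_vec k. \<forall>i<k. w $ i \<in> carrier (group_ring H)},
       monoid.mult = undefined,
       one = undefined,
       ring.zero = 0\<^sub>v k,
       add = (+),
       smult = (\<lambda>x w. vec k (\<lambda>j. \<Sum>g\<in>Poly_Mapping.keys x.
                  pm_scale (of_int (Poly_Mapping.lookup x g))
                    (twisted_act H k \<alpha> \<phi> w g $ j))) \<rparr>"


section \<open>Basic facts\<close>

lemma free_left_module:
  assumes "ring R"
  shows "left_module R (free_left_module R S)"
proof -
  interpret R: ring R by fact
  have fin: "finite {s. x s \<oplus>\<^bsub>R\<^esub> y s \<noteq> \<zero>\<^bsub>R\<^esub>}"
    if "finite {s. x s \<noteq> \<zero>\<^bsub>R\<^esub>}" "finite {s. y s \<noteq> \<zero>\<^bsub>R\<^esub>}" for x y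
    by (rule finite_subset[OF _ finite_UnI[OF that]]) auto
  have fin': "finite {s. r \<otimes>\<^bsub>R\<^esub> x s \<noteq> \<zero>\<^bsub>R\<^esub>}"
    if "finite {s. x s \<noteq> \<zero>\<^bsub>R\<^esub>}" "r \<in> carrier R" for r x
    by (rule finite_subset[OF _ that(1)]) (use that in auto)
  have "abelian_group (free_left_module R S)"
  proof (rule abelian_groupI)
    fix x assume x: "x \<in> carrier (free_left_module R S)"
    have "finite {s. \<ominus>\<^bsub>R\<^esub> x s \<noteq> \<zero>\<^bsub>R\<^esub>}"
      by (rule finite_subset[of _ "{s. x s \<noteq> \<zero>\<^bsub>R\<^esub>}"]) (use x in \<open>auto simp: free_left_module_def\<close>)
    then show "\<exists>y\<in>carrier (free_left_module R S). y \<oplus>\<^bsub>free_left_module R S\<^esub> x = \<zero>\<^bsub>free_left_module R S\<^esub>"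
      using x by (intro bexI[of _ "\<lambda>s. \<ominus>\<^bsub>R\<^esub> x s"]) (auto simp: free_left_module_def R.l_neg)
  qed (auto simp: free_left_module_def fun_eq_iff fin R.a_assoc intro: R.a_comm)
  then show ?thesis
    by (intro left_module.intro left_module_axioms.intro assms)
       (auto simp: free_left_module_def fun_eq_iff fin' R.l_distr R.r_distr R.m_assoc)
qed

lemma pm_induct[consumes 1]:
  fixes x :: "'a \<Rightarrow>\<^sub>0 'b::comm_monoid_add"
  assumes k: "Poly_Mapping.keys x \<subseteq> S" and z: "P 0"
    and s: "\<And>g a. g \<in> S \<Longrightarrow> P (Poly_Mapping.single g a)"
    and a: "\<And>x y. P x \<Longrightarrow> P y \<Longrightarrow> P (x + y)"
  shows "P x"
proof -
  have "P (\<Sum>g\<in>F. Poly_Mapping.single g (Poly_Mapping.lookup x g))" if "finite F" "F \<subseteq> S" for F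
    using that by (induction F rule: finite_induct) (auto simp: z s a)
  moreover have "(\<Sum>g\<in>Poly_Mapping.keys x. Poly_Mapping.single g (Poly_Mapping.lookup x g)) = x"
    by (rule poly_mapping_eqI)
       (auto simp: Poly_Mapping.lookup_sum Poly_Mapping.lookup_single when_def sum.delta' in_keys_iff)
  ultimately show ?thesis using k by (metis finite_keys)
qed

lemma pm_sum_superset:
  fixes F :: "'a \<Rightarrow> 'b::zero \<Rightarrow> 'c::comm_monoid_add"
  assumes "finite A" "Poly_Mapping.keys x \<subseteq> A" "\<And>g. F g 0 = 0"
  shows "(\<Sum>g\<in>Poly_Mapping.keys x. F g (Poly_Mapping.lookup x g)) = (\<Sum>g\<in>A. F g (Poly_Mapping.lookup x g))"
  using assms by (intro sum.mono_neutral_left) (auto simp: in_keys_iff)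

lemma pm_sum_add:
  fixes F :: "'a \<Rightarrow> 'b::comm_monoid_add \<Rightarrow> 'c::comm_monoid_add"
  assumes z: "\<And>g. F g 0 = 0" and a: "\<And>g c d. F g (c + d) = F g c + F g d"
  shows "(\<Sum>g\<in>Poly_Mapping.keys (x+y). F g (Poly_Mapping.lookup (x+y) g)) =
    (\<Sum>g\<in>Poly_Mapping.keys x. F g (Poly_Mapping.lookup x g)) +
    (\<Sum>g\<in>Poly_Mapping.keys y. F g (Poly_Mapping.lookup y g))"
proof -
  let ?A = "Poly_Mapping.keys x \<union> Poly_Mapping.keys y"
  have "finite ?A" "Poly_Mapping.keys (x+y) \<subseteq> ?A" by (auto simp: Poly_Mapping.keys_add)
  then show ?thesis
    using pm_sum_superset[of ?A x F] pm_sum_superset[of ?A y F] pm_sum_superset[of ?A "x+y" F]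
    by (simp add: z a Poly_Mapping.lookup_add sum.distrib)
qed

lemma gm_add_l: "group_ring_mult G (x + y) z = group_ring_mult G x z + group_ring_mult G y z"
  unfolding group_ring_mult_def
  by (rule pm_sum_add) (auto simp: algebra_simps single_add sum.distrib)

lemma gm_add_r: "group_ring_mult G z (x + y) = group_ring_mult G z x + group_ring_mult G z y"
  unfolding group_ring_mult_def sum.distrib[symmetric]
  by (intro sum.cong refl pm_sum_add) (auto simp: algebra_simps single_add)

lemma gm_0[simp]: "group_ring_mult G 0 x = 0" "group_ring_mult G x 0 = 0"
  by (auto simp: group_ring_mult_def)

lemma gm_single[simp]: "group_ring_mult G (Poly_Mapping.single g a) (Poly_Mapping.single h b) =
   Poly_Mapping.single (g \<otimes>\<^bsub>G\<^esub> h) (a * b)"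
  by (auto simp: group_ring_mult_def)

lemma gm_closed: assumes "group G" "Poly_Mapping.keys x \<subseteq> carrier G" "Poly_Mapping.keys y \<subseteq> carrier G"
  shows "Poly_Mapping.keys (group_ring_mult G x y) \<subseteq> carrier G"
proof -
  interpret group G by fact
  show ?thesis using assms(2,3) unfolding group_ring_mult_def
    by (intro order_trans[OF Poly_Mapping.keys_sum] UN_least) auto
qed

lemma gm_assoc: assumes "group G" "Poly_Mapping.keys x \<subseteq> carrier G" "Poly_Mapping.keys y \<subseteq> carrier G"
  "Poly_Mapping.keys z \<subseteq> carrier G"
  shows "group_ring_mult G (group_ring_mult G x y) z = group_ring_mult G x (group_ring_mult G y z)"
proof -
  interpret group G by fact
  show ?thesis using assms(2)
  proof (induction x rule: pm_induct)
    fix g a assume g: "g \<in> carrier G"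
    show "group_ring_mult G (group_ring_mult G (Poly_Mapping.single g a) y) z = group_ring_mult G (Poly_Mapping.single g a) (group_ring_mult G y z)"
      using assms(3)
    proof (induction y rule: pm_induct)
      fix h b assume h: "h \<in> carrier G"
      show "group_ring_mult G (group_ring_mult G (Poly_Mapping.single g a) (Poly_Mapping.single h b)) z = group_ring_mult G (Poly_Mapping.single g a) (group_ring_mult G (Poly_Mapping.single h b) z)"
        using assms(4)
        by (induction z rule: pm_induct) (auto simp: gm_add_r g h m_assoc mult.assoc)
    qed (auto simp: gm_add_l gm_add_r)
  qed (auto simp: gm_add_l)
qed

lemma gm_one: assumes "group G" "Poly_Mapping.keys x \<subseteq> carrier G"
  shows "group_ring_mult G (Poly_Mapping.single \<one>\<^bsub>G\<^esub> 1) x = x" "group_ring_mult G x (Poly_Mapping.single \<one>\<^bsub>G\<^esub> 1) = x"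
proof -
  interpret group G by fact
  show "group_ring_mult G (Poly_Mapping.single \<one>\<^bsub>G\<^esub> 1) x = x" using assms(2)
    by (induction x rule: pm_induct) (auto simp: gm_add_r)
  show "group_ring_mult G x (Poly_Mapping.single \<one>\<^bsub>G\<^esub> 1) = x" using assms(2)
    by (induction x rule: pm_induct) (auto simp: gm_add_l)
qed

lemma ring_group_ring: fixes G :: "('a, 'b) monoid_scheme" assumes "group G" shows "ring (group_ring G :: ('a \<Rightarrow>\<^sub>0 'c::comm_ring_1) ring)"
proof (rule ringI)
  interpret group G by fact
  show "abelian_group (group_ring G :: ('a \<Rightarrow>\<^sub>0 'c) ring)"
  proof (rule abelian_groupI)
    fix x :: "'a \<Rightarrow>\<^sub>0 'c" assume "x \<in> carrier (group_ring G)"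
    then show "\<exists>y\<in>carrier (group_ring G). y \<oplus>\<^bsub>group_ring G\<^esub> x = \<zero>\<^bsub>group_ring G\<^esub>"
      by (intro bexI[of _ "- x"]) (auto simp: group_ring_def)
  qed (auto simp: group_ring_def algebra_simps dest: subsetD[OF Poly_Mapping.keys_add])
  show "monoid (group_ring G)"
    by (rule monoidI) (auto simp: group_ring_def gm_assoc gm_one assms dest: subsetD[OF gm_closed[OF assms]])
qed (auto simp: group_ring_def gm_add_l gm_add_r)

lemma lookup_scal[simp]: "Poly_Mapping.lookup (pm_scale c q) g = c * Poly_Mapping.lookup q g"
  by (transfer) (auto simp: when_def)

lemma scal_simps: "pm_scale 0 q = 0" "pm_scale c 0 = 0" "pm_scale (c+d) q = pm_scale c q + pm_scale d q"
  "pm_scale c (q + r) = pm_scale c q + pm_scale c r" "pm_scale 1 q = q" "pm_scale c (pm_scale d q) = pm_scale (c*d) q"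
  by (auto intro!: poly_mapping_eqI simp: Poly_Mapping.lookup_add algebra_simps)

lemma scal_0: "Poly_Mapping.map (\<lambda>a. 0) q = 0"
  by (rule poly_mapping_eqI, transfer) (auto simp: when_def)

lemma scal_sum: "pm_scale c (sum F A) = (\<Sum>a\<in>A. pm_scale c (F a))"
  by (induction A rule: infinite_finite_induct) (auto simp: scal_simps)

lemma gm_scal: "group_ring_mult G (pm_scale c x) y = pm_scale c (group_ring_mult G x y)"
proof (rule pm_induct[of x UNIV])
  fix g a
  show "group_ring_mult G (pm_scale c (Poly_Mapping.single g a)) y = pm_scale c (group_ring_mult G (Poly_Mapping.single g a) y)"
    by (rule pm_induct[of y UNIV]) (auto simp: gm_add_r scal_simps mult.assoc)
qed (auto simp: scal_simps gm_add_l)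

lemma gm_sum_l: "group_ring_mult G (sum F A) y = (\<Sum>a\<in>A. group_ring_mult G (F a) y)"
  by (induction A rule: infinite_finite_induct) (auto simp: gm_add_l)
lemma gm_sum_r: "group_ring_mult G y (sum F A) = (\<Sum>a\<in>A. group_ring_mult G y (F a))"
  by (induction A rule: infinite_finite_induct) (auto simp: gm_add_r)

lemma single_sum: "Poly_Mapping.single g (sum F A) = (\<Sum>a\<in>A. Poly_Mapping.single g (F a))"
  by (induction A rule: infinite_finite_induct) (auto simp: single_add)

lemma augmentation_add: "augmentation (x + y) = augmentation x + augmentation y"
  unfolding augmentation_def by (rule pm_sum_add) auto
lemma augmentation_single[simp]: "augmentation (Poly_Mapping.single g a) = a"
  by (auto simp: augmentation_def)
lemma augmentation_mult: "augmentation (group_ring_mult G x y) = augmentation x * augmentation y"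
proof (rule pm_induct[of x UNIV])
  fix g a
  show "augmentation (group_ring_mult G (Poly_Mapping.single g a) y) = augmentation (Poly_Mapping.single g a) * augmentation y"
    by (rule pm_induct[of y UNIV]) (auto simp: gm_add_r augmentation_add algebra_simps, auto simp: augmentation_def)
qed (auto simp: gm_add_l augmentation_add algebra_simps, auto simp: augmentation_def)

lemma twisted_act_row_tensor:
  assumes v: "v \<in> carrier_vec k" and a: "\<alpha> g \<in> carrier_mat k k"
  shows "twisted_act H k \<alpha> \<phi> (row_tensor v q) g =
    row_tensor (row_mult v (\<alpha> g)) (group_ring_mult H q (Poly_Mapping.single (\<phi> g) 1))"
proof (rule eq_vecI)
  have d: "dim_vec (row_mult v (\<alpha> g)) = k" using a by (auto simp: row_mult_def)
  show "dim_vec (twisted_act H k \<alpha> \<phi> (row_tensor v q) g) = dim_vec (row_tensor (row_mult v (\<alpha> g)) (group_ring_mult H q (Poly_Mapping.single (\<phi> g) 1)))"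
    by (simp add: twisted_act_def row_tensor_def d)
  fix j assume "j < dim_vec (row_tensor (row_mult v (\<alpha> g)) (group_ring_mult H q (Poly_Mapping.single (\<phi> g) 1)))"
  then have j: "j < k" by (simp add: row_tensor_def d)
  have e: "row_mult v (\<alpha> g) $ j = (\<Sum>i<k. v $ i * \<alpha> g $$ (i,j))"
    using v a j by (auto simp: row_mult_def scalar_prod_def lessThan_atLeast0)
  have s: "pm_scale (sum F A) q = (\<Sum>a\<in>A. pm_scale (F a) q)" for F and A :: "nat set" and q
    by (induction A rule: infinite_finite_induct) (auto simp: scal_simps scal_0)
  have m: "group_ring_mult H q (Poly_Mapping.single (\<phi> g) c) = pm_scale c (group_ring_mult H q (Poly_Mapping.single (\<phi> g) 1))" for c
  proof (rule pm_induct[of q UNIV])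
    fix h a
    show "group_ring_mult H (Poly_Mapping.single h a) (Poly_Mapping.single (\<phi> g) c) =
        pm_scale c (group_ring_mult H (Poly_Mapping.single h a) (Poly_Mapping.single (\<phi> g) 1))"
      by (simp, rule arg_cong, rule mult.commute)
  qed (simp_all add: gm_add_l scal_simps(2-))
  show "twisted_act H k \<alpha> \<phi> (row_tensor v q) g $ j = row_tensor (row_mult v (\<alpha> g)) (group_ring_mult H q (Poly_Mapping.single (\<phi> g) 1)) $ j"
    using v j d by (simp add: twisted_act_def row_tensor_def e s gm_scal m[of "\<alpha> g $$ _"] scal_simps)
qed

lemma Zp_right_module:
  assumes "group G" "prime (p::nat)"
  shows "right_module (group_ring G) (Zp_right_module p)"
proof -
  interpret residues_prime p "residue_ring (int p)" by (unfold_locales) (use assms in auto)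
  interpret G: ring "group_ring G :: ('a \<Rightarrow>\<^sub>0 int) ring" using ring_group_ring assms(1) by blast
  have p: "int p > 0" using assms(2) prime_gt_0_nat by auto
  have pm: "1 + y mod int p \<le> int p" for y
    using pos_mod_bound[OF p, of y] by linarith
  show ?thesis
  proof (intro right_module.intro right_module_axioms.intro G.ring_axioms)
    show "abelian_group (Zp_right_module p :: ('a \<Rightarrow>\<^sub>0 int, int) module)"
    proof (rule abelian_groupI)
      fix x assume "x \<in> carrier (Zp_right_module p :: ('a \<Rightarrow>\<^sub>0 int, int) module)"
      then have x: "x \<in> carrier (residue_ring (int p))" by (simp add: Zp_right_module_def)
      have *: "add (Zp_right_module p :: ('a \<Rightarrow>\<^sub>0 int, int) module) = add (residue_ring (int p))"
        "\<zero>\<^bsub>Zp_right_module p :: ('a \<Rightarrow>\<^sub>0 int, int) module\<^esub> = \<zero>\<^bsub>residue_ring (int p)\<^esub>"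
        "carrier (Zp_right_module p :: ('a \<Rightarrow>\<^sub>0 int, int) module) = carrier (residue_ring (int p))"
        by (auto simp: Zp_right_module_def)
      show "\<exists>y\<in>carrier (Zp_right_module p :: ('a \<Rightarrow>\<^sub>0 int, int) module). y \<oplus>\<^bsub>Zp_right_module p :: ('a \<Rightarrow>\<^sub>0 int, int) module\<^esub> x = \<zero>\<^bsub>Zp_right_module p :: ('a \<Rightarrow>\<^sub>0 int, int) module\<^esub>"
        unfolding * using x l_neg a_inv_closed by blast
    qed (auto simp: Zp_right_module_def a_assoc intro: a_comm)
  qed (use p in \<open>auto simp: pm Zp_right_module_def residue_ring_def group_ring_def augmentation_add augmentation_mult mod_simps algebra_simps\<close>)
qed

lemma twisted_right_module:
  fixes \<alpha> :: "'g \<Rightarrow> 'q::field mat"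
  assumes G: "group G" and H: "group H" and f: "\<phi> \<in> hom G H" and a: "\<alpha> \<in> hom G (GL k)"
  shows "right_module (group_ring G) (twisted_right_module H k \<alpha> \<phi>)"
proof -
  interpret G: group G by fact
  interpret H: group H by fact
  interpret R: ring "group_ring G :: ('g \<Rightarrow>\<^sub>0 int) ring" using ring_group_ring G by blast
  let ?T = "twisted_right_module H k \<alpha> \<phi>"
  let ?C = "{w \<in> carrier_vec k. \<forall>i<k. Poly_Mapping.keys (w $ i) \<subseteq> carrier H}"
  define A where "A = twisted_act H k \<alpha> \<phi>"
  have C: "carrier ?T = ?C" by (simp add: twisted_right_module_def group_ring_def)
  have ac: "\<alpha> g \<in> carrier_mat k k" if "g \<in> carrier G" for g
    using hom_in_carrier[OF a that] by (auto simp: GL_def units_of_def Units_def ring_mat_def)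
  have fc: "\<phi> g \<in> carrier H" if "g \<in> carrier G" for g
    using hom_in_carrier[OF f that] .
  have am: "\<alpha> (g \<otimes>\<^bsub>G\<^esub> h) = \<alpha> g * \<alpha> h" if "g \<in> carrier G" "h \<in> carrier G" for g h
    using hom_mult[OF a that] by (auto simp: GL_def units_of_def ring_mat_def)
  have GLg: "group (GL k :: 'q mat monoid)"
    unfolding GL_def by (intro monoid.units_group) (use ring_mat[of k "()"] in \<open>auto simp: ring_def\<close>)
  have a1: "\<alpha> \<one>\<^bsub>G\<^esub> = 1\<^sub>m k" using hom_one[OF a G GLg] by (auto simp: GL_def units_of_def ring_mat_def)
  have f1: "\<phi> \<one>\<^bsub>G\<^esub> = \<one>\<^bsub>H\<^esub>" using hom_one[OF f G H] .
  have Aj: "A w g $ j = (\<Sum>i<k. group_ring_mult H (w $ i) (Poly_Mapping.single (\<phi> g) (\<alpha> g $$ (i, j))))" if "j < k" for w g j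
    using that by (simp add: A_def twisted_act_def)
  have Ad[simp]: "dim_vec (A w g) = k" for w g by (simp add: A_def twisted_act_def)
  have Aadd: "A (w + w') g = A w g + A w' g" if "w \<in> ?C" "w' \<in> ?C" for w w' g
    by (rule eq_vecI) (use that in \<open>auto simp: Aj gm_add_l sum.distrib\<close>)
  have Acl: "A w g \<in> ?C" if "w \<in> ?C" "g \<in> carrier G" for w g
  proof -
    have "Poly_Mapping.keys (A w g $ j) \<subseteq> carrier H" if "j < k" for j
      unfolding Aj[OF that]
      by (intro order_trans[OF Poly_Mapping.keys_sum] UN_least gm_closed) (use \<open>w \<in> ?C\<close> \<open>g \<in> _\<close> H fc in auto)
    then show ?thesis using carrier_vecI[OF Ad] by auto
  qed
  have A1: "A w \<one>\<^bsub>G\<^esub> = w" if "w \<in> ?C" for w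
  proof (rule eq_vecI)
    fix j assume "j < dim_vec w" then have j: "j < k" using that by auto
    have "A w \<one>\<^bsub>G\<^esub> $ j = (\<Sum>i<k. if i = j then w $ i else 0)"
      unfolding Aj[OF j] by (intro sum.cong refl) (use j that in \<open>auto simp: a1 f1 gm_one H\<close>)
    then show "A w \<one>\<^bsub>G\<^esub> $ j = w $ j" using j by simp
  qed (use that in auto)
  have Am: "A w (g \<otimes>\<^bsub>G\<^esub> h) = A (A w g) h" if w: "w \<in> ?C" and g: "g \<in> carrier G" and h: "h \<in> carrier G" for w g h
  proof (rule eq_vecI)
    fix j assume "j < dim_vec (A (A w g) h)" then have j: "j < k" by simp
    have "A (A w g) h $ j = (\<Sum>l<k. \<Sum>i<k. group_ring_mult H (group_ring_mult H (w $ i) (Poly_Mapping.single (\<phi> g) (\<alpha> g $$ (i, l)))) (Poly_Mapping.single (\<phi> h) (\<alpha> h $$ (l, j))))"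
      using j by (simp add: Aj gm_sum_l)
    also have "\<dots> = (\<Sum>l<k. \<Sum>i<k. group_ring_mult H (w $ i) (Poly_Mapping.single (\<phi> g \<otimes>\<^bsub>H\<^esub> \<phi> h) (\<alpha> g $$ (i, l) * \<alpha> h $$ (l, j))))"
      by (intro sum.cong refl) (use w g h fc in \<open>auto simp: gm_assoc H\<close>)
    also have "\<dots> = (\<Sum>i<k. \<Sum>l<k. group_ring_mult H (w $ i) (Poly_Mapping.single (\<phi> g \<otimes>\<^bsub>H\<^esub> \<phi> h) (\<alpha> g $$ (i, l) * \<alpha> h $$ (l, j))))"
      by (rule sum.swap)
    also have "\<dots> = A w (g \<otimes>\<^bsub>G\<^esub> h) $ j"
      unfolding Aj[OF j]
    proof (intro sum.cong refl)
      fix i assume i: "i \<in> {..<k}"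
      have "\<alpha> (g \<otimes>\<^bsub>G\<^esub> h) $$ (i,j) = (\<Sum>l<k. \<alpha> g $$ (i, l) * \<alpha> h $$ (l, j))"
        using i j ac[OF g] ac[OF h] by (auto simp: am g h scalar_prod_def lessThan_atLeast0)
      then show "(\<Sum>l<k. group_ring_mult H (w $ i) (Poly_Mapping.single (\<phi> g \<otimes>\<^bsub>H\<^esub> \<phi> h) (\<alpha> g $$ (i, l) * \<alpha> h $$ (l, j)))) = group_ring_mult H (w $ i) (Poly_Mapping.single (\<phi> (g \<otimes>\<^bsub>G\<^esub> h)) (\<alpha> (g \<otimes>\<^bsub>G\<^esub> h) $$ (i, j)))"
        by (simp add: hom_mult[OF f g h] single_sum gm_sum_r)
    qed
    finally show "A w (g \<otimes>\<^bsub>G\<^esub> h) $ j = A (A w g) h $ j" by simp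
  qed simp
  define sm where "sm = (\<lambda>(x::'g \<Rightarrow>\<^sub>0 int) w. vec k (\<lambda>j. \<Sum>g\<in>Poly_Mapping.keys x. pm_scale (of_int (Poly_Mapping.lookup x g)) (A w g $ j)))"
  have sm: "x \<odot>\<^bsub>?T\<^esub> w = sm x w" for x w by (simp add: sm_def A_def twisted_right_module_def)
  have sd[simp]: "dim_vec (sm x w) = k" for x w by (simp add: sm_def)
  have sj: "sm x w $ j = (\<Sum>g\<in>Poly_Mapping.keys x. pm_scale (of_int (Poly_Mapping.lookup x g)) (A w g $ j))" if "j < k" for x w j
    using that by (simp add: sm_def)
  have s_addl: "sm (x + y) w = sm x w + sm y w" for x y w
  proof (rule eq_vecI)
    fix j assume "j < dim_vec (sm x w + sm y w)" then have j: "j < k" by simp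
    show "sm (x + y) w $ j = (sm x w + sm y w) $ j" using j
      by (simp add: sj, intro pm_sum_add) (auto simp: scal_simps scal_0)
  qed simp
  have s_addr: "sm x (w + w') = sm x w + sm x w'" if "w \<in> ?C" "w' \<in> ?C" for x w w'
    by (rule eq_vecI) (use that in \<open>auto simp: sj Aadd scal_simps sum.distrib\<close>)
  have keys_scal: "Poly_Mapping.keys (pm_scale c q) \<subseteq> Poly_Mapping.keys q" for c and q :: "'b \<Rightarrow>\<^sub>0 'q"
    by (auto simp: in_keys_iff)
  have s_cl: "sm x w \<in> ?C" if x: "Poly_Mapping.keys x \<subseteq> carrier G" and w: "w \<in> ?C" for x w
  proof -
    have "Poly_Mapping.keys (sm x w $ j) \<subseteq> carrier H" if "j < k" for j
      unfolding sj[OF that] using Acl[OF w] x that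
      by (intro order_trans[OF Poly_Mapping.keys_sum] UN_least order_trans[OF keys_scal]) auto
    then show ?thesis using carrier_vecI[OF sd] by auto
  qed
  have s_single: "sm (Poly_Mapping.single g c) w = vec k (\<lambda>j. pm_scale (of_int c) (A w g $ j))" for g c w
    by (rule eq_vecI) (auto simp: sj scal_simps)
  have A_scal: "A (vec k (\<lambda>j. pm_scale c (w $ j))) g = vec k (\<lambda>j. pm_scale c (A w g $ j))" for c w g
    by (rule eq_vecI) (auto simp: Aj gm_scal scal_sum)
  have s0: "sm 0 w = 0\<^sub>v k" for w by (rule eq_vecI) (auto simp: sj)
  have A0: "A (0\<^sub>v k) g = 0\<^sub>v k" for g by (rule eq_vecI) (auto simp: Aj)
  have s0': "sm x (0\<^sub>v k) = 0\<^sub>v k" for x by (rule eq_vecI) (auto simp: sj A0 scal_simps)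
  have s_mult: "sm (group_ring_mult G x y) w = sm y (sm x w)"
    if x: "Poly_Mapping.keys x \<subseteq> carrier G" and y: "Poly_Mapping.keys y \<subseteq> carrier G" and w: "w \<in> ?C" for x y w
  proof -
    have "Poly_Mapping.keys x \<subseteq> carrier G \<and> sm (group_ring_mult G x y) w = sm y (sm x w)" using x
    proof (induction x rule: pm_induct)
      fix g a assume g: "g \<in> carrier G"
      show "Poly_Mapping.keys (Poly_Mapping.single g a) \<subseteq> carrier G \<and>
        sm (group_ring_mult G (Poly_Mapping.single g a) y) w = sm y (sm (Poly_Mapping.single g a) w)"
      proof
        show "sm (group_ring_mult G (Poly_Mapping.single g a) y) w = sm y (sm (Poly_Mapping.single g a) w)"
          using y
        proof (induction y rule: pm_induct)
          fix h b assume h: "h \<in> carrier G"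
          show "sm (group_ring_mult G (Poly_Mapping.single g a) (Poly_Mapping.single h b)) w = sm (Poly_Mapping.single h b) (sm (Poly_Mapping.single g a) w)"
            by (rule eq_vecI) (auto simp: s_single A_scal Am[OF w g h] scal_simps mult.commute)
        qed (auto simp: gm_add_r s_addl s0)
      qed (use g in auto)
    next
      fix x x' assume *: "Poly_Mapping.keys x \<subseteq> carrier G \<and> sm (group_ring_mult G x y) w = sm y (sm x w)"
       "Poly_Mapping.keys x' \<subseteq> carrier G \<and> sm (group_ring_mult G x' y) w = sm y (sm x' w)"
      then show "Poly_Mapping.keys (x+x') \<subseteq> carrier G \<and> sm (group_ring_mult G (x+x') y) w = sm y (sm (x+x') w)"
        using Poly_Mapping.keys_add[of x x'] s_cl[of x w] s_cl[of x' w] w by (auto simp: gm_add_l s_addl s_addr)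
    qed (auto simp: s0 s0')
    then show ?thesis by simp
  qed
  have s1: "sm (Poly_Mapping.single \<one>\<^bsub>G\<^esub> 1) w = w" if "w \<in> ?C" for w
    by (rule eq_vecI) (use that in \<open>auto simp: s_single A1 scal_simps\<close>)
  have ab: "abelian_group ?T"
  proof (rule abelian_groupI)
    fix w assume "w \<in> carrier ?T"
    then have w: "w \<in> ?C" using C by simp
    show "\<exists>y\<in>carrier ?T. y \<oplus>\<^bsub>?T\<^esub> w = \<zero>\<^bsub>?T\<^esub>"
      by (rule bexI[of _ "- w"], unfold C) (use w in \<open>auto simp: twisted_right_module_def subset_iff\<close>)
  next
    fix v w assume "v \<in> carrier ?T" "w \<in> carrier ?T"
    then have vw: "v \<in> ?C" "w \<in> ?C" using C by auto
    have "Poly_Mapping.keys ((v + w) $ i) \<subseteq> carrier H" if "i < k" for i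
      using vw that Poly_Mapping.keys_add[of "v $ i" "w $ i"] by (auto simp: subset_iff)
    then show "v \<oplus>\<^bsub>?T\<^esub> w \<in> carrier ?T"
      unfolding C using vw by (auto simp: twisted_right_module_def simp del: index_add_vec)
    show "v \<oplus>\<^bsub>?T\<^esub> w = w \<oplus>\<^bsub>?T\<^esub> v"
      using vw comm_add_vec[of v k w] by (simp add: twisted_right_module_def)
  next
    fix u v w assume "u \<in> carrier ?T" "v \<in> carrier ?T" "w \<in> carrier ?T"
    then show "u \<oplus>\<^bsub>?T\<^esub> v \<oplus>\<^bsub>?T\<^esub> w = u \<oplus>\<^bsub>?T\<^esub> (v \<oplus>\<^bsub>?T\<^esub> w)"
      using assoc_add_vec[of u k v w] by (simp add: twisted_right_module_def)
  qed (unfold C, auto simp: twisted_right_module_def)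
  show ?thesis
  proof (intro right_module.intro right_module_axioms.intro R.ring_axioms ab)
  qed (unfold C sm, auto simp: group_ring_def s_addl s_addr s_mult s1 s_cl[simplified] 
      simp: twisted_right_module_def[of H])
qed

lemma tensor_relators_closed:
  assumes A: "right_module R A" and B: "left_module R B"
  shows "tensor_relators R A B \<subseteq> carrier (free_Abelian_group (carrier A \<times> carrier B))"
proof -
  interpret A: right_module R A by fact
  interpret B: left_module R B by fact
  have d: "x - y \<in> carrier (free_Abelian_group S)" if "x \<in> carrier (free_Abelian_group S)"
    "y \<in> carrier (free_Abelian_group S)" for x y :: "'x \<Rightarrow>\<^sub>0 int" and S
    using that keys_diff[of x y] by (auto simp: free_Abelian_group_def)
  have o: "frag_of (a, b) \<in> carrier (free_Abelian_group (carrier A \<times> carrier B))"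
    if "a \<in> carrier A" "b \<in> carrier B" for a b
    using that by simp
  show ?thesis unfolding tensor_relators_def
    by (intro Un_least subsetI; elim CollectE exE conjE; hypsubst;
        intro d o A.smult_closed B.smult_closed A.M.add.m_closed B.M.add.m_closed; assumption)
qed

lemma tensor_kernel_subgroup:
  assumes "right_module R A" "left_module R B"
  shows "subgroup (tensor_kernel R A B) (free_Abelian_group (carrier A \<times> carrier B))"
  unfolding tensor_kernel_def
  by (intro group.generate_is_subgroup group_free_Abelian_group tensor_relators_closed assms)

context
  fixes R :: "('r, 'c) ring_scheme" and A :: "('r, 'a, 'd) module_scheme"
    and B :: "('r, 'b, 'e) module_scheme" and C :: "('r, 'n, 'w) module_scheme" and f :: "'b \<Rightarrow> 'n"
  assumes A: "right_module R A" and B: "left_module R B" and C: "left_module R C"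
    and f: "f \<in> left_module_hom R B C"
begin

lemma kernel_map: "x \<in> tensor_kernel R A B \<Longrightarrow> tensor_frag f x \<in> tensor_kernel R A C"
proof -
  have rel: "tensor_frag f x \<in> tensor_relators R A C" if x: "x \<in> tensor_relators R A B" for x
  proof -
    have fc: "f b \<in> carrier C" if "b \<in> carrier B" for b
      using f that by (auto simp: left_module_hom_def)
    have fa: "f (b \<oplus>\<^bsub>B\<^esub> b') = f b \<oplus>\<^bsub>C\<^esub> f b'" if "b \<in> carrier B" "b' \<in> carrier B" for b b'
      using f that by (simp add: left_module_hom_def)
    have fs: "f (r \<odot>\<^bsub>B\<^esub> b) = r \<odot>\<^bsub>C\<^esub> f b" if "r \<in> carrier R" "b \<in> carrier B" for r b
      using f that by (simp add: left_module_hom_def)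
    consider
        (add1) a a' b where "a \<in> carrier A" "a' \<in> carrier A" "b \<in> carrier B"
          "x = frag_of (a \<oplus>\<^bsub>A\<^esub> a', b) - frag_of (a, b) - frag_of (a', b)"
      | (add2) a b b' where "a \<in> carrier A" "b \<in> carrier B" "b' \<in> carrier B"
          "x = frag_of (a, b \<oplus>\<^bsub>B\<^esub> b') - frag_of (a, b) - frag_of (a, b')"
      | (scalar) r a b where "r \<in> carrier R" "a \<in> carrier A" "b \<in> carrier B"
          "x = frag_of (r \<odot>\<^bsub>A\<^esub> a, b) - frag_of (a, r \<odot>\<^bsub>B\<^esub> b)"
      by (insert x[unfolded tensor_relators_def], elim UnE CollectE exE conjE;
          ((rule that(1); assumption) | (rule that(2); assumption) | (rule that(3); assumption)))
    then show ?thesis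
    proof cases
      case add1
      then have eq: "tensor_frag f x = frag_of (a \<oplus>\<^bsub>A\<^esub> a', f b) - frag_of (a, f b) - frag_of (a', f b)"
        by (simp add: frag_extend_diff)
      show ?thesis unfolding tensor_relators_def
        by (rule UnI1, rule UnI1, intro CollectI exI conjI, rule eq) (rule fc[OF add1(3)] add1(1,2))+
    next
      case add2
      then have eq: "tensor_frag f x = frag_of (a, f b \<oplus>\<^bsub>C\<^esub> f b') - frag_of (a, f b) - frag_of (a, f b')"
        by (simp add: frag_extend_diff fa)
      show ?thesis unfolding tensor_relators_def
        by (rule UnI1, rule UnI2, intro CollectI exI conjI, rule eq) (rule fc[OF add2(2)] fc[OF add2(3)] add2(1))+
    next
      case scalar
      then have eq: "tensor_frag f x = frag_of (r \<odot>\<^bsub>A\<^esub> a, f b) - frag_of (a, r \<odot>\<^bsub>C\<^esub> f b)"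
        by (simp add: frag_extend_diff fs)
      show ?thesis unfolding tensor_relators_def
        by (rule UnI2, intro CollectI exI conjI, rule eq) (rule fc[OF scalar(3)] scalar(1,2))+
    qed
  qed
  assume "x \<in> tensor_kernel R A B"
  then show ?thesis unfolding tensor_kernel_def
  proof (induction rule: generate.induct)
    case one
    then show ?case using generate.one[of "free_Abelian_group (carrier A \<times> carrier C)"] by simp
  next
    case (incl h)
    show ?case by (rule generate.incl[OF rel[OF incl]])
  next
    case (inv h)
    have "h \<in> carrier (free_Abelian_group (carrier A \<times> carrier B))"
      by (rule subsetD[OF tensor_relators_closed[OF A B] inv])
    moreover have "tensor_frag f h \<in> carrier (free_Abelian_group (carrier A \<times> carrier C))"
      by (rule subsetD[OF tensor_relators_closed[OF A C] rel[OF inv]])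
    ultimately show ?case using generate.inv[OF rel[OF inv], of "free_Abelian_group (carrier A \<times> carrier C)"]
      by (simp add: frag_extend_minus)
  next
    case (eng h1 h2)
    then show ?case using generate.eng[of "tensor_frag f h1" "free_Abelian_group (carrier A \<times> carrier C)" _ "tensor_frag f h2"]
      by (simp add: frag_extend_add)
  qed
qed

lemma id_tensor_coset:
  "id_tensor R A C f (tensor_kernel R A B #>\<^bsub>free_Abelian_group (carrier A \<times> carrier B)\<^esub> x) =
   tensor_kernel R A C #>\<^bsub>free_Abelian_group (carrier A \<times> carrier C)\<^esub> tensor_frag f x" (is "?l = ?r")
proof -
  note S = tensor_kernel_subgroup[OF A B]
  note T = tensor_kernel_subgroup[OF A C]
  have 0: "0 \<in> tensor_kernel R A B" using subgroup.one_closed[OF S] by simp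
  have add: "x + y \<in> tensor_kernel R A C" if "x \<in> tensor_kernel R A C" "y \<in> tensor_kernel R A C" for x y
    using subgroup.m_closed[OF T that] by simp
  have "?l = {c + tensor_frag f (b + x) | b c. b \<in> tensor_kernel R A B \<and> c \<in> tensor_kernel R A C}"
    by (auto simp: id_tensor_def set_mult_def r_coset_def)
  also have "\<dots> = {c + tensor_frag f x | c. c \<in> tensor_kernel R A C}"
  proof (safe)
    fix b c assume "b \<in> tensor_kernel R A B" "c \<in> tensor_kernel R A C"
    then show "\<exists>c'. c + tensor_frag f (b + x) = c' + tensor_frag f x \<and> c' \<in> tensor_kernel R A C"
      by (intro exI[of _ "c + tensor_frag f b"]) (auto simp: frag_extend_add add kernel_map)
  next
    fix c assume "c \<in> tensor_kernel R A C"
    then show "\<exists>b ca. c + tensor_frag f x = ca + tensor_frag f (b + x) \<and> b \<in> tensor_kernel R A B \<and> ca \<in> tensor_kernel R A C"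
      using 0 by (intro exI[of _ 0] exI[of _ c]) auto
  qed
  also have "\<dots> = ?r" by (auto simp: r_coset_def)
  finally show ?thesis .
qed

lemma id_tensor_pure: "id_tensor R A C f (pure_tensor R A B a b) = pure_tensor R A C a (f b)"
  by (simp add: pure_tensor_def id_tensor_coset)

lemma id_tensor_hom: "id_tensor R A C f \<in> hom (tensor_product R A B) (tensor_product R A C)"
proof -
  let ?FB = "free_Abelian_group (carrier A \<times> carrier B)" and ?FC = "free_Abelian_group (carrier A \<times> carrier C)"
  have n: "tensor_kernel R A B \<lhd> ?FB" "tensor_kernel R A C \<lhd> ?FC"
    by (intro comm_group.normal_iff_subgroup[THEN iffD2] abelian_free_Abelian_group tensor_kernel_subgroup A B C)+
  have F: "tensor_frag f x \<in> carrier ?FC" if "x \<in> carrier ?FB" for x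
  proof -
    have "(\<Union>y\<in>Poly_Mapping.keys x. Poly_Mapping.keys (case y of (a, b) \<Rightarrow> frag_of (a, f b)))
            \<subseteq> carrier A \<times> carrier C"
    proof (rule UN_least)
      fix y assume "y \<in> Poly_Mapping.keys x"
      then have "y \<in> carrier A \<times> carrier B" using that by auto
      then show "Poly_Mapping.keys (case y of (a, b) \<Rightarrow> frag_of (a, f b)) \<subseteq> carrier A \<times> carrier C"
        using f by (cases y) (auto simp: left_module_hom_def)
    qed
    then show ?thesis
      by (simp only: carrier_free_Abelian_group_iff) (rule order_trans[OF keys_frag_extend])
  qed
  show ?thesis
  proof (rule homI)
    fix X assume "X \<in> carrier (tensor_product R A B)"
    then show "id_tensor R A C f X \<in> carrier (tensor_product R A C)"
      using F by (auto simp: tensor_product_def carrier_FactGroup id_tensor_coset)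
  next
    fix X Y assume "X \<in> carrier (tensor_product R A B)" "Y \<in> carrier (tensor_product R A B)"
    then obtain x y where xy: "x \<in> carrier ?FB" "y \<in> carrier ?FB" "X = tensor_kernel R A B #>\<^bsub>?FB\<^esub> x" "Y = tensor_kernel R A B #>\<^bsub>?FB\<^esub> y"
      by (auto simp: tensor_product_def carrier_FactGroup)
    show "id_tensor R A C f (X \<otimes>\<^bsub>tensor_product R A B\<^esub> Y) = id_tensor R A C f X \<otimes>\<^bsub>tensor_product R A C\<^esub> id_tensor R A C f Y"
      using normal.rcos_sum[OF n(1) xy(1,2)] normal.rcos_sum[OF n(2) F F, OF xy(1,2)]
      by (simp add: tensor_product_def xy(3,4) id_tensor_coset frag_extend_add)
  qed
qed

end

end

theory Submission
  imports Defs "HOL-Algebra.Sylow"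
begin

text \<open>
  The theorem compares two right \<open>\<int>[\<pi>]\<close>-modules \<open>A\<close> through the injectivity of \<open>Id \<otimes> f\<close> on
  \<open>A \<otimes> M\<close>. The proof turns this into linear algebra over \<open>\<int>[\<pi>]\<close> and then moves from the
  coefficients \<open>\<int>/p\<close> to \<open>Q[H]\<^sup>k\<close> through modules of functions on \<open>\<pi>\<close>.

  Coordinates. A projective module has a dual basis, so \<open>A \<otimes> M\<close> and \<open>A \<otimes> N\<close> sit inside direct
  sums of copies of \<open>A\<close>. Hence \<open>Id \<otimes> f\<close> is injective iff finitely supported row vectors \<open>v\<close> over
  \<open>A\<close> with \<open>v E = 0\<close> vanish, where \<open>E\<close> is a matrix over \<open>\<int>[\<pi>]\<close>, independent of \<open>A\<close>: some of its
  columns express that \<open>v\<close> is fixed by the idempotent that cuts \<open>M\<close> out of a free module, the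
  others express that \<open>f\<close> kills \<open>v\<close> (\<open>id_tensor_inj_iff\<close>). For \<open>A = \<int>/p\<close> the matrix acts through
  its augmentation, and the hypothesis says that this action is injective.

  Functions. Let \<open>K = ker \<phi>\<close>, let \<open>\<alpha>\<close> factor on \<open>K\<close> through \<open>\<beta>: K \<rightarrow> P\<close>, and let \<open>U = ker \<beta>\<close>.
  An additive map \<open>l: Q \<rightarrow> \<rat>\<close>, an index \<open>j\<close> and an element \<open>h\<close> of \<open>H\<close> send \<open>y\<close> in \<open>Q[H]\<^sup>k\<close> to the
  function \<open>x \<mapsto> l (coefficient of h in the j-th entry of y \<cdot> x)\<close> on \<open>\<pi>\<close>. This is equivariant for
  translation of functions, and these maps are jointly injective. The functions that arise are
  right invariant under \<open>U\<close> and vanish outside finitely many cosets of \<open>K\<close>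
  (\<open>twisted_lookup_coset_function\<close>). So it suffices that \<open>E\<close> is injective on rational functions of
  this kind. As \<open>K/U\<close> is finite, denominators can be cleared
  (\<open>matrix_injective_rat_of_int\<close>); an integral solution of \<open>v E = 0\<close> is divisible by \<open>p\<close>, hence by
  every power of \<open>p\<close>, as soon as \<open>E\<close> is injective modulo \<open>p\<close> (\<open>matrix_injective_int_of_mod\<close>).

  Modulo \<open>p\<close> the subgroup is made smaller in steps, starting from \<open>\<pi>\<close>, where invariant functions are
  constant and the hypothesis applies (\<open>matrix_injective_carrier\<close>). If \<open>V\<close> is generated by \<open>U\<close> and an
  element \<open>c\<close> that normalises \<open>U\<close> and has a \<open>p\<close>-power power in \<open>U\<close>, then right translation \<open>T\<close> by
  \<open>c\<close> acts on \<open>U\<close>-invariant functions and commutes with \<open>E\<close>, and \<open>(T - 1) ^ (p ^ n) = T ^ (p ^ n) - 1 = 0\<close>. The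
  last nonzero vector among the \<open>(T - 1) ^ j v\<close> is \<open>V\<close>-invariant, so injectivity passes from \<open>V\<close> to
  \<open>U\<close> (\<open>matrix_injective_cyclic_step\<close>). Such steps lead from \<open>\<pi>\<close> to the preimage of the
  subgroup \<open>H ^ (p ^ n)\<close> of \<open>p ^ n\<close>-th powers, one step for each generator of \<open>\<pi>\<close>, and from \<open>K\<close> to \<open>U\<close> along a subnormal series of the
  \<open>p\<close>-group \<open>\<beta> K\<close> (\<open>matrix_injective_p_group_kernel\<close>). The gap between the preimages of
  \<open>H ^ (p ^ n)\<close> and \<open>K\<close> is bridged by summing functions over fibres
  (\<open>matrix_injective_residual\<close>); this loses nothing for large \<open>n\<close>, because a finitely generated
  torsion-free abelian group has no nontrivial element that is divisible by all powers of \<open>p\<close>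
  (\<open>infinitely_divisible_trivial\<close>).
\<close>

section \<open>Divisibility in abelian groups and subgroups of index \<open>p\<close>\<close>

lemma (in comm_group) generate_insert_subset:
  assumes "g \<in> carrier G" "S \<subseteq> carrier G"
  shows "generate G (insert g S) \<subseteq> {y \<otimes> g [^] (i::int) | y i. y \<in> generate G S}"
proof
  fix x assume "x \<in> generate G (insert g S)"
  then show "x \<in> {y \<otimes> g [^] (i::int) | y i. y \<in> generate G S}"
  proof (induction rule: generate.induct)
    case one
    show ?case by (rule CollectI, rule exI[of _ \<one>], rule exI[of _ 0]) (simp add: generate.one)
  next
    case (incl h)
    show ?case
    proof (cases "h = g")
      case True
      then show ?thesis using assms
        by (intro CollectI exI[of _ \<one>] exI[of _ 1]) (simp add: generate.one int_pow_1)
    next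
      case False
      then have "h \<in> S" using incl by simp
      then show ?thesis using assms
        by (intro CollectI exI[of _ h] exI[of _ 0]) (auto intro: generate.incl)
    qed
  next
    case (inv h)
    show ?case
    proof (cases "h = g")
      case True
      then show ?thesis using assms
        by (intro CollectI exI[of _ \<one>] exI[of _ "-1"]) (simp add: generate.one int_pow_neg int_pow_1)
    next
      case False
      then have "h \<in> S" using inv by simp
      then show ?thesis using assms
        by (intro CollectI exI[of _ "inv h"] exI[of _ 0]) (auto intro: generate.inv)
    qed
  next
    case (eng h1 h2)
    then obtain y1 y2 and i1 i2 :: int where
      *: "h1 = y1 \<otimes> g [^] i1" "h2 = y2 \<otimes> g [^] i2" "y1 \<in> generate G S" "y2 \<in> generate G S" by blast
    have "y1 \<in> carrier G" "y2 \<in> carrier G" using * generate_incl[OF assms(2)] by auto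
    then have "h1 \<otimes> h2 = (y1 \<otimes> y2) \<otimes> g [^] (i1 + i2)"
      using assms(1) by (simp add: * int_pow_mult m_ac)
    then show ?case using generate.eng[OF *(3,4)] by blast
  qed
qed

lemma (in comm_group) nat_pow_mult_int_pow:
  assumes "y \<in> carrier G" "g \<in> carrier G"
  shows "(y \<otimes> g [^] (i::int)) [^] (m::nat) = y [^] m \<otimes> g [^] (int m * i)"
proof -
  have "(g [^] i) [^] m = g [^] (int m * i)"
    by (metis assms(2) int_pow_int int_pow_pow mult.commute)
  then show ?thesis using assms by (simp add: nat_pow_distrib)
qed

text \<open>Induction on the generators. If a power \<open>g ^ m\<close> of the new generator \<open>g\<close> lies in the subgroup
  generated by the others, then so does the tower \<open>r n ^ m\<close>. Otherwise the exponent of \<open>g\<close> in \<open>r n\<close>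
  is well defined and divisible by every power of \<open>p\<close>, hence \<open>0\<close>, and the tower already lies in the
  smaller subgroup.\<close>

lemma (in comm_group) root_tower_trivial:
  fixes p :: nat
  assumes tf: "\<And>h n. h \<in> carrier G \<Longrightarrow> n > (0::nat) \<Longrightarrow> h [^] n = \<one> \<Longrightarrow> h = \<one>"
    and p: "p > 1"
  shows "finite S \<Longrightarrow> S \<subseteq> carrier G \<Longrightarrow> (\<And>n. r n \<in> generate G S) \<Longrightarrow>
    (\<And>n. r (Suc n) [^] p = r n) \<Longrightarrow> r 0 = \<one>"
proof (induction S arbitrary: r rule: finite_induct)
  case empty
  then show ?case using generate_empty by blast
next
  case (insert g S)
  have g: "g \<in> carrier G" and S: "S \<subseteq> carrier G" using insert.prems by auto
  interpret A: subgroup "generate G S" G by (rule generate_is_subgroup[OF S])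
  have rG: "r n \<in> carrier G" for n
    using insert.prems(1,2) generate_incl by blast
  have "\<exists>y i. y \<in> generate G S \<and> r n = y \<otimes> g [^] (i::int)" for n
    using generate_insert_subset[OF g S] insert.prems(2)[of n] by blast
  then obtain y and i :: "nat \<Rightarrow> int" where
    y: "\<And>n. y n \<in> generate G S" and r: "\<And>n. r n = y n \<otimes> g [^] i n" by metis
  have yG: "y n \<in> carrier G" for n using y A.mem_carrier by blast
  show ?case
  proof (cases "\<exists>m>0. g [^] (m::nat) \<in> generate G S")
    case True
    then obtain m :: nat where m: "m > 0" "g [^] m \<in> generate G S" by blast
    have rm: "r n [^] m \<in> generate G S" for n
    proof -
      have "r n [^] m = y n [^] m \<otimes> (g [^] m) [^] i n"
        unfolding r nat_pow_mult_int_pow[OF yG g]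
        using int_pow_pow[OF g, of "int m" "i n"] by (simp add: int_pow_int)
      also have "y n [^] m \<in> generate G S"
        using y by (induction m) auto
      moreover have "(g [^] m) [^] i n \<in> generate G S"
        using subgroup_int_pow_closed[OF A.subgroup_axioms m(2)] .
      ultimately show ?thesis by simp
    qed
    have "r 0 [^] m = \<one>"
    proof (rule insert.IH[of "\<lambda>n. r n [^] m", OF S rm])
      fix n
      have "(r (Suc n) [^] m) [^] p = (r (Suc n) [^] p) [^] m"
        using rG by (simp add: nat_pow_pow mult.commute)
      then show "(r (Suc n) [^] m) [^] p = r n [^] m" using insert.prems(3) by simp
    qed
    then show ?thesis using tf[OF rG m(1)] by blast
  next
    case False
    have indep: "j = 0" if "g [^] (j::int) \<in> generate G S" for j
    proof (rule ccontr)
      assume "j \<noteq> 0"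
      then have "nat \<bar>j\<bar> > 0" by simp
      moreover have "g [^] nat \<bar>j\<bar> \<in> generate G S"
      proof (cases "j \<ge> 0")
        case True
        then show ?thesis using that unfolding int_pow_def2 by simp
      next
        case False
        then have "g [^] nat \<bar>j\<bar> = inv (g [^] j)" using g unfolding int_pow_def2 by simp
        then show ?thesis using that by simp
      qed
      ultimately show False using False by blast
    qed
    have step: "i n = int p * i (Suc n)" for n
    proof -
      have "r n = y (Suc n) [^] p \<otimes> g [^] (int p * i (Suc n))"
        using insert.prems(3)[of n] nat_pow_mult_int_pow[OF yG g, of "Suc n" "i (Suc n)" p]
        by (simp only: r[of "Suc n"])
      then have e: "y n \<otimes> g [^] i n = y (Suc n) [^] p \<otimes> g [^] (int p * i (Suc n))" by (simp only: r[of n])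
      define a b where "a = y (Suc n) [^] p" and "b = g [^] (int p * i (Suc n))"
      have ab: "a \<in> carrier G" "b \<in> carrier G" "g [^] i n \<in> carrier G"
        using yG g by (auto simp: a_def b_def)
      have "inv a \<otimes> y n = inv a \<otimes> (y n \<otimes> g [^] i n) \<otimes> inv (g [^] i n)"
        using ab yG[of n] by (simp add: m_assoc)
      also have "\<dots> = b \<otimes> inv (g [^] i n)"
        unfolding e a_def[symmetric] b_def[symmetric] using ab by (simp add: m_assoc[symmetric])
      finally have "g [^] (int p * i (Suc n) - i n) = inv (y (Suc n) [^] p) \<otimes> y n"
        using g by (simp add: int_pow_diff a_def b_def)
      moreover have "y (Suc n) [^] p \<in> generate G S" using y by (induction p) auto
      ultimately have "g [^] (int p * i (Suc n) - i n) \<in> generate G S" using y by simp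
      then have "int p * i (Suc n) - i n = 0" by (rule indep)
      then show ?thesis by simp
    qed
    have i_pow: "i m = int p ^ n * i (m + n)" for m n
    proof (induction n)
      case (Suc n)
      then show ?case using step[of "m + n"] by simp
    qed simp
    have "i m = 0" for m
    proof (rule ccontr)
      assume nz: "i m \<noteq> 0"
      define n where "n = nat \<bar>i m\<bar>"
      have "int p ^ n dvd i m" by (subst i_pow[of m n]) (rule dvd_triv_left)
      then have "int p ^ n \<le> \<bar>i m\<bar>" using dvd_imp_le_int[OF nz] by fastforce
      also have "\<dots> = int n" by (simp add: n_def)
      also have "int n < int p ^ n"
        using power_gt_expt[of p n] p by (simp flip: of_nat_power)
      finally show False by simp
    qed
    then have "r n \<in> generate G S" for n using r[of n] y[of n] yG[of n] by simp
    then show ?thesis using insert.IH[OF S] insert.prems(3) by blast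
  qed
qed

text \<open>Roots are unique in the absence of torsion, so the roots of \<open>h\<close> of degrees \<open>p ^ n\<close> form a tower.\<close>

lemma (in comm_group) infinitely_divisible_trivial:
  fixes p :: nat
  assumes tf: "\<And>h n. h \<in> carrier G \<Longrightarrow> n > (0::nat) \<Longrightarrow> h [^] n = \<one> \<Longrightarrow> h = \<one>"
    and p: "p > 1"
    and fg: "finite S" "S \<subseteq> carrier G" "generate G S = carrier G"
    and h: "\<And>n. \<exists>y\<in>carrier G. h = y [^] (p ^ n)"
  shows "h = \<one>"
proof -
  obtain r where rG: "\<And>n. r n \<in> carrier G" and r: "\<And>n. h = r n [^] (p ^ n)" using h by metis
  have "r (Suc n) [^] p = r n" for n
  proof -
    have c: "r (Suc n) [^] p \<in> carrier G" using rG by simp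
    have "(r (Suc n) [^] p \<otimes> inv r n) [^] (p ^ n) = (r (Suc n) [^] p) [^] (p ^ n) \<otimes> inv (r n [^] (p ^ n))"
      using rG by (simp add: pow_mult_distrib m_comm nat_pow_inv)
    also have "(r (Suc n) [^] p) [^] (p ^ n) = h"
      using r[of "Suc n"] rG by (simp add: nat_pow_pow)
    also have "h \<otimes> inv (r n [^] (p ^ n)) = \<one>" using rG r[of n] by (metis nat_pow_closed r_inv)
    finally have "r (Suc n) [^] p \<otimes> inv r n = \<one>" using tf[of _ "p ^ n"] rG p by simp
    then show ?thesis using c rG by (metis inv_equality inv_inv inv_closed)
  qed
  moreover have "r n \<in> generate G S" for n using rG fg(3) by simp
  ultimately have "r 0 = \<one>" by (intro root_tower_trivial[OF tf p fg(1,2), where r = r])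
  then show ?thesis using r[of 0] by simp
qed

text \<open>Sylow's theorem supplies a subgroup of index \<open>p\<close>. It is normal because an element \<open>a\<close> of it permutes
  its \<open>p\<close> cosets and fixes one, so its orbits have fewer than \<open>p\<close> elements; their lengths being powers of
  \<open>p\<close>, all cosets are fixed.\<close>

lemma (in group) p_group_index_p_subgroup:
  assumes p: "prime p" and ord: "order G = p ^ Suc n"
  obtains A c where "subgroup A G" "card A = p ^ n" "c \<in> carrier G"
    "generate G (insert c A) = carrier G" "\<And>a. a \<in> A \<Longrightarrow> inv c \<otimes> a \<otimes> c \<in> A"
proof -
  have p1: "p > 1" using p prime_gt_1_nat by simp
  have fin: "finite (carrier G)" using ord p1 by (intro card_ge_0_finite) (simp add: order_def)
  obtain A where A: "subgroup A G" "card A = p ^ n"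
    using sylow_thm[OF p is_group _ fin, of n p] ord by (auto simp: mult.commute)
  interpret A: subgroup A G by fact
  have finA: "finite A" using fin A.subset finite_subset by blast
  have "A \<noteq> carrier G" using A(2) ord p1 unfolding order_def by auto
  then obtain c where c: "c \<in> carrier G" "c \<notin> A" using A.subset by blast
  have cosets: "card (rcosets A) = p"
    using lagrange[OF A(1)] ord A(2) p1 by simp
  \<comment> \<open>an element of a \<open>p\<close>-group is a power of each of its powers with exponent prime to \<open>p\<close>\<close>
  have root: "z \<in> A" if z: "z \<in> carrier G" and d: "0 < d" "d < p" "z [^] d \<in> A" for z d
  proof -
    have "coprime d p" using p d by (metis coprime_commute nat_dvd_not_less prime_imp_coprime)
    then have cop: "coprime d (p ^ Suc n)" by simp
    obtain g e y where g: "g dvd d" "g dvd p ^ Suc n" "d * e = p ^ Suc n * y + g"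
      using bezout_add_strong_nat[of d "p ^ Suc n"] d(1) by blast
    have "g = 1" using coprime_common_divisor[OF cop g(1,2)] by (simp only: nat_dvd_1_iff_1)
    with g(3) have e: "d * e = p ^ Suc n * y + 1" by (simp only:)
    have "z [^] (d * e) = (z [^] (p ^ Suc n)) [^] y \<otimes> z"
      unfolding e using z by (simp only: nat_pow_pow nat_pow_mult[symmetric] nat_pow_eone)
    also have "\<dots> = z" using z pow_order_eq_1[OF z] unfolding ord by simp
    finally have "z [^] (d * e) = z" .
    moreover have "(z [^] d) [^] e \<in> A" using d(3) by (induction e) auto
    ultimately show ?thesis using z by (simp add: nat_pow_pow)
  qed
  have conj_pow: "(x \<otimes> a \<otimes> inv x) [^] i = x \<otimes> a [^] i \<otimes> inv x"
    if "x \<in> carrier G" "a \<in> carrier G" for x a and i :: nat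
  proof (induction i)
    case (Suc i)
    have "inv x \<otimes> (x \<otimes> (a \<otimes> inv x)) = a \<otimes> inv x"
      using that by (simp add: m_assoc[symmetric])
    then show ?case using Suc that by (simp add: m_assoc)
  qed (use that in simp)
  have norm: "x \<otimes> a \<otimes> inv x \<in> A" if x: "x \<in> carrier G" and a: "a \<in> A" for x a
  proof (cases "x \<in> A")
    case True
    then show ?thesis using a by simp
  next
    case False
    have aG: "a \<in> carrier G" using a by simp
    let ?f = "\<lambda>i::nat. A #> (x \<otimes> a [^] i)"
    have mem: "x \<otimes> a [^] i \<in> ?f i" for i
      using rcos_self[OF _ A(1), of "x \<otimes> a [^] i"] x aG by simp
    have "\<not> inj_on ?f {..<p}"
    proof
      assume inj: "inj_on ?f {..<p}"
      have "?f ` {..<p} \<subseteq> rcosets A" using x aG by (auto intro!: rcosetsI A.subset)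
      moreover have "finite (rcosets A)" using cosets p1 by (intro card_ge_0_finite) simp
      moreover have "card (?f ` {..<p}) = card (rcosets A)" using cosets card_image[OF inj] by simp
      ultimately have "?f ` {..<p} = rcosets A" by (intro card_subset_eq)
      then have "A \<in> ?f ` {..<p}" using A.subgroup_in_rcosets[OF is_group] by simp
      then obtain i where "A = ?f i" by blast
      then have "x \<otimes> a [^] i \<in> A" using mem by blast
      moreover have ai: "a [^] i \<in> A" using a by (induction i) auto
      ultimately have "x \<otimes> a [^] i \<otimes> inv (a [^] i) \<in> A" by blast
      then show False using False x ai by (simp add: m_assoc)
    qed
    then obtain i j where ij: "i < j" "j < p" "?f i = ?f j"
      unfolding inj_on_def by (metis lessThan_iff linorder_neqE_nat)
    have "x \<otimes> a [^] j \<in> A #> (x \<otimes> a [^] i)" using mem[of j] ij(3) by simp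
    then have "x \<otimes> a [^] j \<otimes> inv (x \<otimes> a [^] i) \<in> A"
      using A.rcos_module_imp[OF is_group, of "x \<otimes> a [^] i"] x aG by simp
    moreover have "x \<otimes> a [^] j \<otimes> inv (x \<otimes> a [^] i) = (x \<otimes> a \<otimes> inv x) [^] (j - i)"
    proof -
      have "a [^] j = a [^] (j - i) \<otimes> a [^] i" using ij(1) aG by (simp add: nat_pow_mult)
      moreover have "a [^] i \<otimes> (inv (a [^] i) \<otimes> inv x) = inv x"
        using x aG by (simp add: m_assoc[symmetric])
      ultimately have "x \<otimes> a [^] j \<otimes> inv (x \<otimes> a [^] i) = x \<otimes> a [^] (j - i) \<otimes> inv x"
        using x aG by (simp add: inv_mult_group m_assoc)
      then show ?thesis unfolding conj_pow[OF x aG] using x aG by simp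
    qed
    ultimately show ?thesis using root[of "x \<otimes> a \<otimes> inv x" "j - i"] ij x aG by simp
  qed
  have "generate G (insert c A) = carrier G"
  proof -
    have sub: "insert c A \<subseteq> carrier G" using c A.subset by simp
    interpret B: subgroup "generate G (insert c A)" G by (rule generate_is_subgroup[OF sub])
    have "card A < card (generate G (insert c A))"
      using c(2) finite_subset[OF B.subset fin] by (intro psubset_card_mono) (auto intro: generate.incl)
    moreover have "card (generate G (insert c A)) dvd p ^ Suc n"
      using lagrange[OF B.subgroup_axioms] ord by (metis dvd_triv_right)
    then obtain m where m: "m \<le> Suc n" "card (generate G (insert c A)) = p ^ m"
      using divides_primepow_nat[OF p] by blast
    ultimately have "m = Suc n" using A(2) p1 by (metis le_SucE nat_less_le not_le power_increasing order.strict_implies_order)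
    then show ?thesis using card_subset_eq[OF fin B.subset] m ord by (simp add: order_def)
  qed
  moreover have "inv c \<otimes> a \<otimes> c \<in> A" if "a \<in> A" for a
    using norm[of "inv c" a] that c by simp
  ultimately show ?thesis using that A c by blast
qed

section \<open>Matrices over the group ring acting on functions\<close>

text \<open>An element \<open>g\<close> acts from the right by \<open>(w \<cdot> g) x = w (g x)\<close>, so right translations of the argument
  commute with the action.\<close>

definition fun_act ::
    "('g, 'c) monoid_scheme \<Rightarrow> ('g \<Rightarrow>\<^sub>0 int) \<Rightarrow> ('g \<Rightarrow> 'r::comm_ring_1) \<Rightarrow> 'g \<Rightarrow> 'r" where
  "fun_act G e w x =
     (\<Sum>g\<in>Poly_Mapping.keys e. of_int (Poly_Mapping.lookup e g) * w (g \<otimes>\<^bsub>G\<^esub> x))"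

text \<open>The modulus \<open>m\<close> replaces the ring of values by its quotient by \<open>m\<close>, without changing the type; as \<open>0 dvd a\<close> means
  \<open>a = 0\<close>, the value \<open>m = 0\<close> gives honest integral or rational functions. Support is
  measured by a second, larger group \<open>W\<close> so that \<open>U\<close> can shrink while the support condition stays
  the same.\<close>

definition coset_function ::
    "('g, 'c) monoid_scheme \<Rightarrow> 'g set \<Rightarrow> 'g set \<Rightarrow> 'r::comm_ring_1 \<Rightarrow> ('g \<Rightarrow> 'r) \<Rightarrow> bool" where
  "coset_function G U W m w \<longleftrightarrow>
     (\<forall>x\<in>carrier G. \<forall>u\<in>U. m dvd w (x \<otimes>\<^bsub>G\<^esub> u) - w x) \<and>
     (\<exists>F. finite F \<and> F \<subseteq> carrier G \<and>
        (\<forall>x\<in>carrier G. \<not> m dvd w x \<longrightarrow> (\<exists>f\<in>F. \<exists>y\<in>W. x = f \<otimes>\<^bsub>G\<^esub> y)))"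

text \<open>Right multiplication by the matrix \<open>E\<close> is injective on row vectors, indexed by \<open>S\<close>, of functions in
  the sense of \<open>coset_function\<close>.\<close>

definition matrix_injective ::
    "('g, 'c) monoid_scheme \<Rightarrow> 's set \<Rightarrow> ('s \<Rightarrow> 't \<Rightarrow> 'g \<Rightarrow>\<^sub>0 int) \<Rightarrow> 'g set \<Rightarrow> 'g set \<Rightarrow>
     'r::comm_ring_1 \<Rightarrow> bool" where
  "matrix_injective G S E U W m \<longleftrightarrow>
     (\<forall>v. (\<forall>s\<in>S. coset_function G U W m (v s)) \<longrightarrow>
          (\<forall>t. \<forall>x\<in>carrier G. m dvd (\<Sum>s\<in>S. fun_act G (E s t) (v s) x)) \<longrightarrow>
          (\<forall>s\<in>S. \<forall>x\<in>carrier G. m dvd v s x))"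

lemma coset_functionE:
  assumes "coset_function G U W m w"
  obtains F where "finite F" "F \<subseteq> carrier G"
    "\<forall>x\<in>carrier G. \<not> m dvd w x \<longrightarrow> (\<exists>f\<in>F. \<exists>y\<in>W. x = f \<otimes>\<^bsub>G\<^esub> y)"
  using assms unfolding coset_function_def by (elim conjE exE) (rule that)

lemma matrix_injectiveD:
  assumes "matrix_injective G S E U W m" "\<And>s. s \<in> S \<Longrightarrow> coset_function G U W m (v s)"
    and "\<And>t x. x \<in> carrier G \<Longrightarrow> m dvd (\<Sum>s\<in>S. fun_act G (E s t) (v s) x)"
    and "s \<in> S" "x \<in> carrier G"
  shows "m dvd v s x"
  using assms(1)[unfolded matrix_injective_def, rule_format, of v, OF assms(2,3,4,5)] .

lemma fun_act_add: "fun_act G (e + e') w x = fun_act G e w x + fun_act G e' w x"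
  unfolding fun_act_def by (rule pm_sum_add) (auto simp: algebra_simps)

lemma fun_act_diff: "fun_act G (e - e') w x = fun_act G e w x - fun_act G e' w x"
  using fun_act_add[of G "e - e'" e' w x] by simp

lemma fun_act_single: "fun_act G (Poly_Mapping.single g a) w x = of_int a * w (g \<otimes>\<^bsub>G\<^esub> x)"
  by (simp add: fun_act_def)

lemma fun_act_zero [simp]: "fun_act G 0 w x = 0"
  by (simp add: fun_act_def)

lemma fun_act_minus: "fun_act G e (\<lambda>x. w x - w' x) x = fun_act G e w x - fun_act G e w' x"
  by (simp add: fun_act_def right_diff_distrib sum_subtractf)

lemma fun_act_cong_dvd:
  assumes "\<And>g. g \<in> Poly_Mapping.keys e \<Longrightarrow> m dvd w (g \<otimes>\<^bsub>G\<^esub> x) - w' (g \<otimes>\<^bsub>G\<^esub> x)"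
  shows "m dvd fun_act G e w x - fun_act G e w' x"
  unfolding fun_act_minus[symmetric] unfolding fun_act_def by (intro dvd_sum dvd_mult assms)

lemma prime_dvd_choose_prime_power:
  fixes p :: nat
  assumes "prime p" "0 < i" "i < p ^ n"
  shows "p dvd (p ^ n choose i)"
proof (rule ccontr)
  assume "\<not> p dvd (p ^ n choose i)"
  then have "coprime (p ^ n) (p ^ n choose i)"
    using assms(1) by (simp add: prime_imp_coprime)
  moreover have "p ^ n dvd i * (p ^ n choose i)"
    using times_binomial_minus1_eq[OF assms(2), of "p ^ n"] by simp
  ultimately have "p ^ n dvd i" by (simp add: coprime_dvd_mult_left_iff)
  then have "p ^ n \<le> i" by (rule dvd_imp_le[OF _ assms(2)])
  then show False using assms(3) by simp
qed

context group
begin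

lemma fun_act_translate:
  assumes "Poly_Mapping.keys e \<subseteq> carrier G" "x \<in> carrier G" "c \<in> carrier G"
  shows "fun_act G e (\<lambda>x. w (x \<otimes> c)) x = fun_act G e w (x \<otimes> c)"
  unfolding fun_act_def by (intro sum.cong refl) (use assms in \<open>auto simp: m_assoc subset_iff\<close>)

text \<open>Functions invariant under the whole group are constant, and the group ring acts on constants
  through the augmentation.\<close>

lemma matrix_injective_carrier:
  fixes m :: int
  assumes E: "\<And>s t. s \<in> S \<Longrightarrow> Poly_Mapping.keys (E s t) \<subseteq> carrier G"
    and aug: "\<And>c. (\<And>t. m dvd (\<Sum>s\<in>S. augmentation (E s t) * c s)) \<Longrightarrow> \<forall>s\<in>S. m dvd c s"
  shows "matrix_injective G S E (carrier G) (carrier G) m"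
  unfolding matrix_injective_def
proof (intro allI impI)
  fix v :: "'c \<Rightarrow> 'a \<Rightarrow> int"
  assume v: "\<forall>s\<in>S. coset_function G (carrier G) (carrier G) m (v s)"
    and z: "\<forall>t. \<forall>x\<in>carrier G. m dvd (\<Sum>s\<in>S. fun_act G (E s t) (v s) x)"
  have const: "m dvd v s x - v s \<one>" if "s \<in> S" "x \<in> carrier G" for s x
  proof -
    have "m dvd v s (\<one> \<otimes> x) - v s \<one>"
      using v that one_closed unfolding coset_function_def by blast
    then show ?thesis using that by simp
  qed
  have "m dvd (\<Sum>s\<in>S. augmentation (E s t) * v s \<one>)" for t
  proof -
    have "m dvd fun_act G (E s t) (v s) \<one> - augmentation (E s t) * v s \<one>" if s: "s \<in> S" for s
    proof -
      have "augmentation (E s t) * v s \<one> = fun_act G (E s t) (\<lambda>x. v s \<one>) \<one>"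
        by (simp add: augmentation_def fun_act_def sum_distrib_right)
      then show ?thesis using E[OF s, of t] const[OF s]
        by (auto intro!: fun_act_cong_dvd)
    qed
    then have "m dvd (\<Sum>s\<in>S. fun_act G (E s t) (v s) \<one> - augmentation (E s t) * v s \<one>)"
      by (rule dvd_sum)
    then show ?thesis using z[rule_format, OF one_closed, of t]
      unfolding sum_subtractf using dvd_diff_right_iff by blast
  qed
  then have "\<forall>s\<in>S. m dvd v s \<one>" using aug[of "\<lambda>s. v s \<one>"] by blast
  then show "\<forall>s\<in>S. \<forall>x\<in>carrier G. m dvd v s x"
    using const dvd_diff_left_iff by blast
qed

definition shift_diff :: "'a \<Rightarrow> ('a \<Rightarrow> 'r::comm_ring_1) \<Rightarrow> 'a \<Rightarrow> 'r" where
  "shift_diff c w = (\<lambda>x. w (x \<otimes> c) - w x)"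

lemma shift_diff_funpow:
  assumes c: "c \<in> carrier G"
  shows "x \<in> carrier G \<Longrightarrow> (shift_diff c ^^ n) w x
    = (\<Sum>i\<le>n. of_nat (n choose i) * (-1) ^ (n + i) * w (x \<otimes> c [^] i))"
proof (induction n arbitrary: x)
  case 0
  then show ?case by simp
next
  case (Suc n)
  define a where "a i = w (x \<otimes> c [^] i)" for i :: nat
  have a: "w (x \<otimes> c \<otimes> c [^] i) = a (Suc i)" for i
    unfolding a_def by (subst nat_pow_Suc2) (use Suc.prems c in \<open>auto simp: m_assoc\<close>)
  let ?f = "\<lambda>n i. of_nat (n choose i) * (-1) ^ (n + i) * a i"
  have "(shift_diff c ^^ Suc n) w x = (shift_diff c ^^ n) w (x \<otimes> c) - (shift_diff c ^^ n) w x"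
    by (simp add: shift_diff_def)
  also have "\<dots> = (\<Sum>i\<le>n. of_nat (n choose i) * (-1) ^ (n + i) * a (Suc i)) - (\<Sum>i\<le>n. ?f n i)"
    using Suc.prems c by (simp add: Suc.IH a) (simp add: a_def)
  also have "(\<Sum>i\<le>n. ?f n i) = (\<Sum>i\<le>Suc n. ?f n i)" by (simp add: binomial_eq_0)
  also have "\<dots> = ?f n 0 + (\<Sum>i\<le>n. ?f n (Suc i))" by (rule sum.atMost_Suc_shift)
  also have "(\<Sum>i\<le>n. of_nat (n choose i) * (-1) ^ (n + i) * a (Suc i)) - (?f n 0 + (\<Sum>i\<le>n. ?f n (Suc i)))
      = ?f (Suc n) 0 + (\<Sum>i\<le>n. ?f (Suc n) (Suc i))"
    by (simp add: sum_subtractf[symmetric] algebra_simps sum.distrib sum_negf)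
  also have "\<dots> = (\<Sum>i\<le>Suc n. ?f (Suc n) i)" by (rule sum.atMost_Suc_shift[symmetric])
  finally show ?case by (simp add: a_def)
qed

text \<open>The binomial theorem for \<open>T - 1\<close>, where \<open>T\<close> is translation by \<open>c\<close>: the inner binomial coefficients
  are divisible by \<open>p\<close>, and the outer terms cancel modulo \<open>p\<close>.\<close>

lemma shift_diff_prime_power:
  fixes w :: "'a \<Rightarrow> int"
  assumes c: "c \<in> carrier G" and x: "x \<in> carrier G" and p: "prime p"
    and per: "int p dvd w (x \<otimes> c [^] (p ^ n)) - w x"
  shows "int p dvd (shift_diff c ^^ (p ^ n)) w x"
proof -
  let ?q = "p ^ n"
  let ?f = "\<lambda>i. of_nat (?q choose i) * (-1) ^ (?q + i) * w (x \<otimes> c [^] i)"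
  have q: "?q > 0" using p prime_gt_0_nat by simp
  have "{..?q} = insert 0 (insert ?q {0<..<?q})" using q by auto
  then have "(\<Sum>i\<le>?q. ?f i) = ?f 0 + (?f ?q + (\<Sum>i\<in>{0<..<?q}. ?f i))" using q by simp
  also have "int p dvd \<dots>"
  proof -
    have mid: "int p dvd (\<Sum>i\<in>{0<..<?q}. ?f i)"
      by (intro dvd_sum dvd_mult2) (use prime_dvd_choose_prime_power[OF p] in auto)
    have ends: "int p dvd ?f 0 + ?f ?q"
    proof -
      have e: "?f 0 + ?f ?q = (w (x \<otimes> c [^] ?q) - w x) + (1 + (-1) ^ ?q) * w x"
        using x by (simp add: algebra_simps flip: power_add mult_2)
      have "int p dvd 1 + (-1) ^ ?q"
      proof (cases "odd ?q")
        case False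
        then have "p = 2" using p prime_odd_nat[of p] primes_dvd_imp_eq[of 2 p] by force
        then show ?thesis using False by simp
      qed simp
      then show ?thesis unfolding e by (intro dvd_add[OF per] dvd_mult2)
    qed
    show ?thesis unfolding add.assoc[symmetric] by (rule dvd_add[OF ends mid])
  qed
  finally show ?thesis unfolding shift_diff_funpow[OF c x] .
qed

text \<open>With \<open>T\<close> the translation by \<open>c\<close>, each \<open>(T - 1) ^ j v\<close> is again a solution of \<open>v E = 0\<close> among the
  \<open>U\<close>-invariant functions. If the next one vanishes, it is invariant under \<open>c\<close> too, hence under \<open>V\<close>,
  and vanishes by the hypothesis on \<open>V\<close>.\<close>

lemma matrix_injective_cyclic_step:
  fixes p :: nat
  assumes E: "\<And>s t. s \<in> S \<Longrightarrow> Poly_Mapping.keys (E s t) \<subseteq> carrier G" 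
    and p: "prime p"
    and V: "matrix_injective G S E V W (int p)"
    and sub: "U \<subseteq> carrier G" "subgroup W G" "c \<in> W"
    and gen: "V \<subseteq> generate G (insert c U)"
    and norm: "\<And>u. u \<in> U \<Longrightarrow> \<exists>u'\<in>U. u \<otimes> c = c \<otimes> u'"
    and pow: "c [^] (p ^ n) \<in> U"
  shows "matrix_injective G S E U W (int p)"
  unfolding matrix_injective_def
proof (intro allI impI)
  fix v :: "'c \<Rightarrow> 'a \<Rightarrow> int"
  assume v: "\<forall>s\<in>S. coset_function G U W (int p) (v s)"
    and z: "\<forall>t. \<forall>x\<in>carrier G. int p dvd (\<Sum>s\<in>S. fun_act G (E s t) (v s) x)"
  interpret W: subgroup W G by (rule sub(2))
  have c: "c \<in> carrier G" by (rule W.mem_carrier[OF sub(3)])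
  define D where "D j s = (shift_diff c ^^ j) (v s)" for j s
  have DS: "D (Suc j) s x = D j s (x \<otimes> c) - D j s x" for j s x
    by (simp add: D_def shift_diff_def)
  then have DS': "D (Suc j) s = (\<lambda>x. D j s (x \<otimes> c) - D j s x)" for j s by (rule ext)
  have D_fun: "coset_function G U W (int p) (D j s)" if s: "s \<in> S" for j s
  proof (induction j)
    case 0
    then show ?case using v s by (simp add: D_def)
  next
    case (Suc j)
    obtain F where F: "finite F" "F \<subseteq> carrier G"
      "\<And>x. x \<in> carrier G \<Longrightarrow> \<not> int p dvd D j s x \<Longrightarrow> \<exists>f\<in>F. \<exists>y\<in>W. x = f \<otimes> y"
      using Suc unfolding coset_function_def by blast
    have inv: "int p dvd D (Suc j) s (x \<otimes> u) - D (Suc j) s x" if x: "x \<in> carrier G" and u: "u \<in> U" for x u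
    proof -
      obtain u' where u': "u' \<in> U" "u \<otimes> c = c \<otimes> u'" using norm u by blast
      have "u \<in> carrier G" "u' \<in> carrier G" using u u' sub(1) by auto
      then have "x \<otimes> u \<otimes> c = x \<otimes> c \<otimes> u'" using u' x c by (simp add: m_assoc)
      then have "D (Suc j) s (x \<otimes> u) - D (Suc j) s x
          = (D j s (x \<otimes> c \<otimes> u') - D j s (x \<otimes> c)) - (D j s (x \<otimes> u) - D j s x)"
        by (simp add: DS)
      also have "int p dvd \<dots>" 
        using Suc x u u' m_closed[OF x c] unfolding coset_function_def by (meson dvd_diff)
      finally show ?thesis .
    qed
    have "\<exists>f\<in>F. \<exists>y\<in>W. x = f \<otimes> y" if x: "x \<in> carrier G" and nz: "\<not> int p dvd D (Suc j) s x" for x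
    proof (cases "int p dvd D j s x")
      case False
      then show ?thesis using F x by blast
    next
      case True
      then have "\<not> int p dvd D j s (x \<otimes> c)" using nz unfolding DS by auto
      then obtain f y where f: "f \<in> F" "y \<in> W" "x \<otimes> c = f \<otimes> y" using F x c by blast
      have fy: "f \<in> carrier G" "y \<in> carrier G" using f F(2) by auto
      have "x = x \<otimes> c \<otimes> inv c" using x c by (simp add: m_assoc)
      also have "\<dots> = f \<otimes> (y \<otimes> inv c)" using fy c by (simp add: f m_assoc)
      finally show ?thesis using f sub(3) by blast
    qed
    then show ?case unfolding coset_function_def using F inv by blast
  qed
  have D_act: "int p dvd (\<Sum>s\<in>S. fun_act G (E s t) (D j s) x)" if "x \<in> carrier G" for j t x
    using that
  proof (induction j arbitrary: x)
    case 0
    then show ?case using z by (simp add: D_def)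
  next
    case (Suc j)
    have "(\<Sum>s\<in>S. fun_act G (E s t) (D (Suc j) s) x)
      = (\<Sum>s\<in>S. fun_act G (E s t) (\<lambda>x. D j s (x \<otimes> c)) x - fun_act G (E s t) (D j s) x)"
      by (simp only: DS' fun_act_minus)
    also have "\<dots> = (\<Sum>s\<in>S. fun_act G (E s t) (D j s) (x \<otimes> c)) - (\<Sum>s\<in>S. fun_act G (E s t) (D j s) x)"
      unfolding sum_subtractf
      by (intro arg_cong2[of _ _ _ _ minus] sum.cong refl fun_act_translate[OF E Suc.prems c])
    finally show ?case using Suc.IH[OF m_closed[OF Suc.prems c]] Suc.IH[OF Suc.prems] by simp
  qed
  \<comment> \<open>descending induction: \<open>D (Suc j) \<equiv> 0\<close> makes \<open>D j\<close> invariant under \<open>V\<close>\<close>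
  have down: "\<forall>s\<in>S. \<forall>x\<in>carrier G. int p dvd D j s x" if Sj: "\<forall>s\<in>S. \<forall>x\<in>carrier G. int p dvd D (Suc j) s x" for j
  proof -
    have "coset_function G V W (int p) (D j s)" if s: "s \<in> S" for s
    proof -
      have "y \<in> carrier G \<and> (\<forall>x\<in>carrier G. int p dvd D j s (x \<otimes> y) - D j s x)"
        if "y \<in> generate G (insert c U)" for y
        using that
      proof (induction rule: generate.induct)
        case one
        then show ?case by simp
      next
        case (incl h)
        then show ?case using Sj s c sub(1) D_fun[OF s, of j] unfolding DS coset_function_def by auto
      next
        case (inv h)
        have h: "h \<in> carrier G" using inv c sub(1) by auto
        have *: "int p dvd D j s (x \<otimes> h) - D j s x" if "x \<in> carrier G" for x
          using inv that Sj s D_fun[OF s, of j] unfolding DS coset_function_def by auto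
        have "int p dvd D j s (x \<otimes> inv h) - D j s x" if x: "x \<in> carrier G" for x
          using *[of "x \<otimes> inv h"] x h by (simp add: m_assoc dvd_diff_commute)
        then show ?case using h by simp
      next
        case (eng h1 h2)
        have "int p dvd D j s (x \<otimes> (h1 \<otimes> h2)) - D j s x" if x: "x \<in> carrier G" for x
        proof -
          have "D j s (x \<otimes> (h1 \<otimes> h2)) - D j s x = (D j s (x \<otimes> h1 \<otimes> h2) - D j s (x \<otimes> h1)) + (D j s (x \<otimes> h1) - D j s x)"
            using x eng by (simp add: m_assoc)
          moreover have "int p dvd D j s (x \<otimes> h1 \<otimes> h2) - D j s (x \<otimes> h1)"
            using eng m_closed[OF x, of h1] by blast
          moreover have "int p dvd D j s (x \<otimes> h1) - D j s x" using eng x by blast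
          ultimately show ?thesis by (simp only: dvd_add)
        qed
        then show ?case using eng by simp
      qed
      then show ?thesis using gen D_fun[OF s, of j] unfolding coset_function_def by blast
    qed
    then show ?thesis using V D_act unfolding matrix_injective_def by blast
  qed
  have top: "\<forall>s\<in>S. \<forall>x\<in>carrier G. int p dvd D (p ^ n) s x"
  proof (intro ballI)
    fix s x assume s: "s \<in> S" and x: "x \<in> carrier G"
    have "int p dvd v s (x \<otimes> c [^] (p ^ n)) - v s x"
      using v s x pow unfolding coset_function_def by blast
    then show "int p dvd D (p ^ n) s x" unfolding D_def by (rule shift_diff_prime_power[OF c x p])
  qed
  have "\<forall>s\<in>S. \<forall>x\<in>carrier G. int p dvd D 0 s x"
    by (rule inc_induct[of 0 "p ^ n" "\<lambda>j. \<forall>s\<in>S. \<forall>x\<in>carrier G. int p dvd D j s x"])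
       (simp, rule top, rule down)
  then show "\<forall>s\<in>S. \<forall>x\<in>carrier G. int p dvd v s x" by (simp add: D_def)
qed

end

section \<open>Passing to smaller subgroups modulo \<open>p\<close>\<close>

text \<open>The quotient by \<open>U\<close> is abelian of exponent dividing \<open>p ^ n\<close>; adjoining the generators in \<open>T\<close> to \<open>U\<close> one
  at a time gives a chain of cyclic steps.\<close>

lemma (in group) matrix_injective_abelian_power_quotient:
  fixes p :: nat
  assumes E: "\<And>s t. s \<in> S \<Longrightarrow> Poly_Mapping.keys (E s t) \<subseteq> carrier G"
    and p: "prime p"
    and fg: "finite T" "T \<subseteq> carrier G" "generate G T = carrier G"
    and U: "subgroup U G"
    and comm: "\<And>x y. x \<in> carrier G \<Longrightarrow> y \<in> carrier G \<Longrightarrow> \<exists>u\<in>U. x \<otimes> y = y \<otimes> x \<otimes> u"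
    and pow: "\<And>x. x \<in> carrier G \<Longrightarrow> x [^] (p ^ n) \<in> U"
    and top: "matrix_injective G S E (carrier G) (carrier G) (int p)"
  shows "matrix_injective G S E U (carrier G) (int p)"
proof -
  have UG: "U \<subseteq> carrier G" using subgroup.subset[OF U] .
  have "matrix_injective G S E (generate G (T \<union> U)) (carrier G) (int p) \<longrightarrow>
      matrix_injective G S E (generate G U) (carrier G) (int p)"
    using fg(1,2)
  proof (induction T rule: finite_induct)
    case (insert c T)
    have TU: "T \<union> U \<subseteq> carrier G" using insert.prems UG by auto
    interpret A: subgroup "generate G (T \<union> U)" G by (rule generate_is_subgroup[OF TU])
    have c: "c \<in> carrier G" using insert.prems by auto
    have UA: "U \<subseteq> generate G (T \<union> U)" by (auto intro: generate.incl)
    have "matrix_injective G S E (generate G (T \<union> U)) (carrier G) (int p)"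
      if "matrix_injective G S E (generate G (insert c T \<union> U)) (carrier G) (int p)"
    proof (rule matrix_injective_cyclic_step[OF E p that A.subset subgroup_self c])
      show "generate G (insert c T \<union> U) \<subseteq> generate G (insert c (generate G (T \<union> U)))"
        by (rule mono_generate) (auto intro: generate.incl)
      show "c [^] (p ^ n) \<in> generate G (T \<union> U)" using pow[OF c] UA by blast
      fix u assume u: "u \<in> generate G (T \<union> U)"
      obtain u' where u': "u' \<in> U" "u \<otimes> c = c \<otimes> u \<otimes> u'" using comm[OF A.mem_carrier[OF u] c] by blast
      then have "u \<otimes> c = c \<otimes> (u \<otimes> u')" using A.mem_carrier[OF u] c UG by (simp add: m_assoc subset_iff)
      then show "\<exists>u'\<in>generate G (T \<union> U). u \<otimes> c = c \<otimes> u'"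
        using u u'(1) UA A.m_closed by blast
    qed
    then show ?case using insert by auto
  qed simp
  moreover have "generate G U = U"
    using generate_subgroup_incl[OF subset_refl U] by (auto intro: generate.incl)
  moreover have "generate G (T \<union> U) = carrier G"
    using mono_generate[of T "T \<union> U"] fg generate_incl[of "T \<union> U"] UG by auto
  ultimately show ?thesis using top by simp
qed

text \<open>Summing a function over the fibres of \<open>G/K \<rightarrow> G/V\<close>, with \<open>K = ker \<phi>\<close> and \<open>V\<close> the preimage of \<open>L n\<close>, commutes with the
  group ring and preserves solutions of \<open>v E = 0\<close>. Since supports are finite modulo \<open>K\<close>, a large \<open>n\<close>
  separates a given point from all others in the support, and there the sum has only one term.\<close>

lemma (in group) matrix_injective_residual:
  fixes m :: int
  assumes E: "\<And>s t. s \<in> S \<Longrightarrow> Poly_Mapping.keys (E s t) \<subseteq> carrier G"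
    and S: "finite S"
    and H: "comm_group H" and \<phi>: "\<phi> \<in> epi G H"
    and L: "\<And>n::nat. subgroup (L n) H" "\<And>n. L (Suc n) \<subseteq> L n" "(\<Inter>n. L n) = {\<one>\<^bsub>H\<^esub>}"
    and inj: "\<And>n. matrix_injective G S E {x \<in> carrier G. \<phi> x \<in> L n} (carrier G) m"
  shows "matrix_injective G S E (kernel G H \<phi>) (kernel G H \<phi>) m"
  unfolding matrix_injective_def
proof (intro allI impI ballI)
  fix v :: "'c \<Rightarrow> 'a \<Rightarrow> int" and s\<^sub>0 x\<^sub>0
  assume v: "\<forall>s\<in>S. coset_function G (kernel G H \<phi>) (kernel G H \<phi>) m (v s)"
    and z: "\<forall>t. \<forall>x\<in>carrier G. m dvd (\<Sum>s\<in>S. fun_act G (E s t) (v s) x)"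
    and s\<^sub>0: "s\<^sub>0 \<in> S" and x\<^sub>0: "x\<^sub>0 \<in> carrier G"
  interpret H: comm_group H by fact
  interpret \<phi>: group_hom G H \<phi>
    by unfold_locales (use \<phi> in \<open>simp add: epi_def\<close>)
  note ph = \<phi>.hom_closed
  have im: "\<phi> ` carrier G = carrier H" using \<phi> by (simp add: epi_def)
  have surj: "\<exists>g\<in>carrier G. \<phi> g = h" if "h \<in> carrier H" for h
    using that unfolding im[symmetric] by blast
  define rep where "rep h = (SOME g. g \<in> carrier G \<and> \<phi> g = h)" for h
  have rep: "rep h \<in> carrier G" "\<phi> (rep h) = h" if "h \<in> carrier H" for h
    using someI_ex[of "\<lambda>g. g \<in> carrier G \<and> \<phi> g = h"] surj[OF that] unfolding rep_def by blast+
  have v_cong: "m dvd v s x - v s y" if "s \<in> S" "x \<in> carrier G" "y \<in> carrier G" "\<phi> x = \<phi> y" for s x y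
  proof -
    have "inv y \<otimes> x \<in> kernel G H \<phi>" using that by (simp add: kernel_def)
    then have "m dvd v s (y \<otimes> (inv y \<otimes> x)) - v s y"
      using v that unfolding coset_function_def by blast
    then show ?thesis using that by (simp add: m_assoc[symmetric])
  qed
  have "\<forall>s\<in>S. \<exists>F. finite F \<and> F \<subseteq> carrier G \<and>
      (\<forall>x\<in>carrier G. \<not> m dvd v s x \<longrightarrow> (\<exists>f\<in>F. \<exists>y\<in>kernel G H \<phi>. x = f \<otimes> y))"
    using v unfolding coset_function_def by blast
  from bchoice[OF this] obtain F where F: "\<forall>s\<in>S. finite (F s) \<and> F s \<subseteq> carrier G \<and>
      (\<forall>x\<in>carrier G. \<not> m dvd v s x \<longrightarrow> (\<exists>f\<in>F s. \<exists>y\<in>kernel G H \<phi>. x = f \<otimes> y))"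
    by (rule exE)
  define \<Phi> where "\<Phi> = \<phi> ` (\<Union>s\<in>S. F s)"
  have \<Phi>: "finite \<Phi>" "\<Phi> \<subseteq> carrier H" using S F ph unfolding \<Phi>_def by blast+
  have supp: "\<phi> x \<in> \<Phi>" if s: "s \<in> S" and x: "x \<in> carrier G" and nz: "\<not> m dvd v s x" for s x
  proof -
    obtain f y where f: "f \<in> F s" "y \<in> kernel G H \<phi>" "x = f \<otimes> y" using F s x nz by blast
    moreover have "f \<in> carrier G" using f(1) F s by blast
    ultimately have "\<phi> x = \<phi> f" by (simp add: kernel_def)
    then show ?thesis using f(1) s unfolding \<Phi>_def by blast
  qed
  have L_antimono: "L b \<subseteq> L a" if "a \<le> b" for a b
    by (rule lift_Suc_antimono_le[of L, OF L(2) that])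
  have LH: "L n \<subseteq> carrier H" for n using subgroup.subset[OF L(1)] .
  show "m dvd v s\<^sub>0 x\<^sub>0"
  proof (rule ccontr)
    assume nz: "\<not> m dvd v s\<^sub>0 x\<^sub>0"
    let ?h\<^sub>0 = "\<phi> x\<^sub>0"
    \<comment> \<open>one \<open>L n\<close> separates \<open>\<phi> x\<^sub>0\<close> from the rest of the support\<close>
    have "\<exists>n. h \<otimes>\<^bsub>H\<^esub> inv\<^bsub>H\<^esub> ?h\<^sub>0 \<notin> L n" if "h \<in> \<Phi> - {?h\<^sub>0}" for h
    proof (rule ccontr)
      assume "\<not> ?thesis"
      then have one: "h \<otimes>\<^bsub>H\<^esub> inv\<^bsub>H\<^esub> ?h\<^sub>0 = \<one>\<^bsub>H\<^esub>" using L(3) by blast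
      have hH: "h \<in> carrier H" using that \<Phi>(2) by blast
      have "h = h \<otimes>\<^bsub>H\<^esub> inv\<^bsub>H\<^esub> ?h\<^sub>0 \<otimes>\<^bsub>H\<^esub> ?h\<^sub>0" using hH ph[OF x\<^sub>0] by (simp add: H.m_assoc)
      then have "h = ?h\<^sub>0" unfolding one using ph[OF x\<^sub>0] by simp
      then show False using that by simp
    qed
    then have "\<forall>h\<in>\<Phi> - {?h\<^sub>0}. \<exists>n. h \<otimes>\<^bsub>H\<^esub> inv\<^bsub>H\<^esub> ?h\<^sub>0 \<notin> L n" by (intro ballI)
    from bchoice[OF this] obtain N where N: "\<forall>h\<in>\<Phi> - {?h\<^sub>0}. h \<otimes>\<^bsub>H\<^esub> inv\<^bsub>H\<^esub> ?h\<^sub>0 \<notin> L (N h)"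
      by (rule exE)
    define n where "n = Max (insert 0 (N ` \<Phi>))"
    have sep: "h = ?h\<^sub>0" if "h \<in> \<Phi>" "h \<otimes>\<^bsub>H\<^esub> inv\<^bsub>H\<^esub> ?h\<^sub>0 \<in> L n" for h
    proof (rule ccontr)
      assume "h \<noteq> ?h\<^sub>0"
      then have "h \<otimes>\<^bsub>H\<^esub> inv\<^bsub>H\<^esub> ?h\<^sub>0 \<notin> L (N h)" using N that(1) by simp
      moreover have "N h \<le> n" unfolding n_def using that(1) \<Phi>(1) by (intro Max_ge) auto
      ultimately show False using that(2) L_antimono[of "N h" n] by blast
    qed
    interpret Ln: subgroup "L n" H by (rule L(1))
    define near where "near h k \<longleftrightarrow> h \<otimes>\<^bsub>H\<^esub> inv\<^bsub>H\<^esub> k \<in> L n" for h k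
    define Pv where "Pv s y = (\<Sum>h\<in>{h\<in>\<Phi>. near h (\<phi> y)}. v s (rep h))" for s y
    have Pv_fun: "coset_function G {x \<in> carrier G. \<phi> x \<in> L n} (carrier G) m (Pv s)" for s
    proof -
      have "near h (\<phi> (y \<otimes> u)) \<longleftrightarrow> near h (\<phi> y)"
        if "h \<in> \<Phi>" "y \<in> carrier G" "u \<in> carrier G" "\<phi> u \<in> L n" for h y u
      proof -
        define a where "a = h \<otimes>\<^bsub>H\<^esub> inv\<^bsub>H\<^esub> \<phi> y"
        have a: "a \<in> carrier H" unfolding a_def using that(1,2) \<Phi>(2) ph by auto
        have "h \<otimes>\<^bsub>H\<^esub> inv\<^bsub>H\<^esub> \<phi> (y \<otimes> u) = a \<otimes>\<^bsub>H\<^esub> inv\<^bsub>H\<^esub> \<phi> u"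
          unfolding a_def using that(1-3) \<Phi>(2) ph by (simp add: H.inv_mult H.m_assoc subset_iff)
        moreover have "a \<otimes>\<^bsub>H\<^esub> inv\<^bsub>H\<^esub> \<phi> u \<in> L n \<longleftrightarrow> a \<in> L n"
        proof
          assume "a \<otimes>\<^bsub>H\<^esub> inv\<^bsub>H\<^esub> \<phi> u \<in> L n"
          then have "a \<otimes>\<^bsub>H\<^esub> inv\<^bsub>H\<^esub> \<phi> u \<otimes>\<^bsub>H\<^esub> \<phi> u \<in> L n" using that(4) by (rule Ln.m_closed)
          then show "a \<in> L n" using a ph[OF that(3)] by (simp add: H.m_assoc)
        qed (use that(4) in simp)
        ultimately show ?thesis unfolding near_def a_def by simp
      qed
      then have "Pv s (y \<otimes> u) = Pv s y" if "y \<in> carrier G" "u \<in> carrier G" "\<phi> u \<in> L n" for y u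
        unfolding Pv_def using that by (intro sum.cong) auto
      then have "\<forall>x\<in>carrier G. \<forall>u\<in>{x \<in> carrier G. \<phi> x \<in> L n}. m dvd Pv s (x \<otimes> u) - Pv s x" by simp
      moreover have "\<forall>x\<in>carrier G. \<exists>f\<in>{\<one>}. \<exists>y\<in>carrier G. x = f \<otimes> y" by simp
      ultimately show ?thesis unfolding coset_function_def
        by (intro conjI exI[of _ "{\<one>}"]) auto
    qed
    \<comment> \<open>summing over fibres commutes with translation by \<open>g\<close>, once the index set \<open>\<Psi>\<close> contains the translated support\<close>
    have Pv_translate: "m dvd (\<Sum>h\<in>{h\<in>\<Psi>. near h (\<phi> y)}. v s (g \<otimes> rep h)) - Pv s (g \<otimes> y)"
      if s: "s \<in> S" and y: "y \<in> carrier G" and g: "g \<in> carrier G" 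
        and \<Psi>: "finite \<Psi>" "\<Psi> \<subseteq> carrier H" "\<And>h. h \<in> \<Phi> \<Longrightarrow> inv\<^bsub>H\<^esub> \<phi> g \<otimes>\<^bsub>H\<^esub> h \<in> \<Psi>" for s y g \<Psi>
    proof -
      let ?A = "{h\<in>\<Psi>. near h (\<phi> y)}" and ?B = "{h\<in>\<Phi>. near h (\<phi> (g \<otimes> y))}"
      let ?\<sigma> = "\<lambda>h. inv\<^bsub>H\<^esub> \<phi> g \<otimes>\<^bsub>H\<^esub> h"
      have \<gamma>: "\<phi> g \<in> carrier H" "\<phi> y \<in> carrier H" using ph g y by auto
      have near_shift: "near (\<phi> g \<otimes>\<^bsub>H\<^esub> h) (\<phi> (g \<otimes> y)) \<longleftrightarrow> near h (\<phi> y)" if h: "h \<in> carrier H" for h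
      proof -
        have "\<phi> g \<otimes>\<^bsub>H\<^esub> (inv\<^bsub>H\<^esub> \<phi> g \<otimes>\<^bsub>H\<^esub> inv\<^bsub>H\<^esub> \<phi> y) = inv\<^bsub>H\<^esub> \<phi> y"
          using \<gamma> by (simp add: H.m_assoc[symmetric])
        then have "\<phi> g \<otimes>\<^bsub>H\<^esub> h \<otimes>\<^bsub>H\<^esub> inv\<^bsub>H\<^esub> \<phi> (g \<otimes> y) = h \<otimes>\<^bsub>H\<^esub> inv\<^bsub>H\<^esub> \<phi> y"
          using h \<gamma> g y by (simp add: H.inv_mult H.m_comm[of "\<phi> g" h] H.m_assoc)
        then show ?thesis unfolding near_def by simp
      qed
      have \<sigma>\<sigma>: "\<phi> g \<otimes>\<^bsub>H\<^esub> ?\<sigma> h = h" if "h \<in> carrier H" for h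
        using that \<gamma> by (simp add: H.m_assoc[symmetric])
      have \<sigma>\<sigma>': "?\<sigma> (\<phi> g \<otimes>\<^bsub>H\<^esub> h) = h" if "h \<in> carrier H" for h
        using that \<gamma> by (simp add: H.m_assoc[symmetric])
      have BA: "?\<sigma> ` ?B \<subseteq> ?A"
      proof
        fix k assume "k \<in> ?\<sigma> ` ?B"
        then obtain h where h: "h \<in> \<Phi>" "near h (\<phi> (g \<otimes> y))" "k = ?\<sigma> h" by blast
        then have "h \<in> carrier H" using \<Phi>(2) by blast
        then have "near (?\<sigma> h) (\<phi> y)" using near_shift[of "?\<sigma> h"] \<sigma>\<sigma> h(2) \<gamma> by simp
        then show "k \<in> ?A" using h \<Psi>(3) by simp
      qed
      have "inj_on ?\<sigma> ?B"
        by (rule inj_on_inverseI[of _ "\<lambda>k. \<phi> g \<otimes>\<^bsub>H\<^esub> k"]) (use \<sigma>\<sigma> \<Phi>(2) in blast)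
      then have "(\<Sum>k\<in>?\<sigma> ` ?B. v s (rep (\<phi> g \<otimes>\<^bsub>H\<^esub> k))) = (\<Sum>h\<in>?B. v s (rep (\<phi> g \<otimes>\<^bsub>H\<^esub> ?\<sigma> h)))"
        by (simp add: sum.reindex)
      also have "\<dots> = Pv s (g \<otimes> y)"
        unfolding Pv_def by (intro sum.cong refl arg_cong[of _ _ "v s"] arg_cong[of _ _ rep] \<sigma>\<sigma>) (use \<Phi>(2) in blast)
      finally have B: "(\<Sum>k\<in>?\<sigma> ` ?B. v s (rep (\<phi> g \<otimes>\<^bsub>H\<^esub> k))) = Pv s (g \<otimes> y)" .
      have A: "(\<Sum>h\<in>?A. v s (g \<otimes> rep h)) = (\<Sum>h\<in>?A - ?\<sigma> ` ?B. v s (g \<otimes> rep h)) + (\<Sum>h\<in>?\<sigma> ` ?B. v s (g \<otimes> rep h))"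
        using BA \<Psi>(1) by (intro sum.subset_diff) auto
      have out: "m dvd v s (g \<otimes> rep h)" if h: "h \<in> ?A - ?\<sigma> ` ?B" for h
      proof (rule ccontr)
        assume n: "\<not> m dvd v s (g \<otimes> rep h)"
        have hH: "h \<in> carrier H" using h \<Psi>(2) by blast
        have "\<phi> (g \<otimes> rep h) \<in> \<Phi>" by (rule supp[OF s _ n]) (use g rep hH in simp)
        then have "\<phi> g \<otimes>\<^bsub>H\<^esub> h \<in> ?B" using h near_shift[OF hH] g rep[OF hH] by simp
        then have "?\<sigma> (\<phi> g \<otimes>\<^bsub>H\<^esub> h) \<in> ?\<sigma> ` ?B" by (rule imageI)
        then show False using h \<sigma>\<sigma>'[OF hH] by simp
      qed
      have ins: "m dvd v s (g \<otimes> rep k) - v s (rep (\<phi> g \<otimes>\<^bsub>H\<^esub> k))" if "k \<in> ?\<sigma> ` ?B" for k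
      proof -
        have "k \<in> carrier H" using that BA \<Psi>(2) by blast
        then show ?thesis using \<gamma> g rep[of k] rep[of "\<phi> g \<otimes>\<^bsub>H\<^esub> k"] by (intro v_cong s) simp_all
      qed
      have "(\<Sum>h\<in>?A. v s (g \<otimes> rep h)) - Pv s (g \<otimes> y) = (\<Sum>h\<in>?A - ?\<sigma> ` ?B. v s (g \<otimes> rep h))
          + (\<Sum>k\<in>?\<sigma> ` ?B. v s (g \<otimes> rep k) - v s (rep (\<phi> g \<otimes>\<^bsub>H\<^esub> k)))"
        unfolding A sum_subtractf B by simp
      also have "m dvd \<dots>"
        by (rule dvd_add[OF dvd_sum[OF out] dvd_sum[OF ins]])
      finally show ?thesis .
    qed
    have "m dvd (\<Sum>s\<in>S. fun_act G (E s t) (Pv s) y)" if y: "y \<in> carrier G" for t y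
    proof -
      define \<Psi> where "\<Psi> = (\<Union>s\<in>S. \<Union>g\<in>Poly_Mapping.keys (E s t). (\<lambda>h. inv\<^bsub>H\<^esub> \<phi> g \<otimes>\<^bsub>H\<^esub> h) ` \<Phi>)"
      let ?A = "{h\<in>\<Psi>. near h (\<phi> y)}"
      have keys: "g \<in> carrier G" if "s \<in> S" "g \<in> Poly_Mapping.keys (E s t)" for s g using E that by blast
      have \<Psi>: "finite \<Psi>" unfolding \<Psi>_def using S \<Phi>(1) by simp
      have \<Psi>H: "\<Psi> \<subseteq> carrier H"
      proof
        fix k assume "k \<in> \<Psi>"
        then obtain s g h where "s \<in> S" "g \<in> Poly_Mapping.keys (E s t)" "h \<in> \<Phi>" "k = inv\<^bsub>H\<^esub> \<phi> g \<otimes>\<^bsub>H\<^esub> h"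
          unfolding \<Psi>_def by blast
        moreover from this have "h \<in> carrier H" "\<phi> g \<in> carrier H" using \<Phi>(2) ph[OF keys] by auto
        ultimately show "k \<in> carrier H" by simp
      qed
      have "(\<Sum>h\<in>?A. \<Sum>s\<in>S. fun_act G (E s t) (v s) (rep h))
          = (\<Sum>s\<in>S. \<Sum>g\<in>Poly_Mapping.keys (E s t). \<Sum>h\<in>?A. of_int (Poly_Mapping.lookup (E s t) g) * v s (g \<otimes> rep h))"
        unfolding fun_act_def
        by (subst sum.swap, intro sum.cong refl, subst sum.swap, rule refl)
      also have "\<dots> - (\<Sum>s\<in>S. fun_act G (E s t) (Pv s) y)
          = (\<Sum>s\<in>S. \<Sum>g\<in>Poly_Mapping.keys (E s t). of_int (Poly_Mapping.lookup (E s t) g) * ((\<Sum>h\<in>?A. v s (g \<otimes> rep h)) - Pv s (g \<otimes> y)))"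
        unfolding fun_act_def by (simp add: sum_subtractf right_diff_distrib sum_distrib_left)
      also have "m dvd \<dots>"
      proof (intro dvd_sum dvd_mult)
        fix s g assume sg: "s \<in> S" "g \<in> Poly_Mapping.keys (E s t)"
        show "m dvd (\<Sum>h\<in>?A. v s (g \<otimes> rep h)) - Pv s (g \<otimes> y)"
          by (rule Pv_translate[OF sg(1) y keys[OF sg] \<Psi> \<Psi>H]) (use sg in \<open>unfold \<Psi>_def, blast\<close>)
      qed
      finally have "m dvd (\<Sum>h\<in>?A. \<Sum>s\<in>S. fun_act G (E s t) (v s) (rep h)) - (\<Sum>s\<in>S. fun_act G (E s t) (Pv s) y)" .
      moreover have "m dvd (\<Sum>h\<in>?A. \<Sum>s\<in>S. fun_act G (E s t) (v s) (rep h))"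
      proof (rule dvd_sum)
        fix h assume "h \<in> ?A"
        then have "rep h \<in> carrier G" using \<Psi>H by (intro rep(1)) blast
        then show "m dvd (\<Sum>s\<in>S. fun_act G (E s t) (v s) (rep h))" using z by blast
      qed
      ultimately show ?thesis by (simp only: dvd_diff_right_iff)
    qed
    then have "m dvd Pv s\<^sub>0 x\<^sub>0"
      using inj[of n] Pv_fun s\<^sub>0 x\<^sub>0 unfolding matrix_injective_def by blast
    moreover have "{h\<in>\<Phi>. near h ?h\<^sub>0} = {?h\<^sub>0}"
    proof -
      have "near ?h\<^sub>0 ?h\<^sub>0" unfolding near_def using ph[OF x\<^sub>0] by simp
      then show ?thesis using supp[OF s\<^sub>0 x\<^sub>0 nz] sep unfolding near_def by blast
    qed
    ultimately have "m dvd v s\<^sub>0 (rep ?h\<^sub>0)" by (simp add: Pv_def)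
    moreover have "m dvd v s\<^sub>0 (rep ?h\<^sub>0) - v s\<^sub>0 x\<^sub>0"
      by (rule v_cong[OF s\<^sub>0]) (use x\<^sub>0 ph[OF x\<^sub>0] rep in auto)
    ultimately show False using nz by (simp only: dvd_diff_right_iff)
  qed
qed

text \<open>Descending induction along subgroups \<open>B\<close> of the \<open>p\<close>-group \<open>\<beta> K\<close>, each of index \<open>p\<close> in the previous one; their
  preimages under \<open>\<beta>\<close> differ by a cyclic step.\<close>

lemma (in group) matrix_injective_p_group_kernel:
  fixes p :: nat
  assumes E: "\<And>s t. s \<in> S \<Longrightarrow> Poly_Mapping.keys (E s t) \<subseteq> carrier G"
    and p: "prime p" and K: "subgroup K G"
    and P: "group P" "finite (carrier P)" "order P = p ^ N"
    and \<beta>: "\<beta> \<in> hom (G\<lparr>carrier := K\<rparr>) P"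
    and top: "matrix_injective G S E K K (int p)"
  shows "matrix_injective G S E {x \<in> K. \<beta> x = \<one>\<^bsub>P\<^esub>} K (int p)"
proof -
  interpret K: subgroup K G by fact
  interpret P: group P by fact
  interpret GK: group "G\<lparr>carrier := K\<rparr>" by (rule K.subgroup_is_group[OF is_group])
  interpret \<beta>: group_hom "G\<lparr>carrier := K\<rparr>" P \<beta>
    by (unfold_locales) (rule \<beta>)
  have \<beta>_mult: "\<beta> (x \<otimes> y) = \<beta> x \<otimes>\<^bsub>P\<^esub> \<beta> y" if "x \<in> K" "y \<in> K" for x y
    using \<beta>.hom_mult[of x y] that by simp
  have \<beta>_closed: "\<beta> x \<in> carrier P" if "x \<in> K" for x
    using \<beta>.hom_closed[of x] that by simp
  have \<beta>_inv: "\<beta> (inv x) = inv\<^bsub>P\<^esub> \<beta> x" if "x \<in> K" for x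
    using \<beta>.hom_inv[of x] that m_inv_consistent[OF K] by simp
  let ?V = "\<lambda>B. {x \<in> K. \<beta> x \<in> B}"
  have descend: "matrix_injective G S E (?V B) K (int p) \<longrightarrow> matrix_injective G S E (?V {\<one>\<^bsub>P\<^esub>}) K (int p)"
    if "subgroup B P" "B \<subseteq> \<beta> ` K" "card B = p ^ n" for B n
    using that
  proof (induction n arbitrary: B)
    case 0
    then have "B = {\<one>\<^bsub>P\<^esub>}"
      using subgroup.one_closed[of B P] by (auto simp: card_1_singleton_iff)
    then show ?case by simp
  next
    case (Suc n)
    interpret B: subgroup B P by (rule Suc.prems(1))
    interpret PB: group "P\<lparr>carrier := B\<rparr>" by (rule B.subgroup_is_group[OF P(1)])
    obtain A c where A: "subgroup A (P\<lparr>carrier := B\<rparr>)" "card A = p ^ n" and c: "c \<in> B"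
      and gen: "generate (P\<lparr>carrier := B\<rparr>) (insert c A) = B"
      and norm: "\<And>a. a \<in> A \<Longrightarrow> inv\<^bsub>P\<^esub> c \<otimes>\<^bsub>P\<^esub> a \<otimes>\<^bsub>P\<^esub> c \<in> A"
    proof (rule PB.p_group_index_p_subgroup[OF p, of n])
      show "order (P\<lparr>carrier := B\<rparr>) = p ^ Suc n" using Suc.prems(3) by (simp add: order_def)
    qed (use P.m_inv_consistent[OF Suc.prems(1)] in auto)
    have AB: "A \<subseteq> B" using subgroup.subset[OF A(1)] by simp
    have AP: "subgroup A P" using P.incl_subgroup[OF Suc.prems(1) A(1)] .
    interpret A: subgroup A P by (rule AP)
    obtain c' where c': "c' \<in> K" "\<beta> c' = c" using c Suc.prems(2) by auto
    have "matrix_injective G S E (?V A) K (int p)" if VB: "matrix_injective G S E (?V B) K (int p)"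
    proof (rule matrix_injective_cyclic_step[OF E p VB _ K c'(1)])
      show "?V A \<subseteq> carrier G" using K.subset by auto
      have VAK: "insert c' (?V A) \<subseteq> K" using c' by auto
      let ?\<Gamma> = "generate G (insert c' (?V A))"
      have \<Gamma>: "subgroup ?\<Gamma> G"
        using VAK K.subset by (intro generate_is_subgroup) blast
      have \<Gamma>K: "?\<Gamma> \<subseteq> K" by (rule generate_subgroup_incl[OF VAK K])
      have imA: "insert c A \<subseteq> \<beta> ` ?\<Gamma>"
      proof -
        have "\<beta> ` insert c' (?V A) \<subseteq> \<beta> ` ?\<Gamma>" by (intro image_mono subsetI generate.incl)
        moreover have "insert c A \<subseteq> \<beta> ` insert c' (?V A)" using c'(2) AB Suc.prems(2) by blast
        ultimately show ?thesis by (rule order_trans[rotated])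
      qed
      have im\<Gamma>: "subgroup (\<beta> ` ?\<Gamma>) P"
        by (rule \<beta>.subgroup_img_is_subgroup[OF subgroup_incl[OF \<Gamma> K \<Gamma>K]])
      have "generate P (insert c A) = B"
        using gen P.generate_consistent[OF _ Suc.prems(1), of "insert c A"] c AB by simp
      then have B: "B \<subseteq> \<beta> ` ?\<Gamma>" using P.generate_subgroup_incl[OF imA im\<Gamma>] by simp
      show "?V B \<subseteq> ?\<Gamma>"
      proof
        fix x assume x: "x \<in> ?V B"
        then obtain y where y: "y \<in> ?\<Gamma>" "\<beta> x = \<beta> y" using B by blast
        have yK: "y \<in> K" using y(1) \<Gamma>K by blast
        have "inv y \<otimes> x \<in> ?V A" using x yK y(2) \<beta>_closed[OF yK] by (simp add: \<beta>_mult \<beta>_inv)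
        then have "y \<otimes> (inv y \<otimes> x) \<in> ?\<Gamma>"
          by (intro subgroup.m_closed[OF \<Gamma> y(1)] generate.incl) blast
        then show "x \<in> ?\<Gamma>" using x yK by (simp add: m_assoc[symmetric])
      qed
      have "c' [^] i \<in> K \<and> \<beta> (c' [^] i) = c [^]\<^bsub>P\<^esub> i" for i :: nat
        using c' by (induction i) (auto simp: \<beta>_mult \<beta>.hom_one[simplified])
      moreover have "c [^]\<^bsub>P\<^esub> (p ^ Suc n) = \<one>\<^bsub>P\<^esub>"
        using PB.pow_order_eq_1[of c] c Suc.prems(3) P.nat_pow_consistent[of c "p ^ Suc n" B]
        by (simp add: order_def)
      ultimately show "c' [^] (p ^ Suc n) \<in> ?V A" by (simp del: power_Suc)
      fix u assume u: "u \<in> ?V A"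
      have "inv c' \<otimes> u \<otimes> c' \<in> ?V A"
        using u c' norm[of "\<beta> u"] by (simp add: \<beta>_mult \<beta>_inv)
      moreover have "u \<otimes> c' = c' \<otimes> (inv c' \<otimes> u \<otimes> c')"
        using u c' by (simp add: m_assoc[symmetric])
      ultimately show "\<exists>u'\<in>?V A. u \<otimes> c' = c' \<otimes> u'" by blast
    qed
    then show ?case using Suc.IH[OF AP _ A(2)] AB Suc.prems(2) by blast
  qed
  have im: "subgroup (\<beta> ` K) P" using \<beta>.img_is_subgroup by simp
  have "card (\<beta> ` K) dvd p ^ N" using P.lagrange[OF im] P(3) by (metis dvd_triv_right)
  then obtain n where "card (\<beta> ` K) = p ^ n" using divides_primepow_nat[OF p] by blast
  moreover have "?V (\<beta> ` K) = K" by auto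
  ultimately show ?thesis using descend[OF im subset_refl] top by simp
qed

section \<open>From \<open>\<int>/p\<close> to \<open>\<rat>\<close>\<close>

text \<open>An integral solution vanishes modulo \<open>p\<close>, and its quotient by \<open>p\<close> is a solution again.\<close>

lemma (in group) matrix_injective_int_of_mod:
  fixes p :: nat
  assumes E: "\<And>s t. s \<in> S \<Longrightarrow> Poly_Mapping.keys (E s t) \<subseteq> carrier G"
    and UW: "U \<subseteq> carrier G"
    and p: "p > 1" and inj: "matrix_injective G S E U W (int p)"
  shows "matrix_injective G S E U W (0::int)"
  unfolding matrix_injective_def
proof (intro allI impI ballI)
  fix v :: "'c \<Rightarrow> 'a \<Rightarrow> int" and s\<^sub>0 x\<^sub>0
  assume v\<^sub>0: "\<forall>s\<in>S. coset_function G U W 0 (v s)"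
    and z\<^sub>0: "\<forall>t. \<forall>x\<in>carrier G. 0 dvd (\<Sum>s\<in>S. fun_act G (E s t) (v s) x)"
    and s\<^sub>0: "s\<^sub>0 \<in> S" and x\<^sub>0: "x\<^sub>0 \<in> carrier G"
  have "int p ^ n dvd v s\<^sub>0 x\<^sub>0"
    if "\<forall>s\<in>S. coset_function G U W 0 (v s)" 
      "\<forall>t. \<forall>x\<in>carrier G. 0 dvd (\<Sum>s\<in>S. fun_act G (E s t) (v s) x)" for n and v :: "'c \<Rightarrow> 'a \<Rightarrow> int"
    using that
  proof (induction n arbitrary: v)
    case (Suc n)
    note v = Suc.prems(1) and z = Suc.prems(2)
    have "coset_function G U W (int p) (v s)" if s: "s \<in> S" for s
    proof -
      obtain F where F: "finite F" "F \<subseteq> carrier G"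
        "\<forall>x\<in>carrier G. \<not> 0 dvd v s x \<longrightarrow> (\<exists>f\<in>F. \<exists>y\<in>W. x = f \<otimes> y)"
        by (rule coset_functionE[OF v[rule_format, OF s]])
      have "\<forall>x\<in>carrier G. \<not> int p dvd v s x \<longrightarrow> (\<exists>f\<in>F. \<exists>y\<in>W. x = f \<otimes> y)"
      proof (intro ballI impI)
        fix x assume x: "x \<in> carrier G" and "\<not> int p dvd v s x"
        then have "\<not> 0 dvd v s x" by (cases "v s x = 0") simp_all
        then show "\<exists>f\<in>F. \<exists>y\<in>W. x = f \<otimes> y" using F(3) x by blast
      qed
      moreover have "\<forall>x\<in>carrier G. \<forall>u\<in>U. int p dvd v s (x \<otimes> u) - v s x"
        using v s unfolding coset_function_def by simp
      ultimately show ?thesis unfolding coset_function_def using F(1,2) by blast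
    qed
    moreover have "\<forall>t. \<forall>x\<in>carrier G. int p dvd (\<Sum>s\<in>S. fun_act G (E s t) (v s) x)"
      using z by simp
    ultimately have dvd: "\<forall>s\<in>S. \<forall>x\<in>carrier G. int p dvd v s x"
      using inj unfolding matrix_injective_def by blast
    define w where "w s x = v s x div int p" for s x
    have vw: "v s x = int p * w s x" if "s \<in> S" "x \<in> carrier G" for s x
      using dvd that unfolding w_def by simp
    have w0: "w s x = 0 \<longleftrightarrow> v s x = 0" if "s \<in> S" "x \<in> carrier G" for s x
      using vw[OF that] p by simp
    have "coset_function G U W 0 (w s)" if s: "s \<in> S" for s
    proof -
      obtain F where F: "finite F" "F \<subseteq> carrier G"
        "\<forall>x\<in>carrier G. \<not> 0 dvd v s x \<longrightarrow> (\<exists>f\<in>F. \<exists>y\<in>W. x = f \<otimes> y)"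
        by (rule coset_functionE[OF v[rule_format, OF s]])
      have "\<forall>x\<in>carrier G. \<not> 0 dvd w s x \<longrightarrow> (\<exists>f\<in>F. \<exists>y\<in>W. x = f \<otimes> y)"
        using F(3) w0[OF s] by simp
      moreover have "\<forall>x\<in>carrier G. \<forall>u\<in>U. 0 dvd w s (x \<otimes> u) - w s x"
        using v s unfolding coset_function_def w_def by simp
      ultimately show ?thesis unfolding coset_function_def using F(1,2) by blast
    qed
    moreover have "0 dvd (\<Sum>s\<in>S. fun_act G (E s t) (w s) x)" if x: "x \<in> carrier G" for t x
    proof -
      have "int p * (\<Sum>s\<in>S. fun_act G (E s t) (w s) x) = (\<Sum>s\<in>S. fun_act G (E s t) (v s) x)"
        unfolding sum_distrib_left
      proof (intro sum.cong refl)
        fix s assume s: "s \<in> S"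
        have "g \<otimes> x \<in> carrier G" if "g \<in> Poly_Mapping.keys (E s t)" for g using E[OF s] that x by blast
        then show "int p * fun_act G (E s t) (w s) x = fun_act G (E s t) (v s) x"
          unfolding fun_act_def sum_distrib_left
          by (intro sum.cong refl) (simp add: vw[OF s] mult.left_commute)
      qed
      also have "\<dots> = 0" using z x by simp
      finally show ?thesis using p by simp
    qed
    ultimately have "int p ^ n dvd w s\<^sub>0 x\<^sub>0" using Suc.IH[of w] by blast
    then show ?case unfolding vw[OF s\<^sub>0 x\<^sub>0] by simp
  qed simp
  then have dvd: "int p ^ n dvd v s\<^sub>0 x\<^sub>0" for n using v\<^sub>0 z\<^sub>0 by blast
  have "v s\<^sub>0 x\<^sub>0 = 0"
  proof (rule ccontr)
    assume nz: "v s\<^sub>0 x\<^sub>0 \<noteq> 0"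
    define n where "n = nat \<bar>v s\<^sub>0 x\<^sub>0\<bar>"
    have "int p ^ n \<le> \<bar>v s\<^sub>0 x\<^sub>0\<bar>" using dvd_imp_le_int[OF nz dvd[of n]] by simp
    also have "\<dots> = int n" by (simp add: n_def)
    also have "int n < int p ^ n"
      using power_gt_expt[of p n] p by (simp flip: of_nat_power)
    finally show False by simp
  qed
  then show "0 dvd v s\<^sub>0 x\<^sub>0" by simp
qed

lemma finite_common_denominator:
  fixes A :: "rat set"
  assumes "finite A"
  shows "\<exists>d::int. d > 0 \<and> (\<forall>a\<in>A. \<exists>b::int. of_int d * a = of_int b)"
  using assms
proof (induction A rule: finite_induct)
  case (insert a A)
  then obtain d :: int where d: "d > 0" "\<forall>a\<in>A. \<exists>b::int. of_int d * a = of_int b" by blast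
  obtain n e where ne: "quotient_of a = (n, e)" by fastforce
  have e: "e > 0" "a = of_int n / of_int e" using quotient_of_denom_pos[OF ne] quotient_of_div[OF ne] by auto
  show ?case
  proof (rule exI[of _ "d * e"], intro conjI ballI)
    fix x assume x: "x \<in> insert a A"
    show "\<exists>b::int. of_int (d * e) * x = of_int b"
    proof (cases "x = a")
      case True
      then show ?thesis using e by (intro exI[of _ "d * n"]) simp
    next
      case False
      then obtain b :: int where b: "of_int d * x = of_int b" using d(2) x by blast
      have "of_int (d * e) * x = of_int e * (of_int d * x)" by (simp only: of_int_mult ac_simps)
      also have "\<dots> = of_int (e * b)" by (simp add: b)
      finally show ?thesis by (rule exI)
    qed
  qed (use d e in simp)
qed (intro exI[of _ 1], simp)

text \<open>The set \<open>T\<close> represents the cosets of \<open>U\<close> in \<open>W\<close>. Its finiteness makes the functions take finitely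
  many values, so that they have a common denominator.\<close>

lemma (in group) matrix_injective_rat_of_int:
  assumes E: "\<And>s t. s \<in> S \<Longrightarrow> Poly_Mapping.keys (E s t) \<subseteq> carrier G"
    and S: "finite S"
    and UW: "U \<subseteq> carrier G" "W \<subseteq> carrier G"
    and T: "finite T" "T \<subseteq> carrier G" "\<And>y. y \<in> W \<Longrightarrow> \<exists>t\<in>T. \<exists>u\<in>U. y = t \<otimes> u"
    and inj: "matrix_injective G S E U W (0::int)"
  shows "matrix_injective G S E U W (0::rat)"
  unfolding matrix_injective_def
proof (intro allI impI)
  fix v :: "'c \<Rightarrow> 'a \<Rightarrow> rat"
  assume v: "\<forall>s\<in>S. coset_function G U W 0 (v s)"
    and z: "\<forall>t. \<forall>x\<in>carrier G. 0 dvd (\<Sum>s\<in>S. fun_act G (E s t) (v s) x)"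
  have fin: "finite (v s ` carrier G)" if s: "s \<in> S" for s
  proof -
    obtain F where F: "finite F" "F \<subseteq> carrier G"
      "\<forall>x\<in>carrier G. \<not> 0 dvd v s x \<longrightarrow> (\<exists>f\<in>F. \<exists>y\<in>W. x = f \<otimes> y)"
      by (rule coset_functionE[OF v[rule_format, OF s]])
    have "v s ` carrier G \<subseteq> insert 0 ((\<lambda>(f, t). v s (f \<otimes> t)) ` (F \<times> T))"
    proof
      fix a assume "a \<in> v s ` carrier G"
      then obtain x where x: "x \<in> carrier G" "a = v s x" by blast
      show "a \<in> insert 0 ((\<lambda>(f, t). v s (f \<otimes> t)) ` (F \<times> T))"
      proof (cases "v s x = 0")
        case False
        then obtain f y where f: "f \<in> F" "y \<in> W" "x = f \<otimes> y" using F(3) x(1) by auto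
        then obtain t u where t: "t \<in> T" "u \<in> U" "y = t \<otimes> u" using T(3) by blast
        have c: "f \<in> carrier G" "t \<in> carrier G" "u \<in> carrier G" using f t F(2) T(2) UW by auto
        have "0 dvd v s (f \<otimes> t \<otimes> u) - v s (f \<otimes> t)"
          using v s t(2) c unfolding coset_function_def by blast
        then have "a = v s (f \<otimes> t)" using c by (simp add: x f t m_assoc)
        then show ?thesis using f(1) t(1) by (intro insertI2 image_eqI[of _ _ "(f, t)"]) simp_all
      qed (simp add: x)
    qed
    then show ?thesis by (rule finite_subset) (use F(1) T(1) in simp)
  qed
  have "finite (\<Union>s\<in>S. v s ` carrier G)" using S fin by simp
  from finite_common_denominator[OF this] obtain d :: int
    where d: "d > 0" "\<forall>a\<in>(\<Union>s\<in>S. v s ` carrier G). \<exists>b::int. of_int d * a = of_int b"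
    by (elim exE conjE)
  define w where "w s x = \<lfloor>of_int d * v s x\<rfloor>" for s x
  have w: "of_int (w s x) = of_int d * v s x" if sx: "s \<in> S" "x \<in> carrier G" for s x
  proof -
    obtain b :: int where "of_int d * v s x = of_int b" using d(2) sx by blast
    then show ?thesis by (simp add: w_def)
  qed
  have w0: "w s x = 0 \<longleftrightarrow> v s x = 0" if "s \<in> S" "x \<in> carrier G" for s x
    using w[OF that] d(1) by (metis less_irrefl mult_eq_0_iff of_int_eq_0_iff)
  have "coset_function G U W 0 (w s)" if s: "s \<in> S" for s
  proof -
    have "w s (x \<otimes> u) = w s x" if xu: "x \<in> carrier G" "u \<in> U" for x u
    proof -
      have "v s (x \<otimes> u) = v s x" using v s xu unfolding coset_function_def by simp
      then show ?thesis by (simp add: w_def)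
    qed
    then have "\<forall>x\<in>carrier G. \<forall>u\<in>U. 0 dvd w s (x \<otimes> u) - w s x" by simp
    moreover obtain F where F: "finite F" "F \<subseteq> carrier G"
      "\<forall>x\<in>carrier G. \<not> 0 dvd v s x \<longrightarrow> (\<exists>f\<in>F. \<exists>y\<in>W. x = f \<otimes> y)"
      by (rule coset_functionE[OF v[rule_format, OF s]])
    moreover have "\<forall>x\<in>carrier G. \<not> 0 dvd w s x \<longrightarrow> (\<exists>f\<in>F. \<exists>y\<in>W. x = f \<otimes> y)"
      using F(3) w0[OF s] by simp
    ultimately show ?thesis unfolding coset_function_def by blast
  qed
  moreover have "0 dvd (\<Sum>s\<in>S. fun_act G (E s t) (w s) x)" if x: "x \<in> carrier G" for t x
  proof -
    have "(of_int (\<Sum>s\<in>S. fun_act G (E s t) (w s) x) :: rat) = (\<Sum>s\<in>S. of_int d * fun_act G (E s t) (v s) x)"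
      unfolding of_int_sum
    proof (intro sum.cong refl)
      fix s assume s: "s \<in> S"
      have "g \<otimes> x \<in> carrier G" if "g \<in> Poly_Mapping.keys (E s t)" for g using E[OF s] that x by blast
      then show "(of_int (fun_act G (E s t) (w s) x) :: rat) = of_int d * fun_act G (E s t) (v s) x"
        unfolding fun_act_def of_int_sum sum_distrib_left
        by (intro sum.cong refl) (simp add: w[OF s] mult.left_commute)
    qed
    also have "\<dots> = 0" using z x by (simp add: sum_distrib_left[symmetric])
    finally have "(\<Sum>s\<in>S. fun_act G (E s t) (w s) x) = 0" by (simp only: of_int_eq_0_iff)
    then show ?thesis by simp
  qed
  ultimately have "\<forall>s\<in>S. \<forall>x\<in>carrier G. 0 dvd w s x" using inj unfolding matrix_injective_def by blast
  then show "\<forall>s\<in>S. \<forall>x\<in>carrier G. 0 dvd v s x" using w0 by simp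
qed

text \<open>The descent runs from \<open>G\<close> over the preimages of the subgroups \<open>L n\<close> of \<open>p ^ n\<close>-th powers to \<open>ker \<phi>\<close> and on
  to \<open>ker \<beta>\<close>, all modulo \<open>p\<close>; only then are the coefficients changed, first to \<open>\<int>\<close> and then to \<open>\<rat>\<close>.\<close>

lemma matrix_injective_rational:
  fixes G (structure) and p :: nat
  assumes G: "finitely_generated_group G" and p: "prime p"
    and H: "torsion_free_abelian_group H" and \<phi>: "\<phi> \<in> epi G H"
    and P: "p_group p P" and \<beta>: "\<beta> \<in> hom (G\<lparr>carrier := kernel G H \<phi>\<rparr>) P"
    and S: "finite S"
    and E: "\<And>s t. s \<in> S \<Longrightarrow> Poly_Mapping.keys (E s t) \<subseteq> carrier G"
    and aug: "\<And>c. (\<And>t. int p dvd (\<Sum>s\<in>S. augmentation (E s t) * c s)) \<Longrightarrow> \<forall>s\<in>S. int p dvd c s"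
  shows "matrix_injective G S E {x \<in> kernel G H \<phi>. \<beta> x = \<one>\<^bsub>P\<^esub>} (kernel G H \<phi>) (0::rat)"
proof -
  let ?K = "kernel G H \<phi>" and ?U = "{x \<in> kernel G H \<phi>. \<beta> x = \<one>\<^bsub>P\<^esub>}"
  obtain T where T: "finite T" "T \<subseteq> carrier G" "generate G T = carrier G"
    using G unfolding finitely_generated_group_def by blast
  interpret group G using G by (simp add: finitely_generated_group_def)
  interpret H: comm_group H using H by (simp add: torsion_free_abelian_group_def)
  interpret \<phi>: group_hom G H \<phi> by unfold_locales (use \<phi> in \<open>simp add: epi_def\<close>)
  have im: "\<phi> ` carrier G = carrier H" using \<phi> by (simp add: epi_def)
  have p1: "p > 1" using p prime_gt_1_nat by simp
  obtain N where P': "group P" "finite (carrier P)" "order P = p ^ N"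
    using P unfolding p_group_def by blast
  interpret P: group P by (rule P'(1))
  have tf: "h = \<one>\<^bsub>H\<^esub>" if "h \<in> carrier H" "n > (0::nat)" "h [^]\<^bsub>H\<^esub> n = \<one>\<^bsub>H\<^esub>" for h n
    using H that unfolding torsion_free_abelian_group_def by blast
  define L where "L n = {h [^]\<^bsub>H\<^esub> (p ^ n) | h. h \<in> carrier H}" for n :: nat
  have L: "subgroup (L n) H" for n
  proof (rule H.subgroupI)
    show "L n \<subseteq> carrier H" unfolding L_def by auto
    show "L n \<noteq> {}" unfolding L_def using H.one_closed by blast
    fix a assume "a \<in> L n"
    then obtain h where h: "h \<in> carrier H" "a = h [^]\<^bsub>H\<^esub> (p ^ n)" unfolding L_def by blast
    then have "inv\<^bsub>H\<^esub> a = (inv\<^bsub>H\<^esub> h) [^]\<^bsub>H\<^esub> (p ^ n)" by (simp add: H.nat_pow_inv)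
    then show "inv\<^bsub>H\<^esub> a \<in> L n" unfolding L_def using H.inv_closed[OF h(1)] by blast
    fix b assume "b \<in> L n"
    then obtain k where k: "k \<in> carrier H" "b = k [^]\<^bsub>H\<^esub> (p ^ n)" unfolding L_def by blast
    have "a \<otimes>\<^bsub>H\<^esub> b = (h \<otimes>\<^bsub>H\<^esub> k) [^]\<^bsub>H\<^esub> (p ^ n)" using h k by (simp add: H.nat_pow_distrib)
    then show "a \<otimes>\<^bsub>H\<^esub> b \<in> L n" unfolding L_def using H.m_closed[OF h(1) k(1)] by blast
  qed
  have L_dec: "L (Suc n) \<subseteq> L n" for n
  proof
    fix a assume "a \<in> L (Suc n)"
    then obtain h where h: "h \<in> carrier H" "a = h [^]\<^bsub>H\<^esub> (p ^ Suc n)" unfolding L_def by blast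
    then have "a = (h [^]\<^bsub>H\<^esub> p) [^]\<^bsub>H\<^esub> (p ^ n)" by (simp add: H.nat_pow_pow)
    then show "a \<in> L n" unfolding L_def using H.nat_pow_closed[OF h(1), of p] by blast
  qed
  have L_inter: "(\<Inter>n. L n) = {\<one>\<^bsub>H\<^esub>}"
  proof (intro equalityI subsetI)
    fix h assume h: "h \<in> (\<Inter>n. L n)"
    have "h = \<one>\<^bsub>H\<^esub>"
    proof (rule H.infinitely_divisible_trivial[OF tf p1, where S = "\<phi> ` T"])
      show "finite (\<phi> ` T)" "\<phi> ` T \<subseteq> carrier H" using T im by auto
      show "generate H (\<phi> ` T) = carrier H"
        using \<phi>.generate_img[OF T(2)] T(3) im by simp
      fix n
      have "h \<in> L n" using h by simp
      then show "\<exists>y\<in>carrier H. h = y [^]\<^bsub>H\<^esub> (p ^ n)" unfolding L_def by (elim CollectE exE conjE) (rule bexI)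
    qed
    then show "h \<in> {\<one>\<^bsub>H\<^esub>}" by simp
  next
    fix h assume "h \<in> {\<one>\<^bsub>H\<^esub>}"
    then show "h \<in> (\<Inter>n. L n)" using subgroup.one_closed[OF L] by blast
  qed
  have "matrix_injective G S E {x \<in> carrier G. \<phi> x \<in> L n} (carrier G) (int p)" for n
  proof (rule matrix_injective_abelian_power_quotient[OF E p T])
    show "subgroup {x \<in> carrier G. \<phi> x \<in> L n} G"
      using subgroup.one_closed[OF L] subgroup.m_closed[OF L] subgroup.m_inv_closed[OF L]
      by (intro subgroupI) auto
    show "x [^] (p ^ n) \<in> {x \<in> carrier G. \<phi> x \<in> L n}" if "x \<in> carrier G" for x
      using that \<phi>.hom_closed[OF that] unfolding L_def by (auto simp: \<phi>.hom_nat_pow)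
    show "\<exists>u\<in>{x \<in> carrier G. \<phi> x \<in> L n}. x \<otimes> y = y \<otimes> x \<otimes> u"
      if xy: "x \<in> carrier G" "y \<in> carrier G" for x y
    proof (intro bexI CollectI conjI)
      show "x \<otimes> y = y \<otimes> x \<otimes> (inv (y \<otimes> x) \<otimes> (x \<otimes> y))" using xy by (simp add: m_assoc[symmetric])
      have "\<phi> (inv (y \<otimes> x) \<otimes> (x \<otimes> y)) = \<one>\<^bsub>H\<^esub>"
        using xy by (simp add: H.m_comm[of "\<phi> x" "\<phi> y"])
      then show "\<phi> (inv (y \<otimes> x) \<otimes> (x \<otimes> y)) \<in> L n" using subgroup.one_closed[OF L] by simp
    qed (use xy in simp)
    show "matrix_injective G S E (carrier G) (carrier G) (int p)"
      by (rule matrix_injective_carrier[OF E aug])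
  qed
  then have "matrix_injective G S E ?K ?K (int p)"
    by (intro matrix_injective_residual[OF E S _ \<phi> L L_dec L_inter]) (unfold_locales)
  then have "matrix_injective G S E ?U ?K (int p)"
    by (intro matrix_injective_p_group_kernel[OF E p \<phi>.subgroup_kernel P' \<beta>])
  then have int: "matrix_injective G S E ?U ?K (0::int)"
    by (intro matrix_injective_int_of_mod[OF E _ p1]) (auto simp: kernel_def)
  \<comment> \<open>choosing preimages of the finitely many values of \<open>\<beta>\<close> gives representatives for the cosets of \<open>ker \<beta>\<close>\<close>
  define rep where "rep b = (SOME y. y \<in> ?K \<and> \<beta> y = b)" for b
  have rep: "rep (\<beta> y) \<in> ?K \<and> \<beta> (rep (\<beta> y)) = \<beta> y" if "y \<in> ?K" for y
    unfolding rep_def by (rule someI[of _ y]) (use that in simp)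
  interpret K: subgroup ?K G by (rule \<phi>.subgroup_kernel)
  interpret GK: group "G\<lparr>carrier := ?K\<rparr>" by (rule K.subgroup_is_group[OF is_group])
  interpret \<beta>: group_hom "G\<lparr>carrier := ?K\<rparr>" P \<beta> by unfold_locales (rule \<beta>)
  have cov: "\<exists>t\<in>rep ` \<beta> ` ?K. \<exists>u\<in>?U. y = t \<otimes> u" if y: "y \<in> ?K" for y
  proof (intro bexI)
    let ?t = "rep (\<beta> y)"
    have t: "?t \<in> ?K" "\<beta> ?t = \<beta> y" using rep[OF y] by auto
    show "y = ?t \<otimes> (inv ?t \<otimes> y)" using t y K.subset by (simp add: m_assoc[symmetric] subset_iff)
    have "\<beta> (inv ?t \<otimes> y) = inv\<^bsub>P\<^esub> \<beta> ?t \<otimes>\<^bsub>P\<^esub> \<beta> y"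
      using \<beta>.hom_mult[of "inv ?t" y] \<beta>.hom_inv[of ?t] t(1) y m_inv_consistent[OF K.subgroup_axioms t(1)] by simp
    also have "\<dots> = \<one>\<^bsub>P\<^esub>" using \<beta>.hom_closed[of y] y by (simp add: t(2))
    finally show "inv ?t \<otimes> y \<in> ?U" using t y by simp
  qed (use y in simp)
  have "\<beta> ` ?K \<subseteq> carrier P" using \<beta>.hom_closed by (intro image_subsetI) simp
  then have fin: "finite (rep ` \<beta> ` ?K)" using P'(2) by (simp only: finite_subset finite_imageI)
  have "rep ` \<beta> ` ?K \<subseteq> carrier G"
    unfolding image_image by (intro image_subsetI K.mem_carrier rep[THEN conjunct1])
  moreover have "?U \<subseteq> carrier G" using K.mem_carrier by (intro subsetI) simp
  ultimately show ?thesis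
    by (intro matrix_injective_rat_of_int[OF E S _ K.subset fin _ cov int])
qed

section \<open>Tensor products with projective modules in coordinates\<close>

definition left_functional ::
    "('r, 'c) ring_scheme \<Rightarrow> ('r, 'm, 'd) module_scheme \<Rightarrow> ('m \<Rightarrow> 'r) \<Rightarrow> bool" where
  "left_functional R M \<eta> \<longleftrightarrow>
     \<eta> \<in> carrier M \<rightarrow> carrier R \<and>
     (\<forall>x\<in>carrier M. \<forall>y\<in>carrier M. \<eta> (x \<oplus>\<^bsub>M\<^esub> y) = \<eta> x \<oplus>\<^bsub>R\<^esub> \<eta> y) \<and>
     (\<forall>r\<in>carrier R. \<forall>x\<in>carrier M. \<eta> (r \<odot>\<^bsub>M\<^esub> x) = r \<otimes>\<^bsub>R\<^esub> \<eta> x)"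

text \<open>Expansions are demanded over every finite set containing the support, so that expansions of several
  elements can be compared over a common set.\<close>

definition dual_basis ::
    "('r, 'c) ring_scheme \<Rightarrow> ('r, 'm, 'd) module_scheme \<Rightarrow> 's set \<Rightarrow> ('s \<Rightarrow> 'm) \<Rightarrow>
     ('s \<Rightarrow> 'm \<Rightarrow> 'r) \<Rightarrow> bool" where
  "dual_basis R M S b c \<longleftrightarrow>
     b \<in> S \<rightarrow> carrier M \<and> (\<forall>s\<in>S. left_functional R M (c s)) \<and>
     (\<forall>m\<in>carrier M. finite {s \<in> S. c s m \<noteq> \<zero>\<^bsub>R\<^esub>} \<and>
        (\<forall>F. finite F \<longrightarrow> F \<subseteq> S \<longrightarrow> {s \<in> S. c s m \<noteq> \<zero>\<^bsub>R\<^esub>} \<subseteq> F \<longrightarrow>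
             m = finsum M (\<lambda>s. c s m \<odot>\<^bsub>M\<^esub> b s) F))"

lemma dual_basisD:
  assumes "dual_basis R M S b c"
  shows "s \<in> S \<Longrightarrow> b s \<in> carrier M"
    and "s \<in> S \<Longrightarrow> left_functional R M (c s)"
    and "m \<in> carrier M \<Longrightarrow> finite {s \<in> S. c s m \<noteq> \<zero>\<^bsub>R\<^esub>}"
    and "\<lbrakk>m \<in> carrier M; finite F; F \<subseteq> S; {s \<in> S. c s m \<noteq> \<zero>\<^bsub>R\<^esub>} \<subseteq> F\<rbrakk> \<Longrightarrow>
      m = finsum M (\<lambda>s. c s m \<odot>\<^bsub>M\<^esub> b s) F"
  using assms unfolding dual_basis_def by blast+

lemma left_functional_closed:
  "left_functional R M \<eta> \<Longrightarrow> m \<in> carrier M \<Longrightarrow> \<eta> m \<in> carrier R"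
  unfolding left_functional_def by blast

lemma left_functional_comp:
  assumes "f \<in> left_module_hom R M N" "left_functional R N \<theta>"
  shows "left_functional R M (\<lambda>m. \<theta> (f m))"
  using assms unfolding left_functional_def left_module_hom_def by (auto simp: Pi_iff)

text \<open>For a retraction of a free module onto \<open>M\<close>, take the images of the standard basis vectors, together
  with the coordinates of the section.\<close>

lemma projective_dual_basis:
  assumes "projective_left_module R M"
  obtains S :: "'m set" and b c where "dual_basis R (M :: ('r, 'm, 'd) module_scheme) S b c"
proof -
  obtain S :: "'m set" and i r where M: "left_module R M"
    and i: "i \<in> left_module_hom R M (free_left_module R S)"
    and r: "r \<in> left_module_hom R (free_left_module R S) M"
    and ri: "\<And>x. x \<in> carrier M \<Longrightarrow> r (i x) = x"
    using assms unfolding projective_left_module_def by blast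
  interpret M: left_module R M by fact
  let ?F = "free_left_module R S"
  define \<delta> where "\<delta> s = (\<lambda>s'. if s' = s then \<one>\<^bsub>R\<^esub> else \<zero>\<^bsub>R\<^esub>)" for s :: 'm
  define b where "b s = r (\<delta> s)" for s
  define c where "c s m = i m s" for s m
  have \<delta>: "\<delta> s \<in> carrier ?F" if "s \<in> S" for s
  proof -
    have "finite {s'. \<delta> s s' \<noteq> \<zero>\<^bsub>R\<^esub>}" by (rule finite_subset[of _ "{s}"]) (auto simp: \<delta>_def)
    then show ?thesis using that by (simp add: free_left_module_def \<delta>_def)
  qed
  have r_closed: "r x \<in> carrier M" if "x \<in> carrier ?F" for x
    using r that unfolding left_module_hom_def by blast
  have r_add: "r (\<lambda>s. x s \<oplus>\<^bsub>R\<^esub> y s) = r x \<oplus>\<^bsub>M\<^esub> r y" if "x \<in> carrier ?F" "y \<in> carrier ?F" for x y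
    using r that unfolding left_module_hom_def by (simp add: free_left_module_def)
  have r_smult: "r (\<lambda>s. a \<otimes>\<^bsub>R\<^esub> x s) = a \<odot>\<^bsub>M\<^esub> r x" if "a \<in> carrier R" "x \<in> carrier ?F" for a x
    using r that unfolding left_module_hom_def by (simp add: free_left_module_def)
  have b_closed: "b s \<in> carrier M" if "s \<in> S" for s
    unfolding b_def by (rule r_closed[OF \<delta>[OF that]])
  have expand: "z \<in> carrier ?F \<Longrightarrow> {s. z s \<noteq> \<zero>\<^bsub>R\<^esub>} \<subseteq> F \<Longrightarrow> r z = finsum M (\<lambda>s. z s \<odot>\<^bsub>M\<^esub> b s) F"
    if "finite F" "F \<subseteq> S" for F z
    using that
  proof (induction F arbitrary: z rule: finite_induct)
    case empty
    then have "z = (\<lambda>_. \<zero>\<^bsub>R\<^esub>)" by auto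
    moreover have "r (\<lambda>_. \<zero>\<^bsub>R\<^esub>) = \<zero>\<^bsub>M\<^esub>"
    proof -
      have z0: "(\<lambda>_. \<zero>\<^bsub>R\<^esub>) \<in> carrier ?F" by (simp add: free_left_module_def)
      have "r (\<lambda>_. \<zero>\<^bsub>R\<^esub>) = r (\<lambda>_. \<zero>\<^bsub>R\<^esub>) \<oplus>\<^bsub>M\<^esub> r (\<lambda>_. \<zero>\<^bsub>R\<^esub>)"
        using r_add[OF z0 z0] by simp
      then show ?thesis using M.M.add.l_cancel_one'[OF r_closed[OF z0] r_closed[OF z0]] by simp
    qed
    ultimately show ?case by simp
  next
    case (insert s F)
    have s: "s \<in> S" and FS: "F \<subseteq> S" using insert.prems by auto
    have zR: "z t \<in> carrier R" for t using insert.prems by (simp add: free_left_module_def)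
    define y where "y = (\<lambda>t. if t = s then \<zero>\<^bsub>R\<^esub> else z t)"
    have y: "y \<in> carrier ?F" 
    proof -
      have "finite {t. y t \<noteq> \<zero>\<^bsub>R\<^esub>}"
        by (rule finite_subset[of _ "{t. z t \<noteq> \<zero>\<^bsub>R\<^esub>}"]) (use insert.prems in \<open>auto simp: y_def free_left_module_def\<close>)
      then show ?thesis using insert.prems by (simp add: y_def free_left_module_def)
    qed
    have yF: "{t. y t \<noteq> \<zero>\<^bsub>R\<^esub>} \<subseteq> F" using insert.prems by (auto simp: y_def)
    have zs\<delta>: "(\<lambda>t. z s \<otimes>\<^bsub>R\<^esub> \<delta> s t) \<in> carrier ?F"
    proof -
      have "finite {t. z s \<otimes>\<^bsub>R\<^esub> \<delta> s t \<noteq> \<zero>\<^bsub>R\<^esub>}" by (rule finite_subset[of _ "{s}"]) (use zR in \<open>auto simp: \<delta>_def\<close>)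
      then show ?thesis using s zR by (simp add: free_left_module_def \<delta>_def)
    qed
    have "z = (\<lambda>t. z s \<otimes>\<^bsub>R\<^esub> \<delta> s t \<oplus>\<^bsub>R\<^esub> y t)" using zR by (auto simp: \<delta>_def y_def)
    then have "r z = r (\<lambda>t. z s \<otimes>\<^bsub>R\<^esub> \<delta> s t) \<oplus>\<^bsub>M\<^esub> r y" using r_add[OF zs\<delta> y] by simp
    also have "r (\<lambda>t. z s \<otimes>\<^bsub>R\<^esub> \<delta> s t) = z s \<odot>\<^bsub>M\<^esub> b s" unfolding b_def by (rule r_smult[OF zR \<delta>[OF s]])
    also have "r y = finsum M (\<lambda>t. y t \<odot>\<^bsub>M\<^esub> b t) F" by (rule insert.IH[OF y yF FS])
    also have "\<dots> = finsum M (\<lambda>t. z t \<odot>\<^bsub>M\<^esub> b t) F"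
      by (rule M.M.finsum_cong') (use insert.hyps FS zR b_closed M.smult_closed in \<open>auto simp: y_def\<close>)
    also have "z s \<odot>\<^bsub>M\<^esub> b s \<oplus>\<^bsub>M\<^esub> \<dots> = finsum M (\<lambda>t. z t \<odot>\<^bsub>M\<^esub> b t) (insert s F)"
      by (rule M.M.finsum_insert[symmetric]) (use insert.hyps s FS zR b_closed M.smult_closed in auto)
    finally show ?case .
  qed
  have i_closed: "i m \<in> carrier ?F" if "m \<in> carrier M" for m
    using i that unfolding left_module_hom_def by blast
  have "dual_basis R M S b c"
    unfolding dual_basis_def
  proof (intro conjI ballI allI impI)
    show "b \<in> S \<rightarrow> carrier M" using b_closed by blast
    fix s show "left_functional R M (c s)"
      using i unfolding left_functional_def left_module_hom_def c_def
      by (auto simp: free_left_module_def)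
  next
    fix m assume m: "m \<in> carrier M"
    have supp: "{s \<in> S. c s m \<noteq> \<zero>\<^bsub>R\<^esub>} = {s. i m s \<noteq> \<zero>\<^bsub>R\<^esub>}"
      using i_closed[OF m] unfolding c_def by (auto simp: free_left_module_def)
    show "finite {s \<in> S. c s m \<noteq> \<zero>\<^bsub>R\<^esub>}"
      unfolding supp using i_closed[OF m] by (simp add: free_left_module_def)
    fix F assume F: "finite F" "F \<subseteq> S" "{s \<in> S. c s m \<noteq> \<zero>\<^bsub>R\<^esub>} \<subseteq> F"
    show "m = finsum M (\<lambda>s. c s m \<odot>\<^bsub>M\<^esub> b s) F"
      using expand[OF F(1,2) i_closed[OF m] F(3)[unfolded supp]] ri[OF m] unfolding c_def by simp
  qed
  then show ?thesis by (rule that)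
qed

text \<open>The homomorphism on \<open>A \<otimes> M\<close> given by \<open>a \<otimes> m \<mapsto> a \<cdot> \<eta> m\<close>, lifted to the free abelian group on pairs.\<close>

definition contraction ::
    "('r, 'a, 'd) module_scheme \<Rightarrow> ('r, 'm, 'e) module_scheme \<Rightarrow> ('m \<Rightarrow> 'r) \<Rightarrow>
     ('a \<times> 'm \<Rightarrow>\<^sub>0 int) \<Rightarrow> 'a" where
  "contraction A M \<eta> =
     (SOME h. h \<in> hom (free_Abelian_group (carrier A \<times> carrier M)) (add_monoid A) \<and>
        (\<forall>a\<in>carrier A. \<forall>m\<in>carrier M. h (frag_of (a, m)) = \<eta> m \<odot>\<^bsub>A\<^esub> a))"

text \<open>The elements of \<open>free_pairs\<close> represent those of the tensor product; equality there means that the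
  difference lies in \<open>relations\<close>.\<close>

locale tensor_pair = A: right_module R A + M: left_module R M
  for R :: "('r, 'c) ring_scheme" and A :: "('r, 'a, 'd) module_scheme"
    and M :: "('r, 'm, 'e) module_scheme"
begin

abbreviation "free_pairs \<equiv> free_Abelian_group (carrier A \<times> carrier M)"
abbreviation "relations \<equiv> tensor_kernel R A M"

lemma free_pairs_simps [simp]:
  "x \<in> carrier free_pairs \<longleftrightarrow> Poly_Mapping.keys x \<subseteq> carrier A \<times> carrier M"
  by (rule carrier_free_Abelian_group_iff)

lemma diff_closed:
  "x \<in> carrier free_pairs \<Longrightarrow> y \<in> carrier free_pairs \<Longrightarrow> x - y \<in> carrier free_pairs"
  using keys_diff[of x y] by auto

lemma relations_subgroup: "subgroup relations free_pairs"
  by (intro tensor_kernel_subgroup A.right_module_axioms M.left_module_axioms)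

lemma relations_closed: "x \<in> relations \<Longrightarrow> x \<in> carrier free_pairs"
  using subgroup.subset[OF relations_subgroup] by blast

lemma relations_zero: "0 \<in> relations"
  using subgroup.one_closed[OF relations_subgroup] by simp

lemma relations_add: "x \<in> relations \<Longrightarrow> y \<in> relations \<Longrightarrow> x + y \<in> relations"
  using subgroup.m_closed[OF relations_subgroup] by simp

lemma relations_uminus: "x \<in> relations \<Longrightarrow> - x \<in> relations"
  using subgroup.m_inv_closed[OF relations_subgroup, of x] relations_closed[of x]
  by (simp only: inv_free_Abelian_group carrier_free_Abelian_group_iff)

lemma relations_diff: "x \<in> relations \<Longrightarrow> y \<in> relations \<Longrightarrow> x - y \<in> relations"
  using relations_add[of x "- y"] relations_uminus by simp

lemma relations_sum: "(\<And>s. s \<in> F \<Longrightarrow> x s \<in> relations) \<Longrightarrow> sum x F \<in> relations"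
  by (induction F rule: infinite_finite_induct) (auto intro: relations_zero relations_add)

lemma relator_left:
  "\<lbrakk>a \<in> carrier A; a' \<in> carrier A; m \<in> carrier M\<rbrakk> \<Longrightarrow>
    frag_of (a \<oplus>\<^bsub>A\<^esub> a', m) - frag_of (a, m) - frag_of (a', m) \<in> relations"
  unfolding tensor_kernel_def tensor_relators_def by (intro generate.incl UnI1) blast

lemma relator_right:
  "\<lbrakk>a \<in> carrier A; m \<in> carrier M; m' \<in> carrier M\<rbrakk> \<Longrightarrow>
    frag_of (a, m \<oplus>\<^bsub>M\<^esub> m') - frag_of (a, m) - frag_of (a, m') \<in> relations"
  unfolding tensor_kernel_def tensor_relators_def by (intro generate.incl, rule UnI1, rule UnI2) blast

lemma relator_scalar:
  "\<lbrakk>r \<in> carrier R; a \<in> carrier A; m \<in> carrier M\<rbrakk> \<Longrightarrow>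
    frag_of (r \<odot>\<^bsub>A\<^esub> a, m) - frag_of (a, r \<odot>\<^bsub>M\<^esub> m) \<in> relations"
  unfolding tensor_kernel_def tensor_relators_def by (intro generate.incl UnI2) blast

lemma relator_zero_left: "m \<in> carrier M \<Longrightarrow> frag_of (\<zero>\<^bsub>A\<^esub>, m) \<in> relations"
  using relations_uminus[OF relator_left[of "\<zero>\<^bsub>A\<^esub>" "\<zero>\<^bsub>A\<^esub>" m]] by simp

lemma relator_zero_right: "a \<in> carrier A \<Longrightarrow> frag_of (a, \<zero>\<^bsub>M\<^esub>) \<in> relations"
  using relations_uminus[OF relator_right[of a "\<zero>\<^bsub>M\<^esub>" "\<zero>\<^bsub>M\<^esub>"]] by simp

lemma relator_diff_left:
  assumes "a \<in> carrier A" "a' \<in> carrier A" "m \<in> carrier M"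
  shows "frag_of (a, m) - frag_of (a', m) - frag_of (a \<ominus>\<^bsub>A\<^esub> a', m) \<in> relations"
proof -
  have "(a \<ominus>\<^bsub>A\<^esub> a') \<oplus>\<^bsub>A\<^esub> a' = a"
    using assms by (simp add: A.M.minus_eq A.M.a_assoc A.M.l_neg)
  then have "frag_of (a, m) - frag_of (a \<ominus>\<^bsub>A\<^esub> a', m) - frag_of (a', m) \<in> relations"
    using relator_left[of "a \<ominus>\<^bsub>A\<^esub> a'" a' m] assms by simp
  then show ?thesis by (simp add: algebra_simps)
qed

lemma relator_finsum_right:
  assumes "finite F" "g \<in> F \<rightarrow> carrier M" "a \<in> carrier A"
  shows "frag_of (a, finsum M g F) - (\<Sum>s\<in>F. frag_of (a, g s)) \<in> relations"
  using assms(1,2)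
proof (induction F rule: finite_induct)
  case empty
  then show ?case using relator_zero_right[OF assms(3)] by simp
next
  case (insert s F)
  have g: "g \<in> F \<rightarrow> carrier M" "g s \<in> carrier M" using insert.prems by auto
  have "(frag_of (a, finsum M g (insert s F)) - frag_of (a, g s) - frag_of (a, finsum M g F))
      + (frag_of (a, finsum M g F) - (\<Sum>s\<in>F. frag_of (a, g s))) \<in> relations"
    using relator_right[OF assms(3) g(2) M.M.finsum_closed[OF g(1)]] insert.IH[OF g(1)]
      M.M.finsum_insert[OF insert.hyps g]
    by (intro relations_add) simp_all
  then show ?case using insert.hyps by (simp add: algebra_simps)
qed

context
  fixes \<eta> assumes \<eta>: "left_functional R M \<eta>"
begin

lemma contraction_props:
  "contraction A M \<eta> \<in> hom free_pairs (add_monoid A)"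
  "\<lbrakk>a \<in> carrier A; m \<in> carrier M\<rbrakk> \<Longrightarrow> contraction A M \<eta> (frag_of (a, m)) = \<eta> m \<odot>\<^bsub>A\<^esub> a"
proof -
  have cl: "\<eta> m \<in> carrier R" if "m \<in> carrier M" for m using \<eta> that unfolding left_functional_def by blast
  have "(\<lambda>(a, m). \<eta> m \<odot>\<^bsub>A\<^esub> a) ` (carrier A \<times> carrier M) \<subseteq> carrier (add_monoid A)"
    using cl A.smult_closed by auto
  then obtain h where h: "h \<in> hom free_pairs (add_monoid A)"
    "\<And>x. x \<in> carrier A \<times> carrier M \<Longrightarrow> h (frag_of x) = (\<lambda>(a, m). \<eta> m \<odot>\<^bsub>A\<^esub> a) x"
    by (rule comm_group.free_Abelian_group_universal[OF A.M.a_comm_group]) blast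
  have "contraction A M \<eta> \<in> hom free_pairs (add_monoid A) \<and>
      (\<forall>a\<in>carrier A. \<forall>m\<in>carrier M. contraction A M \<eta> (frag_of (a, m)) = \<eta> m \<odot>\<^bsub>A\<^esub> a)"
    unfolding contraction_def by (rule someI[of _ h]) (use h in simp)
  then show "contraction A M \<eta> \<in> hom free_pairs (add_monoid A)"
    "\<lbrakk>a \<in> carrier A; m \<in> carrier M\<rbrakk> \<Longrightarrow> contraction A M \<eta> (frag_of (a, m)) = \<eta> m \<odot>\<^bsub>A\<^esub> a"
    by simp_all
qed

lemma contraction_closed: "x \<in> carrier free_pairs \<Longrightarrow> contraction A M \<eta> x \<in> carrier A"
  using hom_in_carrier[OF contraction_props(1)] by simp

lemma contraction_add:
  "\<lbrakk>x \<in> carrier free_pairs; y \<in> carrier free_pairs\<rbrakk> \<Longrightarrow>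
    contraction A M \<eta> (x + y) = contraction A M \<eta> x \<oplus>\<^bsub>A\<^esub> contraction A M \<eta> y"
  using hom_mult[OF contraction_props(1), of x y] by simp

lemma contraction_zero: "contraction A M \<eta> 0 = \<zero>\<^bsub>A\<^esub>"
  using hom_one[OF contraction_props(1)] A.M.a_group by simp

lemma contraction_diff:
  assumes "x \<in> carrier free_pairs" "y \<in> carrier free_pairs"
  shows "contraction A M \<eta> (x - y) = contraction A M \<eta> x \<ominus>\<^bsub>A\<^esub> contraction A M \<eta> y"
proof -
  have "contraction A M \<eta> x = contraction A M \<eta> (x - y) \<oplus>\<^bsub>A\<^esub> contraction A M \<eta> y"
    using contraction_add[OF diff_closed[OF assms] assms(2)] by simp
  then show ?thesis
    using contraction_closed[OF diff_closed[OF assms]] contraction_closed[OF assms(2)]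
    by (simp add: A.M.minus_eq A.M.a_assoc A.M.r_neg)
qed

lemma contraction_relations: "x \<in> relations \<Longrightarrow> contraction A M \<eta> x = \<zero>\<^bsub>A\<^esub>"
proof -
  let ?h = "contraction A M \<eta>"
  interpret h: group_hom free_pairs "add_monoid A" ?h
    by (intro group_hom.intro group_hom_axioms.intro group_free_Abelian_group A.M.a_group contraction_props(1))
  have cl: "\<eta> m \<in> carrier R" if "m \<in> carrier M" for m using \<eta> that unfolding left_functional_def by blast
  have fc: "frag_of (a, m) \<in> carrier free_pairs" if "a \<in> carrier A" "m \<in> carrier M" for a m
    using that by simp
  have "tensor_relators R A M \<subseteq> kernel free_pairs (add_monoid A) ?h"
  proof
    fix x assume x: "x \<in> tensor_relators R A M"
    have xc: "x \<in> carrier free_pairs"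
      using x tensor_relators_closed[OF A.right_module_axioms M.left_module_axioms] by blast
    have "?h x = \<zero>\<^bsub>A\<^esub>"
      using x unfolding tensor_relators_def
    proof (elim UnE CollectE exE conjE)
      fix a a' m assume *: "x = frag_of (a \<oplus>\<^bsub>A\<^esub> a', m) - frag_of (a, m) - frag_of (a', m)"
        "a \<in> carrier A" "a' \<in> carrier A" "m \<in> carrier M"
      note c = A.smult_closed[OF cl[OF *(4)] *(2)] A.smult_closed[OF cl[OF *(4)] *(3)]
      have "?h x = (\<eta> m \<odot>\<^bsub>A\<^esub> (a \<oplus>\<^bsub>A\<^esub> a') \<ominus>\<^bsub>A\<^esub> \<eta> m \<odot>\<^bsub>A\<^esub> a) \<ominus>\<^bsub>A\<^esub> \<eta> m \<odot>\<^bsub>A\<^esub> a'"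
        unfolding *(1) using *(2-) by (simp only: contraction_diff diff_closed fc A.M.a_closed contraction_props(2))
      also have "\<dots> = \<zero>\<^bsub>A\<^esub>"
        using c cl[OF *(4)] *(2,3)
        by (simp add: A.smult_r_distr A.M.minus_eq A.M.a_ac A.M.r_neg A.M.r_neg1 A.M.r_neg2)
      finally show "?h x = \<zero>\<^bsub>A\<^esub>" .
    next
      fix a m m' assume *: "x = frag_of (a, m \<oplus>\<^bsub>M\<^esub> m') - frag_of (a, m) - frag_of (a, m')"
        "a \<in> carrier A" "m \<in> carrier M" "m' \<in> carrier M"
      note c = A.smult_closed[OF cl[OF *(3)] *(2)] A.smult_closed[OF cl[OF *(4)] *(2)]
      have e: "\<eta> (m \<oplus>\<^bsub>M\<^esub> m') = \<eta> m \<oplus>\<^bsub>R\<^esub> \<eta> m'" using \<eta> *(3,4) unfolding left_functional_def by blast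
      have "?h x = (\<eta> (m \<oplus>\<^bsub>M\<^esub> m') \<odot>\<^bsub>A\<^esub> a \<ominus>\<^bsub>A\<^esub> \<eta> m \<odot>\<^bsub>A\<^esub> a) \<ominus>\<^bsub>A\<^esub> \<eta> m' \<odot>\<^bsub>A\<^esub> a"
        unfolding *(1) using *(2-) by (simp only: contraction_diff diff_closed fc M.M.a_closed contraction_props(2))
      also have "\<dots> = \<zero>\<^bsub>A\<^esub>"
        using c cl[OF *(3)] cl[OF *(4)] *(2)
        by (simp add: e A.smult_l_distr A.M.minus_eq A.M.a_ac A.M.r_neg A.M.r_neg1 A.M.r_neg2)
      finally show "?h x = \<zero>\<^bsub>A\<^esub>" .
    next
      fix r a m assume *: "x = frag_of (r \<odot>\<^bsub>A\<^esub> a, m) - frag_of (a, r \<odot>\<^bsub>M\<^esub> m)"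
        "r \<in> carrier R" "a \<in> carrier A" "m \<in> carrier M"
      have e: "\<eta> (r \<odot>\<^bsub>M\<^esub> m) = r \<otimes>\<^bsub>R\<^esub> \<eta> m" using \<eta> *(2,4) unfolding left_functional_def by blast
      have "?h x = \<eta> m \<odot>\<^bsub>A\<^esub> (r \<odot>\<^bsub>A\<^esub> a) \<ominus>\<^bsub>A\<^esub> (r \<otimes>\<^bsub>R\<^esub> \<eta> m) \<odot>\<^bsub>A\<^esub> a"
        unfolding *(1) using *(2-) 
        by (simp only: contraction_diff diff_closed fc M.smult_closed A.smult_closed contraction_props(2) e)
      also have "\<dots> = \<zero>\<^bsub>A\<^esub>"
        using cl[OF *(4)] *(2,3) by (simp add: A.smult_assoc A.smult_closed A.M.minus_eq A.M.r_neg)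
      finally show "?h x = \<zero>\<^bsub>A\<^esub>" .
    qed
    then show "x \<in> kernel free_pairs (add_monoid A) ?h" using xc by (simp add: kernel_def)
  qed
  then have "relations \<subseteq> kernel free_pairs (add_monoid A) ?h"
    unfolding tensor_kernel_def
    by (rule group.generate_subgroup_incl[OF group_free_Abelian_group _ h.subgroup_kernel])
  then show "x \<in> relations \<Longrightarrow> ?h x = \<zero>\<^bsub>A\<^esub>" by (auto simp: kernel_def)
qed

lemma contraction_sum:
  assumes "finite F" "a \<in> F \<rightarrow> carrier A" "m \<in> F \<rightarrow> carrier M"
  shows "(\<Sum>s\<in>F. frag_of (a s, m s)) \<in> carrier free_pairs \<and>
    contraction A M \<eta> (\<Sum>s\<in>F. frag_of (a s, m s)) = finsum A (\<lambda>s. \<eta> (m s) \<odot>\<^bsub>A\<^esub> a s) F"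
  using assms
proof (induction F rule: finite_induct)
  case empty
  then show ?case by (simp add: contraction_zero)
next
  case (insert s F)
  have cl: "\<eta> x \<in> carrier R" if "x \<in> carrier M" for x using \<eta> that unfolding left_functional_def by blast
  have am: "a s \<in> carrier A" "m s \<in> carrier M" using insert.prems by auto
  have amF: "a \<in> F \<rightarrow> carrier A" "m \<in> F \<rightarrow> carrier M" using insert.prems by auto
  have t: "(\<lambda>s. \<eta> (m s) \<odot>\<^bsub>A\<^esub> a s) \<in> F \<rightarrow> carrier A"
    using amF cl A.smult_closed by (intro funcsetI) blast
  have f: "frag_of (a s, m s) \<in> carrier free_pairs" using am by simp
  note IH = insert.IH[OF amF]
  have S: "(\<Sum>s\<in>insert s F. frag_of (a s, m s)) = frag_of (a s, m s) + (\<Sum>s\<in>F. frag_of (a s, m s))"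
    using insert.hyps by simp
  show ?case
  proof
    show "(\<Sum>s\<in>insert s F. frag_of (a s, m s)) \<in> carrier free_pairs"
      unfolding S using monoid.m_closed[OF group.is_monoid[OF group_free_Abelian_group] f IH[THEN conjunct1]] by simp
    show "contraction A M \<eta> (\<Sum>s\<in>insert s F. frag_of (a s, m s)) = finsum A (\<lambda>s. \<eta> (m s) \<odot>\<^bsub>A\<^esub> a s) (insert s F)"
      unfolding S contraction_add[OF f IH[THEN conjunct1]] IH[THEN conjunct2] contraction_props(2)[OF am]
      by (rule A.M.finsum_insert[OF insert.hyps t A.smult_closed[OF cl[OF am(2)] am(1)], symmetric])
  qed
qed

end

end

context tensor_pair
begin

text \<open>Moving the coefficients of \<open>m = (\<Sum>s. c s m \<cdot> b s)\<close> across the tensor sign writes \<open>a \<otimes> m\<close> as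
  \<open>(\<Sum>s. a \<cdot> c s m \<otimes> b s)\<close>, and the contraction with \<open>c s\<close> reads off the left factors.\<close>

lemma tensor_expansion:
  assumes bas: "dual_basis R M S b c" and x: "x \<in> carrier free_pairs"
  obtains F where "finite F" "F \<subseteq> S"
    "x - (\<Sum>s\<in>F. frag_of (contraction A M (c s) x, b s)) \<in> relations"
proof -
  have b: "b s \<in> carrier M" and c: "left_functional R M (c s)" if "s \<in> S" for s
    using dual_basisD(1,2)[OF bas that] .
  have "Poly_Mapping.keys x \<subseteq> carrier A \<times> carrier M \<and> (\<exists>F\<^sub>0. finite F\<^sub>0 \<and> F\<^sub>0 \<subseteq> S \<and> (\<forall>F. finite F \<longrightarrow> F\<^sub>0 \<subseteq> F \<longrightarrow> F \<subseteq> S \<longrightarrow>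
       x - (\<Sum>s\<in>F. frag_of (contraction A M (c s) x, b s)) \<in> relations))"
    using x unfolding free_pairs_simps
  proof (induction rule: frag_induction)
    case zero
    have "0 - (\<Sum>s\<in>F. frag_of (contraction A M (c s) 0, b s)) \<in> relations" if "F \<subseteq> S" for F
    proof (intro relations_diff relations_zero relations_sum)
      fix s assume "s \<in> F"
      then have s: "s \<in> S" using that by blast
      show "frag_of (contraction A M (c s) 0, b s) \<in> relations"
        unfolding contraction_zero[OF c[OF s]] by (rule relator_zero_left[OF b[OF s]])
    qed
    then show ?case by (intro conjI exI[of _ "{}"]) simp_all
  next
    case (one am)
    obtain a m where am0: "am = (a, m)" by (cases am)
    then have am: "am = (a, m)" "a \<in> carrier A" "m \<in> carrier M" using one by simp_all
    define F\<^sub>0 where "F\<^sub>0 = {s \<in> S. c s m \<noteq> \<zero>\<^bsub>R\<^esub>}"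
    have F\<^sub>0: "finite F\<^sub>0" "F\<^sub>0 \<subseteq> S"
      and exp: "\<And>F. finite F \<Longrightarrow> F \<subseteq> S \<Longrightarrow> F\<^sub>0 \<subseteq> F \<Longrightarrow> m = finsum M (\<lambda>s. c s m \<odot>\<^bsub>M\<^esub> b s) F"
      using dual_basisD(3,4)[OF bas am(3)] unfolding F\<^sub>0_def by simp_all
    have "frag_of am - (\<Sum>s\<in>F. frag_of (contraction A M (c s) (frag_of am), b s)) \<in> relations"
      if F: "finite F" "F\<^sub>0 \<subseteq> F" "F \<subseteq> S" for F
    proof -
      have cR: "c s m \<in> carrier R" if "s \<in> F" for s
        by (rule left_functional_closed[OF c am(3)]) (use F(3) that in blast)
      have bM: "b s \<in> carrier M" if "s \<in> F" for s using b F(3) that by blast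
      have "(\<Sum>s\<in>F. frag_of (contraction A M (c s) (frag_of am), b s)) = (\<Sum>s\<in>F. frag_of (c s m \<odot>\<^bsub>A\<^esub> a, b s))"
      proof (intro sum.cong refl arg_cong[of _ _ frag_of] arg_cong2[of _ _ _ _ Pair])
        fix s assume "s \<in> F"
        then have "s \<in> S" using F(3) by blast
        then show "contraction A M (c s) (frag_of am) = c s m \<odot>\<^bsub>A\<^esub> a"
          unfolding am(1) by (intro contraction_props(2)[OF c am(2,3)])
      qed
      then have "frag_of am - (\<Sum>s\<in>F. frag_of (contraction A M (c s) (frag_of am), b s))
        = (frag_of (a, finsum M (\<lambda>s. c s m \<odot>\<^bsub>M\<^esub> b s) F) - (\<Sum>s\<in>F. frag_of (a, c s m \<odot>\<^bsub>M\<^esub> b s)))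
          - (\<Sum>s\<in>F. frag_of (c s m \<odot>\<^bsub>A\<^esub> a, b s) - frag_of (a, c s m \<odot>\<^bsub>M\<^esub> b s))"
        using exp[OF F(1,3,2)] by (simp add: am(1) sum_subtractf)
      also have "\<dots> \<in> relations"
      proof (rule relations_diff)
        show "frag_of (a, finsum M (\<lambda>s. c s m \<odot>\<^bsub>M\<^esub> b s) F) - (\<Sum>s\<in>F. frag_of (a, c s m \<odot>\<^bsub>M\<^esub> b s)) \<in> relations"
          by (rule relator_finsum_right[OF F(1) funcsetI am(2)]) (rule M.smult_closed[OF cR bM])
        show "(\<Sum>s\<in>F. frag_of (c s m \<odot>\<^bsub>A\<^esub> a, b s) - frag_of (a, c s m \<odot>\<^bsub>M\<^esub> b s)) \<in> relations"
          by (rule relations_sum) (rule relator_scalar[OF cR am(2) bM])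
      qed
      finally show ?thesis .
    qed
    then show ?case using F\<^sub>0 one by (intro conjI exI[of _ F\<^sub>0] allI impI) simp_all
  next
    case (diff x y)
    obtain X where X: "finite X" "X \<subseteq> S" "\<And>F. finite F \<Longrightarrow> X \<subseteq> F \<Longrightarrow> F \<subseteq> S \<Longrightarrow>
       x - (\<Sum>s\<in>F. frag_of (contraction A M (c s) x, b s)) \<in> relations" using diff(1) by blast
    obtain Y where Y: "finite Y" "Y \<subseteq> S" "\<And>F. finite F \<Longrightarrow> Y \<subseteq> F \<Longrightarrow> F \<subseteq> S \<Longrightarrow>
       y - (\<Sum>s\<in>F. frag_of (contraction A M (c s) y, b s)) \<in> relations" using diff(2) by blast
    have xy: "x \<in> carrier free_pairs" "y \<in> carrier free_pairs" using diff by simp_all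
    have "x - y - (\<Sum>s\<in>F. frag_of (contraction A M (c s) (x - y), b s)) \<in> relations"
      if F: "finite F" "X \<union> Y \<subseteq> F" "F \<subseteq> S" for F
    proof -
      let ?k = "\<lambda>s x. contraction A M (c s) x"
      have "x - y - (\<Sum>s\<in>F. frag_of (?k s (x - y), b s))
        = (x - (\<Sum>s\<in>F. frag_of (?k s x, b s))) - (y - (\<Sum>s\<in>F. frag_of (?k s y, b s)))
          + (\<Sum>s\<in>F. frag_of (?k s x, b s) - frag_of (?k s y, b s) - frag_of (?k s (x - y), b s))"
        by (simp add: sum_subtractf)
      also have "\<dots> \<in> relations"
      proof (rule relations_add[OF relations_diff[OF X(3) Y(3)] relations_sum])
        fix s assume "s \<in> F"
        then have s: "s \<in> S" using F by blast
        show "frag_of (?k s x, b s) - frag_of (?k s y, b s) - frag_of (?k s (x - y), b s) \<in> relations"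
          unfolding contraction_diff[OF c[OF s] xy]
          by (rule relator_diff_left[OF contraction_closed[OF c[OF s] xy(1)] contraction_closed[OF c[OF s] xy(2)] b[OF s]])
      qed (use F in auto)
      finally show ?thesis .
    qed
    then show ?case using X(1,2) Y(1,2) diff_closed[OF xy] unfolding free_pairs_simps
      by (intro conjI exI[of _ "X \<union> Y"] allI impI) simp_all
  qed
  then obtain F where F: "finite F" "F \<subseteq> S" "\<forall>F'. finite F' \<longrightarrow> F \<subseteq> F' \<longrightarrow> F' \<subseteq> S \<longrightarrow>
       x - (\<Sum>s\<in>F'. frag_of (contraction A M (c s) x, b s)) \<in> relations" by (elim conjE exE)
  then show ?thesis by (intro that[of F]) simp_all
qed

end

lemma tensor_frag_closed:
  assumes f: "f \<in> left_module_hom R M N"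
    and x: "x \<in> carrier (free_Abelian_group (carrier A \<times> carrier M))"
  shows "tensor_frag f x \<in> carrier (free_Abelian_group (carrier A \<times> carrier N))"
proof -
  have "(\<Union>y\<in>Poly_Mapping.keys x. Poly_Mapping.keys (case y of (a, b) \<Rightarrow> frag_of (a, f b))) \<subseteq> carrier A \<times> carrier N"
  proof (rule UN_least)
    fix y assume "y \<in> Poly_Mapping.keys x"
    then have "y \<in> carrier A \<times> carrier M" using x by auto
    then show "Poly_Mapping.keys (case y of (a, b) \<Rightarrow> frag_of (a, f b)) \<subseteq> carrier A \<times> carrier N"
      using f by (cases y) (auto simp: left_module_hom_def)
  qed
  then show ?thesis unfolding carrier_free_Abelian_group_iff by (rule order_trans[OF keys_frag_extend])
qed

lemma contraction_tensor_frag: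
  assumes "tensor_pair R A M" "tensor_pair R A N" "f \<in> left_module_hom R M N"
    and \<theta>: "left_functional R N \<theta>"
    and x: "x \<in> carrier (free_Abelian_group (carrier A \<times> carrier M))"
  shows "contraction A N \<theta> (tensor_frag f x) = contraction A M (\<lambda>m. \<theta> (f m)) x"
proof -
  interpret M: tensor_pair R A M by fact
  interpret N: tensor_pair R A N by fact
  note \<eta> = left_functional_comp[OF assms(3) \<theta>]
  have "Poly_Mapping.keys x \<subseteq> carrier A \<times> carrier M \<and>
    contraction A N \<theta> (tensor_frag f x) = contraction A M (\<lambda>m. \<theta> (f m)) x"
    using x unfolding carrier_free_Abelian_group_iff[of _ "carrier A \<times> carrier M"]
  proof (induction rule: frag_induction)
    case zero
    then show ?case by (simp add: M.contraction_zero[OF \<eta>] N.contraction_zero[OF \<theta>])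
  next
    case (one am)
    obtain a m where am0: "am = (a, m)" by (cases am)
    then have am: "am = (a, m)" "a \<in> carrier A" "m \<in> carrier M" using one by simp_all
    have "f m \<in> carrier N" using assms(3) am(3) unfolding left_module_hom_def by blast
    then show ?case using am M.contraction_props(2)[OF \<eta>] N.contraction_props(2)[OF \<theta>] by simp
  next
    case (diff x y)
    have xy: "x \<in> carrier M.free_pairs" "y \<in> carrier M.free_pairs" using diff by simp_all
    have fxy: "tensor_frag f x \<in> carrier N.free_pairs" "tensor_frag f y \<in> carrier N.free_pairs"
      by (intro tensor_frag_closed[OF assms(3)] xy)+
    show ?case
      using M.diff_closed[OF xy] diff
        M.contraction_diff[OF \<eta> xy] N.contraction_diff[OF \<theta> fxy]
      by (simp add: frag_extend_diff)
  qed
  then show ?thesis by blast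
qed

text \<open>The vector \<open>w\<close> stands for the element \<open>(\<Sum>s\<in>F. w s \<otimes> b s)\<close>. The first condition says that \<open>w\<close> lies in the
  image of \<open>A \<otimes> M\<close> in a direct sum of copies of \<open>A\<close>, the second that \<open>Id \<otimes> f\<close> maps it to zero.\<close>

definition coordinates_injective ::
    "('r, 'c) ring_scheme \<Rightarrow> ('r, 'a, 'd) module_scheme \<Rightarrow> ('m \<Rightarrow> 'n) \<Rightarrow>
     's set \<Rightarrow> ('s \<Rightarrow> 'm) \<Rightarrow> ('s \<Rightarrow> 'm \<Rightarrow> 'r) \<Rightarrow> 't set \<Rightarrow> ('t \<Rightarrow> 'n \<Rightarrow> 'r) \<Rightarrow> bool" where
  "coordinates_injective R A f S b c T e \<longleftrightarrow>
     (\<forall>F w. finite F \<longrightarrow> F \<subseteq> S \<longrightarrow> w \<in> F \<rightarrow> carrier A \<longrightarrow>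
        (\<forall>s'\<in>F. finsum A (\<lambda>s. c s' (b s) \<odot>\<^bsub>A\<^esub> w s) F = w s') \<longrightarrow>
        (\<forall>t\<in>T. finsum A (\<lambda>s. e t (f (b s)) \<odot>\<^bsub>A\<^esub> w s) F = \<zero>\<^bsub>A\<^esub>) \<longrightarrow>
        (\<forall>s\<in>F. w s = \<zero>\<^bsub>A\<^esub>))"

text \<open>The coordinates of an element of \<open>A \<otimes> M\<close>, or of its image in \<open>A \<otimes> N\<close>, are its contractions with the
  functionals of the dual basis, and by \<open>tensor_expansion\<close> an element with zero coordinates is zero.\<close>

lemma id_tensor_inj_iff:
  assumes MA: "tensor_pair R A M" and NA: "tensor_pair R A N" and f: "f \<in> left_module_hom R M N"
    and bas: "dual_basis R M S b c" and bas': "dual_basis R N T d e"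
  shows "inj_on (id_tensor R A N f) (carrier (tensor_product R A M)) \<longleftrightarrow>
    coordinates_injective R A f S b c T e"
proof -
  interpret M: tensor_pair R A M by fact
  interpret N: tensor_pair R A N by fact
  let ?id = "id_tensor R A N f"
  note Ar = M.A.right_module_axioms and Mr = M.M.left_module_axioms and Nr = N.M.left_module_axioms
  have b: "b s \<in> carrier M" and c: "left_functional R M (c s)" if "s \<in> S" for s
    using dual_basisD(1,2)[OF bas that] .
  have d: "d t \<in> carrier N" and e: "left_functional R N (e t)" if "t \<in> T" for t
    using dual_basisD(1,2)[OF bas' that] .
  have fe: "left_functional R M (\<lambda>m. e t (f m))" if "t \<in> T" for t
    by (rule left_functional_comp[OF f e[OF that]])
  have coset_zero: "M.relations #>\<^bsub>M.free_pairs\<^esub> x = M.relations \<longleftrightarrow> x \<in> M.relations"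
    if "x \<in> carrier M.free_pairs" for x
    using group.coset_join1[OF group_free_Abelian_group _ that M.relations_subgroup]
      group.coset_join2[OF group_free_Abelian_group that M.relations_subgroup] subgroup.subset[OF M.relations_subgroup] by blast
  have coset_zero': "N.relations #>\<^bsub>N.free_pairs\<^esub> x = N.relations \<longleftrightarrow> x \<in> N.relations"
    if "x \<in> carrier N.free_pairs" for x
    using group.coset_join1[OF group_free_Abelian_group _ that N.relations_subgroup]
      group.coset_join2[OF group_free_Abelian_group that N.relations_subgroup] subgroup.subset[OF N.relations_subgroup] by blast
  note frag_closed = tensor_frag_closed[OF f]
  have normM: "M.relations \<lhd> M.free_pairs" and normN: "N.relations \<lhd> N.free_pairs"
    by (intro comm_group.normal_iff_subgroup[THEN iffD2] abelian_free_Abelian_group M.relations_subgroup N.relations_subgroup)+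
  interpret h: group_hom "tensor_product R A M" "tensor_product R A N" ?id
    by (intro group_hom.intro group_hom_axioms.intro id_tensor_hom Ar Mr Nr f)
       (unfold tensor_product_def, rule normal.factorgroup_is_group[OF normM],
        rule normal.factorgroup_is_group[OF normN])
  have inj_iff: "inj_on ?id (carrier (tensor_product R A M)) \<longleftrightarrow>
    (\<forall>x\<in>carrier M.free_pairs. tensor_frag f x \<in> N.relations \<longrightarrow> x \<in> M.relations)"
  proof -
    have "inj_on ?id (carrier (tensor_product R A M)) \<longleftrightarrow>
      (\<forall>X\<in>carrier (tensor_product R A M). ?id X = N.relations \<longrightarrow> X = M.relations)"
      unfolding h.inj_on_one_iff by (auto simp: tensor_product_def FactGroup_def)
    also have "\<dots> \<longleftrightarrow> (\<forall>x\<in>carrier M.free_pairs. ?id (M.relations #>\<^bsub>M.free_pairs\<^esub> x) = N.relations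
        \<longrightarrow> M.relations #>\<^bsub>M.free_pairs\<^esub> x = M.relations)"
      unfolding tensor_product_def carrier_FactGroup by (rule ball_simps(9))
    also have "\<dots> \<longleftrightarrow> (\<forall>x\<in>carrier M.free_pairs. tensor_frag f x \<in> N.relations \<longrightarrow> x \<in> M.relations)"
      unfolding id_tensor_coset[OF Ar Mr Nr f]
      by (intro ball_cong refl) (simp only: coset_zero coset_zero' frag_closed)
    finally show ?thesis .
  qed
  show ?thesis
    unfolding inj_iff
  proof
    assume inj: "\<forall>x\<in>carrier M.free_pairs. tensor_frag f x \<in> N.relations \<longrightarrow> x \<in> M.relations"
    show "coordinates_injective R A f S b c T e"
      unfolding coordinates_injective_def
    proof (intro allI impI)
      fix F w
      assume F: "finite F" "F \<subseteq> S" and w: "w \<in> F \<rightarrow> carrier A"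
        and idem: "\<forall>s'\<in>F. finsum A (\<lambda>s. c s' (b s) \<odot>\<^bsub>A\<^esub> w s) F = w s'"
        and zero: "\<forall>t\<in>T. finsum A (\<lambda>s. e t (f (b s)) \<odot>\<^bsub>A\<^esub> w s) F = \<zero>\<^bsub>A\<^esub>"
      define x where "x = (\<Sum>s\<in>F. frag_of (w s, b s))"
      have bF: "b \<in> F \<rightarrow> carrier M" using b F(2) by blast
      note sum_x = M.contraction_sum[OF _ F(1) w bF, folded x_def]
      have x: "x \<in> carrier M.free_pairs"
      proof (cases "F = {}")
        case False
        then obtain s where "s \<in> S" using F(2) by blast
        then show ?thesis using sum_x[OF c] by blast
      qed (simp add: x_def)
      obtain F\<^sub>0 where F\<^sub>0: "finite F\<^sub>0" "F\<^sub>0 \<subseteq> T"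
        "tensor_frag f x - (\<Sum>t\<in>F\<^sub>0. frag_of (contraction A N (e t) (tensor_frag f x), d t)) \<in> N.relations"
        by (rule N.tensor_expansion[OF bas' frag_closed[OF x]])
      have "(\<Sum>t\<in>F\<^sub>0. frag_of (contraction A N (e t) (tensor_frag f x), d t)) \<in> N.relations"
      proof (rule N.relations_sum)
        fix t assume "t \<in> F\<^sub>0"
        then have t: "t \<in> T" using F\<^sub>0(2) by blast
        have "contraction A N (e t) (tensor_frag f x) = \<zero>\<^bsub>A\<^esub>"
          unfolding contraction_tensor_frag[OF MA NA f e[OF t] x] sum_x[OF fe[OF t], THEN conjunct2]
          using zero t by (rule bspec)
        then show "frag_of (contraction A N (e t) (tensor_frag f x), d t) \<in> N.relations"
          using N.relator_zero_left[OF d[OF t]] by (simp only:)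
      qed
      from N.relations_add[OF F\<^sub>0(3) this] have "tensor_frag f x \<in> N.relations" by (simp only: diff_add_cancel)
      then have xr: "x \<in> M.relations" using inj x by blast
      show "\<forall>s\<in>F. w s = \<zero>\<^bsub>A\<^esub>"
      proof
        fix s assume s: "s \<in> F"
        then have cs: "left_functional R M (c s)" using c F(2) by blast
        have "w s = finsum A (\<lambda>s'. c s (b s') \<odot>\<^bsub>A\<^esub> w s') F" by (rule idem[rule_format, OF s, symmetric])
        also have "\<dots> = contraction A M (c s) x" by (rule sum_x[OF cs, THEN conjunct2, symmetric])
        also have "\<dots> = \<zero>\<^bsub>A\<^esub>" by (rule M.contraction_relations[OF cs xr])
        finally show "w s = \<zero>\<^bsub>A\<^esub>" .
      qed
    qed
  next
    assume ci: "coordinates_injective R A f S b c T e"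
    show "\<forall>x\<in>carrier M.free_pairs. tensor_frag f x \<in> N.relations \<longrightarrow> x \<in> M.relations"
    proof (intro ballI impI)
      fix x assume x: "x \<in> carrier M.free_pairs" and fx: "tensor_frag f x \<in> N.relations"
      define w where "w s = contraction A M (c s) x" for s
      obtain F where F: "finite F" "F \<subseteq> S" and exp: "x - (\<Sum>s\<in>F. frag_of (w s, b s)) \<in> M.relations"
        unfolding w_def by (rule M.tensor_expansion[OF bas x])
      have w: "w \<in> F \<rightarrow> carrier A"
      proof (rule funcsetI)
        fix s assume "s \<in> F"
        then have "s \<in> S" using F(2) by blast
        then show "w s \<in> carrier A" unfolding w_def by (intro M.contraction_closed[OF c x])
      qed
      have bF: "b \<in> F \<rightarrow> carrier M" using b F(2) by blast
      have contr: "contraction A M \<eta> x = finsum A (\<lambda>s. \<eta> (b s) \<odot>\<^bsub>A\<^esub> w s) F" if \<eta>: "left_functional R M \<eta>" for \<eta>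
      proof -
        let ?y = "\<Sum>s\<in>F. frag_of (w s, b s)"
        note y = M.contraction_sum[OF \<eta> F(1) w bF]
        have "contraction A M \<eta> x = contraction A M \<eta> (x - ?y) \<oplus>\<^bsub>A\<^esub> contraction A M \<eta> ?y"
          using M.contraction_add[OF \<eta> M.relations_closed[OF exp] y[THEN conjunct1]]
          by (simp only: diff_add_cancel)
        also have "\<dots> = contraction A M \<eta> ?y"
          unfolding M.contraction_relations[OF \<eta> exp]
          by (rule M.A.M.l_zero[OF M.contraction_closed[OF \<eta> y[THEN conjunct1]]])
        also note y[THEN conjunct2]
        finally show ?thesis .
      qed
      have "\<forall>s'\<in>F. finsum A (\<lambda>s. c s' (b s) \<odot>\<^bsub>A\<^esub> w s) F = w s'"
      proof
        fix s' assume "s' \<in> F"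
        then have "s' \<in> S" using F(2) by blast
        from contr[OF c[OF this]] show "finsum A (\<lambda>s. c s' (b s) \<odot>\<^bsub>A\<^esub> w s) F = w s'"
          unfolding w_def by (rule sym)
      qed
      moreover have "\<forall>t\<in>T. finsum A (\<lambda>s. e t (f (b s)) \<odot>\<^bsub>A\<^esub> w s) F = \<zero>\<^bsub>A\<^esub>"
      proof
        fix t assume t: "t \<in> T"
        show "finsum A (\<lambda>s. e t (f (b s)) \<odot>\<^bsub>A\<^esub> w s) F = \<zero>\<^bsub>A\<^esub>"
          unfolding contr[OF fe[OF t], symmetric] contraction_tensor_frag[OF MA NA f e[OF t] x, symmetric]
          by (rule N.contraction_relations[OF e[OF t] fx])
      qed
      ultimately have w0: "\<forall>s\<in>F. w s = \<zero>\<^bsub>A\<^esub>" using ci F w unfolding coordinates_injective_def by blast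
      have "(\<Sum>s\<in>F. frag_of (w s, b s)) \<in> M.relations"
      proof (rule M.relations_sum)
        fix s assume s: "s \<in> F"
        then have "b s \<in> carrier M" using bF by blast
        then show "frag_of (w s, b s) \<in> M.relations"
          unfolding w0[rule_format, OF s] by (rule M.relator_zero_left)
      qed
      from M.relations_add[OF exp this] show "x \<in> M.relations" by (simp only: diff_add_cancel)
    qed
  qed
qed

lemma coordinates_injectiveD:
  assumes "coordinates_injective R A f S b c T e" "finite F" "F \<subseteq> S" "w \<in> F \<rightarrow> carrier A"
    and "\<And>s'. s' \<in> F \<Longrightarrow> finsum A (\<lambda>s. c s' (b s) \<odot>\<^bsub>A\<^esub> w s) F = w s'"
    and "\<And>t. t \<in> T \<Longrightarrow> finsum A (\<lambda>s. e t (f (b s)) \<odot>\<^bsub>A\<^esub> w s) F = \<zero>\<^bsub>A\<^esub>"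
  shows "\<forall>s\<in>F. w s = \<zero>\<^bsub>A\<^esub>"
  using assms(1)[unfolded coordinates_injective_def, rule_format, OF assms(2,3,4)] assms(5,6) by simp

section \<open>The two coefficient modules in coordinates\<close>

text \<open>A coordinate with respect to a basis of the field over its prime field \<open>\<rat>\<close>.\<close>

lemma rational_functional_separates:
  fixes q :: "'q::field_char_0"
  assumes "q \<noteq> 0"
  shows "\<exists>l :: 'q \<Rightarrow> rat. (\<forall>x y. l (x + y) = l x + l y) \<and> l q \<noteq> 0"
proof -
  interpret V: vector_space "\<lambda>(r::rat) (x::'q). of_rat r * x"
    by unfold_locales (simp_all add: of_rat_add of_rat_mult algebra_simps)
  define B where "B = V.extend_basis {}"
  have B: "V.independent B" "V.span B = UNIV"
    unfolding B_def by (simp_all add: V.independent_extend_basis V.span_extend_basis V.independent_empty)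
  have "\<exists>b. V.representation B q b \<noteq> 0"
  proof (rule ccontr)
    assume "\<not> ?thesis"
    then have "(\<Sum>b | V.representation B q b \<noteq> 0. of_rat (V.representation B q b) * b) = 0" by simp
    then show False using V.sum_nonzero_representation_eq[OF B(1), of q] B(2) assms by simp
  qed
  then obtain b where b: "V.representation B q b \<noteq> 0" by blast
  show ?thesis
  proof (intro exI[of _ "\<lambda>x. V.representation B x b"] conjI allI)
    show "V.representation B (x + y) b = V.representation B x b + V.representation B y b" for x y
      using V.representation_add[OF B(1), of y x] B(2) by simp
    show "V.representation B q b \<noteq> 0" by (rule b)
  qed
qed

lemma additive_of_int_mult:
  fixes l :: "'q::ring_1 \<Rightarrow> 'r::ring_1"
  assumes "\<And>x y. l (x + y) = l x + l y"
  shows "l (of_int a * x) = of_int a * l x"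
proof -
  interpret additive l by unfold_locales (rule assms)
  show ?thesis
    by (induction a rule: int_induct[of _ 0]) (simp_all add: algebra_simps add diff zero)
qed

lemma (in abelian_monoid) additive_finsum:
  fixes \<Lambda> :: "'a \<Rightarrow> 'z::ab_group_add"
  assumes "\<And>x y. x \<in> carrier G \<Longrightarrow> y \<in> carrier G \<Longrightarrow> \<Lambda> (x \<oplus> y) = \<Lambda> x + \<Lambda> y"
    and "finite F" "g \<in> F \<rightarrow> carrier G"
  shows "\<Lambda> (finsum G g F) = (\<Sum>s\<in>F. \<Lambda> (g s))"
  using assms(2,3)
proof (induction F rule: finite_induct)
  case empty
  have "\<Lambda> \<zero> + \<Lambda> \<zero> = \<Lambda> \<zero>" using assms(1)[OF zero_closed zero_closed] by simp
  then show ?case by simp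
next
  case (insert s F)
  have g: "g \<in> F \<rightarrow> carrier G" "g s \<in> carrier G" using insert.prems by auto
  show ?case
    unfolding finsum_insert[OF insert.hyps g] assms(1)[OF g(2) finsum_closed[OF g(1)]] insert.IH[OF g(1)]
    using insert.hyps by simp
qed

lemma finsum_Zp:
  fixes r :: "'s \<Rightarrow> 'g \<Rightarrow>\<^sub>0 int"
  assumes "group G" "prime p" "finite F" "\<And>s. s \<in> F \<Longrightarrow> Poly_Mapping.keys (r s) \<subseteq> carrier G"
  shows "finsum (Zp_right_module p :: ('g \<Rightarrow>\<^sub>0 int, int) module) (\<lambda>s. r s \<odot>\<^bsub>Zp_right_module p\<^esub> (c s mod int p)) F
    = (\<Sum>s\<in>F. augmentation (r s) * c s) mod int p"
proof -
  let ?A = "Zp_right_module p :: ('g \<Rightarrow>\<^sub>0 int, int) module"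
  interpret A: right_module "group_ring G" ?A by (rule Zp_right_module[OF assms(1,2)])
  have p: "int p > 0" using assms(2) prime_gt_0_nat by simp
  have sm: "x \<odot>\<^bsub>?A\<^esub> (a mod int p) = (augmentation x * a) mod int p" for x a
    by (simp add: Zp_right_module_def residue_ring_def mod_simps mult.commute)
  have cl: "a mod int p \<in> carrier ?A" for a
    using p pos_mod_bound[OF p, of a] by (simp add: Zp_right_module_def residue_ring_def)
  show ?thesis using assms(3)
  proof (induction F rule: finite_induct)
    case empty
    have "\<zero>\<^bsub>?A\<^esub> = 0" by (simp add: Zp_right_module_def residue_ring_def)
    then show ?case by (simp only: A.M.finsum_empty sum.empty mod_0)
  next
    case (insert s F)
    have "finsum ?A (\<lambda>s. r s \<odot>\<^bsub>?A\<^esub> (c s mod int p)) (insert s F)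
      = (augmentation (r s) * c s) mod int p \<oplus>\<^bsub>?A\<^esub> finsum ?A (\<lambda>s. r s \<odot>\<^bsub>?A\<^esub> (c s mod int p)) F"
      using A.M.finsum_insert[OF insert.hyps, of "\<lambda>s. r s \<odot>\<^bsub>?A\<^esub> (c s mod int p)"] cl
      by (simp add: sm)
    also have "\<dots> = (\<Sum>s\<in>insert s F. augmentation (r s) * c s) mod int p"
      unfolding insert.IH using insert.hyps
      by (simp add: Zp_right_module_def residue_ring_def mod_simps)
    finally show ?case .
  qed
qed

lemma GL_group: "group (GL k :: 'q::field mat monoid)"
  unfolding GL_def by (intro monoid.units_group) (use ring_mat[of k "()"] in \<open>auto simp: ring_def\<close>)

lemma GL_one: "\<one>\<^bsub>GL k\<^esub> = 1\<^sub>m k"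
  by (simp add: GL_def units_of_def ring_mat_def)

text \<open>Equivariance of the passage from \<open>Q[H]\<^sup>k\<close> to functions on the group.\<close>

lemma twisted_lookup_fun_act:
  fixes \<alpha> :: "'g \<Rightarrow> 'q::field mat" and l :: "'q \<Rightarrow> rat" and h
  assumes G: "group G" and H: "group H" and \<phi>: "\<phi> \<in> hom G H" and \<alpha>: "\<alpha> \<in> hom G (GL k)"
    and l: "\<And>x y. l (x + y) = l x + l y" and j: "j < k"
    and e: "Poly_Mapping.keys e \<subseteq> carrier G" and x: "x \<in> carrier G"
    and w: "w \<in> carrier (twisted_right_module H k \<alpha> \<phi>)"
  defines "A \<equiv> twisted_right_module H k \<alpha> \<phi>"
  defines "\<Lambda> \<equiv> \<lambda>y. l (Poly_Mapping.lookup (y $ j) h)"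
  shows "fun_act G e (\<lambda>x. \<Lambda> (Poly_Mapping.single x 1 \<odot>\<^bsub>A\<^esub> w)) x
    = \<Lambda> (Poly_Mapping.single x 1 \<odot>\<^bsub>A\<^esub> (e \<odot>\<^bsub>A\<^esub> w))"
proof -
  interpret G: group G by fact
  interpret A: right_module "group_ring G" A
    unfolding A_def by (rule twisted_right_module[OF G H \<phi> \<alpha>])
  have R: "Poly_Mapping.single g a \<in> carrier (group_ring G)" if "g \<in> carrier G" for g a
    using that by (simp add: group_ring_def)
  have w': "w \<in> carrier A" using w by (simp add: A_def)
  have \<Lambda>_add: "\<Lambda> (y \<oplus>\<^bsub>A\<^esub> z) = \<Lambda> y + \<Lambda> z" if "y \<in> carrier A" "z \<in> carrier A" for y z
    using that j by (auto simp: \<Lambda>_def A_def twisted_right_module_def Poly_Mapping.lookup_add l)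
  define \<Lambda>' where "\<Lambda>' y = \<Lambda> (Poly_Mapping.single x 1 \<odot>\<^bsub>A\<^esub> y)" for y
  have \<Lambda>'_add: "\<Lambda>' (y \<oplus>\<^bsub>A\<^esub> z) = \<Lambda>' y + \<Lambda>' z" if yz: "y \<in> carrier A" "z \<in> carrier A" for y z
    unfolding \<Lambda>'_def A.smult_r_distr[OF R[OF x] yz]
    by (rule \<Lambda>_add[OF A.smult_closed[OF R[OF x] yz(1)] A.smult_closed[OF R[OF x] yz(2)]])
  have "Poly_Mapping.keys e \<subseteq> carrier G \<and>
      fun_act G e (\<lambda>x. \<Lambda> (Poly_Mapping.single x 1 \<odot>\<^bsub>A\<^esub> w)) x = \<Lambda>' (e \<odot>\<^bsub>A\<^esub> w)"
    using e
  proof (induction e rule: pm_induct)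
    case 1
    have "(0::'g \<Rightarrow>\<^sub>0 int) \<odot>\<^bsub>A\<^esub> w = \<zero>\<^bsub>A\<^esub>"
      unfolding A_def twisted_right_module_def by (simp add: zero_vec_def)
    moreover have "\<Lambda>' \<zero>\<^bsub>A\<^esub> = 0"
      using \<Lambda>'_add[OF A.M.zero_closed A.M.zero_closed] A.M.l_zero[OF A.M.zero_closed] by simp
    ultimately show ?case by simp
  next
    case (2 g a)
    have "Poly_Mapping.single x 1 \<odot>\<^bsub>A\<^esub> (Poly_Mapping.single g a \<odot>\<^bsub>A\<^esub> w)
      = Poly_Mapping.single (g \<otimes>\<^bsub>G\<^esub> x) a \<odot>\<^bsub>A\<^esub> w"
      using A.smult_assoc[OF R[OF 2] R[OF x] w', of a 1] by (simp add: group_ring_def)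
    moreover have "\<Lambda> (Poly_Mapping.single y a \<odot>\<^bsub>A\<^esub> w) = of_int a * \<Lambda> (Poly_Mapping.single y 1 \<odot>\<^bsub>A\<^esub> w)" for y
      unfolding \<Lambda>_def A_def twisted_right_module_def
      using j l[of 0 0] additive_of_int_mult[OF l] by (simp add: scal_simps)
    ultimately show ?case using 2 by (simp add: fun_act_single \<Lambda>'_def)
  next
    case (3 e e')
    have ee: "e \<in> carrier (group_ring G)" "e' \<in> carrier (group_ring G)"
      using 3 by (simp_all add: group_ring_def)
    have "(e + e') \<odot>\<^bsub>A\<^esub> w = e \<odot>\<^bsub>A\<^esub> w \<oplus>\<^bsub>A\<^esub> e' \<odot>\<^bsub>A\<^esub> w"
      using A.smult_l_distr[OF ee w'] by (simp add: group_ring_def)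
    then have "\<Lambda>' ((e + e') \<odot>\<^bsub>A\<^esub> w) = \<Lambda>' (e \<odot>\<^bsub>A\<^esub> w) + \<Lambda>' (e' \<odot>\<^bsub>A\<^esub> w)"
      using \<Lambda>'_add[OF A.smult_closed[OF ee(1) w'] A.smult_closed[OF ee(2) w']] by simp
    moreover have "Poly_Mapping.keys (e + e') \<subseteq> carrier G"
      using 3 Poly_Mapping.keys_add[of e e'] by blast
    ultimately show ?case using 3 by (simp add: fun_act_add)
  qed
  then show ?thesis unfolding \<Lambda>'_def by blast
qed

text \<open>On \<open>U\<close> both \<open>\<phi>\<close> and \<open>\<alpha>\<close> are trivial, whence the invariance. The coefficient of \<open>h\<close> in \<open>w \<cdot> x\<close> can
  only be nonzero if \<open>h = q \<phi>(x)\<close> with \<open>q\<close> in the support of \<open>w\<close>, which leaves finitely many values of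
  \<open>\<phi>(x)\<close>.\<close>

lemma twisted_lookup_coset_function:
  fixes \<alpha> :: "'g \<Rightarrow> 'q::field mat" and l :: "'q \<Rightarrow> rat"
  assumes G: "group G" and H: "group H" and \<phi>: "\<phi> \<in> epi G H" and \<alpha>: "\<alpha> \<in> hom G (GL k)"
    and U: "U \<subseteq> kernel G H \<phi>" "\<And>u. u \<in> U \<Longrightarrow> \<alpha> u = 1\<^sub>m k"
    and l: "\<And>x y. l (x + y) = l x + l y" and j: "j < k" and h: "h \<in> carrier H"
    and w: "w \<in> carrier (twisted_right_module H k \<alpha> \<phi>)"
  defines "A \<equiv> twisted_right_module H k \<alpha> \<phi>"
  shows "coset_function G U (kernel G H \<phi>) 0
    (\<lambda>x. l (Poly_Mapping.lookup ((Poly_Mapping.single x 1 \<odot>\<^bsub>A\<^esub> w) $ j) h))"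
proof -
  have hom: "\<phi> \<in> hom G H" and im: "\<phi> ` carrier G = carrier H" using \<phi> by (simp_all add: epi_def)
  interpret G: group G by fact
  interpret H: group H by fact
  interpret \<phi>: group_hom G H \<phi> by unfold_locales (rule hom)
  interpret A: right_module "group_ring G" A
    unfolding A_def by (rule twisted_right_module[OF G H hom \<alpha>])
  have R: "Poly_Mapping.single g a \<in> carrier (group_ring G)" if "g \<in> carrier G" for g a
    using that by (simp add: group_ring_def)
  have w': "w \<in> carrier A" using w by (simp add: A_def)
  have act: "(Poly_Mapping.single x 1 \<odot>\<^bsub>A\<^esub> y) $ j
      = (\<Sum>i<k. group_ring_mult H (y $ i) (Poly_Mapping.single (\<phi> x) (\<alpha> x $$ (i, j))))" if "j < k" for x y j
    using that by (simp add: A_def twisted_right_module_def twisted_act_def scal_simps)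
  have per: "Poly_Mapping.single (x \<otimes>\<^bsub>G\<^esub> u) 1 \<odot>\<^bsub>A\<^esub> w = Poly_Mapping.single x 1 \<odot>\<^bsub>A\<^esub> w"
    if x: "x \<in> carrier G" and u: "u \<in> U" for x u
  proof -
    have uG: "u \<in> carrier G" and \<phi>u: "\<phi> u = \<one>\<^bsub>H\<^esub>" using u U(1) by (auto simp: kernel_def)
    define y where "y = Poly_Mapping.single x 1 \<odot>\<^bsub>A\<^esub> w"
    have y: "y \<in> carrier A" unfolding y_def by (rule A.smult_closed[OF R[OF x] w'])
    then have yd: "y \<in> carrier_vec k" and yH: "\<And>i. i < k \<Longrightarrow> Poly_Mapping.keys (y $ i) \<subseteq> carrier H"
      by (simp_all add: A_def twisted_right_module_def group_ring_def)
    have "Poly_Mapping.single (x \<otimes>\<^bsub>G\<^esub> u) 1 \<odot>\<^bsub>A\<^esub> w = Poly_Mapping.single u 1 \<odot>\<^bsub>A\<^esub> y"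
      using A.smult_assoc[OF R[OF x] R[OF uG] w', of 1 1] by (simp add: group_ring_def y_def)
    also have "\<dots> = y"
    proof (rule eq_vecI)
      show "dim_vec (Poly_Mapping.single u 1 \<odot>\<^bsub>A\<^esub> y) = dim_vec y"
        using yd by (simp add: A_def twisted_right_module_def)
      fix i assume "i < dim_vec y"
      then have i: "i < k" using yd by simp
      have "(Poly_Mapping.single u 1 \<odot>\<^bsub>A\<^esub> y) $ i = (\<Sum>i'<k. if i' = i then y $ i else 0)"
        unfolding act[OF i] \<phi>u U(2)[OF u]
        by (intro sum.cong refl) (use i yH in \<open>auto simp: gm_one(2)[OF H]\<close>)
      then show "(Poly_Mapping.single u 1 \<odot>\<^bsub>A\<^esub> y) $ i = y $ i" using i by simp
    qed
    finally show ?thesis unfolding y_def .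
  qed
  define Q where "Q = (\<Union>i<k. Poly_Mapping.keys (w $ i))"
  have Q: "finite Q" "Q \<subseteq> carrier H"
    using w by (auto simp: Q_def twisted_right_module_def group_ring_def)
  define rep where "rep b = (SOME g. g \<in> carrier G \<and> \<phi> g = b)" for b
  have rep: "rep b \<in> carrier G \<and> \<phi> (rep b) = b" if b: "b \<in> carrier H" for b
  proof -
    obtain g where "g \<in> carrier G \<and> \<phi> g = b" using b unfolding im[symmetric] by blast
    then show ?thesis unfolding rep_def by (rule someI)
  qed
  have l0: "l 0 = 0" using l[of 0 0] by simp
  have supp: "\<exists>f\<in>(\<lambda>q. rep (inv\<^bsub>H\<^esub> q \<otimes>\<^bsub>H\<^esub> h)) ` Q. \<exists>y\<in>kernel G H \<phi>. x = f \<otimes>\<^bsub>G\<^esub> y"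
    if x: "x \<in> carrier G" and nz: "l (Poly_Mapping.lookup ((Poly_Mapping.single x 1 \<odot>\<^bsub>A\<^esub> w) $ j) h) \<noteq> 0" for x
  proof -
    have \<phi>x: "\<phi> x \<in> carrier H" by (rule \<phi>.hom_closed[OF x])
    have "Poly_Mapping.lookup ((Poly_Mapping.single x 1 \<odot>\<^bsub>A\<^esub> w) $ j) h \<noteq> 0" using nz l0 by auto
    then have "(\<Sum>i<k. Poly_Mapping.lookup (group_ring_mult H (w $ i) (Poly_Mapping.single (\<phi> x) (\<alpha> x $$ (i, j)))) h) \<noteq> 0"
      unfolding act[OF j] by (simp add: Poly_Mapping.lookup_sum)
    then obtain i where i: "i < k"
      and "Poly_Mapping.lookup (group_ring_mult H (w $ i) (Poly_Mapping.single (\<phi> x) (\<alpha> x $$ (i, j)))) h \<noteq> 0"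
      by (meson lessThan_iff sum.not_neutral_contains_not_neutral)
    then have "h \<in> Poly_Mapping.keys (group_ring_mult H (w $ i) (Poly_Mapping.single (\<phi> x) (\<alpha> x $$ (i, j))))"
      by (simp add: in_keys_iff)
    also have "\<dots> \<subseteq> (\<Union>q\<in>Poly_Mapping.keys (w $ i). {q \<otimes>\<^bsub>H\<^esub> \<phi> x})"
      unfolding group_ring_mult_def
      by (rule order_trans[OF Poly_Mapping.keys_sum], rule UN_mono[OF subset_refl],
          rule order_trans[OF Poly_Mapping.keys_sum]) (simp add: UN_subset_iff)
    finally obtain q where q: "q \<in> Poly_Mapping.keys (w $ i)" "h = q \<otimes>\<^bsub>H\<^esub> \<phi> x" by blast
    have qQ: "q \<in> Q" using q(1) i unfolding Q_def by blast
    then have qH: "q \<in> carrier H" using Q(2) by blast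
    have e: "inv\<^bsub>H\<^esub> q \<otimes>\<^bsub>H\<^esub> h = \<phi> x" using qH \<phi>x by (simp add: q(2) H.m_assoc[symmetric])
    have r: "rep (\<phi> x) \<in> carrier G" "\<phi> (rep (\<phi> x)) = \<phi> x" using rep[OF \<phi>x] by blast+
    show ?thesis
    proof (intro bexI)
      show "x = rep (inv\<^bsub>H\<^esub> q \<otimes>\<^bsub>H\<^esub> h) \<otimes>\<^bsub>G\<^esub> (inv\<^bsub>G\<^esub> rep (\<phi> x) \<otimes>\<^bsub>G\<^esub> x)"
        unfolding e using r(1) x by (simp add: G.m_assoc[symmetric])
      show "inv\<^bsub>G\<^esub> rep (\<phi> x) \<otimes>\<^bsub>G\<^esub> x \<in> kernel G H \<phi>" using r x by (simp add: kernel_def)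
    qed (rule imageI[OF qQ])
  qed
  have "(\<lambda>q. rep (inv\<^bsub>H\<^esub> q \<otimes>\<^bsub>H\<^esub> h)) ` Q \<subseteq> carrier G"
  proof (rule image_subsetI)
    fix q assume "q \<in> Q"
    then have "inv\<^bsub>H\<^esub> q \<otimes>\<^bsub>H\<^esub> h \<in> carrier H" using Q(2) h by blast
    from rep[OF this] show "rep (inv\<^bsub>H\<^esub> q \<otimes>\<^bsub>H\<^esub> h) \<in> carrier G" by (rule conjunct1)
  qed
  moreover have "finite ((\<lambda>q. rep (inv\<^bsub>H\<^esub> q \<otimes>\<^bsub>H\<^esub> h)) ` Q)" using Q(1) by (rule finite_imageI)
  ultimately show ?thesis
    unfolding coset_function_def
    by (intro conjI ballI impI exI[of _ "(\<lambda>q. rep (inv\<^bsub>H\<^esub> q \<otimes>\<^bsub>H\<^esub> h)) ` Q"])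
       (simp add: per, assumption+, intro supp, assumption, simp only: dvd_0_left_iff not_False_eq_True)
qed

theorem mainTheorem1:
  fixes \<pi> :: "('g, 'c) monoid_scheme"
    and H :: "('h, 'd) monoid_scheme"
    and P :: "('p, 'e) monoid_scheme"
    and M :: "('g \<Rightarrow>\<^sub>0 int, 'm, 'u) module_scheme"
    and N :: "('g \<Rightarrow>\<^sub>0 int, 'n, 'w) module_scheme"
    and f :: "'m \<Rightarrow> 'n"
    and \<phi> :: "'g \<Rightarrow> 'h"
    and \<alpha> :: "'g \<Rightarrow> 'q::field_char_0 mat"
    and p k :: nat
  assumes "finitely_generated_group \<pi>"
    and "prime p"
    and "projective_left_module (group_ring \<pi>) M"
    and "projective_left_module (group_ring \<pi>) N"
    and "f \<in> left_module_hom (group_ring \<pi>) M N"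
    and "inj_on (id_tensor (group_ring \<pi>) (Zp_right_module p) N f)
           (carrier (tensor_product (group_ring \<pi>) (Zp_right_module p) M))"
    and "torsion_free_abelian_group H"
    and "\<phi> \<in> epi \<pi> H"
    and "\<alpha> \<in> hom \<pi> (GL k)"
    and "p_group p P"
    and "factors_through (\<pi>\<lparr>carrier := kernel \<pi> H \<phi>\<rparr>) P (GL k) \<alpha>"
  shows "inj_on (id_tensor (group_ring \<pi>) (twisted_right_module H k \<alpha> \<phi>) N f)
           (carrier (tensor_product (group_ring \<pi>) (twisted_right_module H k \<alpha> \<phi>) M))"
proof -
  let ?R = "group_ring \<pi> :: ('g \<Rightarrow>\<^sub>0 int) ring" and ?Z = "Zp_right_module p :: ('g \<Rightarrow>\<^sub>0 int, int) module"
  let ?K = "kernel \<pi> H \<phi>"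
  define A where "A = twisted_right_module H k \<alpha> \<phi>"
  have G: "group \<pi>" using assms(1) by (simp add: finitely_generated_group_def)
  interpret G: group \<pi> by (rule G)
  have H: "group H"
    using assms(7) unfolding torsion_free_abelian_group_def comm_group_def by blast
  have hom: "\<phi> \<in> hom \<pi> H" using assms(8) by (simp add: epi_def)
  obtain S :: "'m set" and b c where bas: "dual_basis ?R M S b c" by (rule projective_dual_basis[OF assms(3)])
  obtain T :: "'n set" and d e where bas': "dual_basis ?R N T d e" by (rule projective_dual_basis[OF assms(4)])
  have M: "left_module ?R M" and N: "left_module ?R N"
    using assms(3,4) unfolding projective_left_module_def by blast+
  have Z: "right_module ?R ?Z" by (rule Zp_right_module[OF G assms(2)])
  have A: "right_module ?R A" unfolding A_def by (rule twisted_right_module[OF G H hom assms(9)])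
  interpret A: right_module ?R A by (rule A)
  note b = dual_basisD(1)[OF bas] and c = dual_basisD(2)[OF bas]
  note e = dual_basisD(2)[OF bas']
  have Zinj: "coordinates_injective ?R ?Z f S b c T e"
    using assms(6) id_tensor_inj_iff[OF tensor_pair.intro[OF Z M] tensor_pair.intro[OF Z N] assms(5) bas bas'] by blast
  obtain \<beta> \<gamma> where \<beta>: "\<beta> \<in> hom (\<pi>\<lparr>carrier := ?K\<rparr>) P" and \<gamma>: "\<gamma> \<in> hom P (GL k)"
    and \<gamma>\<beta>: "\<And>x. x \<in> ?K \<Longrightarrow> \<alpha> x = \<gamma> (\<beta> x)"
    using assms(11) unfolding factors_through_def by auto
  have P: "group P" using assms(10) by (simp add: p_group_def)
  let ?U = "{x \<in> ?K. \<beta> x = \<one>\<^bsub>P\<^esub>}"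
  have \<alpha>U: "\<alpha> u = 1\<^sub>m k" if "u \<in> ?U" for u
    using that \<gamma>\<beta>[of u] hom_one[OF \<gamma> P GL_group] by (simp add: GL_one)
  have "coordinates_injective ?R A f S b c T e"
    unfolding coordinates_injective_def
  proof (intro allI impI)
    fix F w
    assume F: "finite F" "F \<subseteq> S" and w: "w \<in> F \<rightarrow> carrier A"
      and idem: "\<forall>s'\<in>F. finsum A (\<lambda>s. c s' (b s) \<odot>\<^bsub>A\<^esub> w s) F = w s'"
      and zero: "\<forall>t\<in>T. finsum A (\<lambda>s. e t (f (b s)) \<odot>\<^bsub>A\<^esub> w s) F = \<zero>\<^bsub>A\<^esub>"
    have cR: "c s' (b s) \<in> carrier ?R" if "s \<in> F" "s' \<in> F" for s s'
      by (rule left_functional_closed[OF c b]) (use that F(2) in blast)+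
    have eR: "e t (f (b s)) \<in> carrier ?R" if s: "s \<in> F" and t: "t \<in> T" for s t
    proof (rule left_functional_closed[OF e[OF t]])
      have "b s \<in> carrier M" using b s F(2) by blast
      then show "f (b s) \<in> carrier N" using assms(5) unfolding left_module_hom_def by blast
    qed
    \<comment> \<open>the columns \<open>Inl s'\<close> hold the identity minus the idempotent that defines \<open>M\<close>, the columns \<open>Inr t\<close> the matrix of \<open>f\<close>\<close>
    define E where "E s t = (case t of
        Inl s' \<Rightarrow> if s' \<in> F then (if s = s' then Poly_Mapping.single \<one>\<^bsub>\<pi>\<^esub> 1 else 0) - c s' (b s) else 0
      | Inr t \<Rightarrow> if t \<in> T then e t (f (b s)) else 0)" for s and t :: "'m + 'n"
    have E_Inl: "E s (Inl s') = (if s = s' then Poly_Mapping.single \<one>\<^bsub>\<pi>\<^esub> 1 else 0) - c s' (b s)" if "s' \<in> F" for s s'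
      using that by (simp add: E_def)
    have E_Inr: "E s (Inr t) = e t (f (b s))" if "t \<in> T" for s t
      using that by (simp add: E_def)
    have E: "Poly_Mapping.keys (E s t) \<subseteq> carrier \<pi>" if s: "s \<in> F" for s t
    proof (cases t)
      case (Inl s')
      show ?thesis
      proof (cases "s' \<in> F")
        case True
        have "Poly_Mapping.keys (c s' (b s)) \<subseteq> carrier \<pi>" using cR[OF s True] by (simp add: group_ring_def)
        moreover have "Poly_Mapping.keys (if s = s' then Poly_Mapping.single \<one>\<^bsub>\<pi>\<^esub> (1::int) else 0) \<subseteq> carrier \<pi>" by simp
        ultimately show ?thesis unfolding Inl E_Inl[OF True] by (intro order_trans[OF keys_diff] Un_least)
      qed (simp add: Inl E_def)
    next
      case (Inr t')
      show ?thesis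
      proof (cases "t' \<in> T")
        case True
        then show ?thesis using eR[OF s True] by (simp add: Inr E_Inr group_ring_def)
      qed (simp add: Inr E_def)
    qed
    have aug: "\<forall>s\<in>F. int p dvd q s"
      if z: "\<And>t. int p dvd (\<Sum>s\<in>F. augmentation (E s t) * q s)" for q
    proof -
      define u where "u s = q s mod int p" for s
      have p: "int p > 0" using assms(2) prime_gt_0_nat by simp
      have uZ: "u \<in> F \<rightarrow> carrier ?Z"
        using p pos_mod_bound[OF p] by (simp add: u_def Zp_right_module_def residue_ring_def)
      have idem_Z: "finsum ?Z (\<lambda>s. c s' (b s) \<odot>\<^bsub>?Z\<^esub> u s) F = u s'" if s': "s' \<in> F" for s'
      proof -
        have aug_diff: "augmentation (x - y) = augmentation x - augmentation y" for x y :: "'g \<Rightarrow>\<^sub>0 int"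
          using augmentation_add[of "x - y" y] by simp
        have "(\<Sum>s\<in>F. augmentation (E s (Inl s')) * q s)
            = (\<Sum>s\<in>F. (if s = s' then q s else 0) - augmentation (c s' (b s)) * q s)"
          unfolding E_Inl[OF s'] aug_diff
          by (intro sum.cong refl) (simp add: left_diff_distrib, simp add: augmentation_def)
        also have "\<dots> = q s' - (\<Sum>s\<in>F. augmentation (c s' (b s)) * q s)"
          using F(1) s' by (simp add: sum_subtractf)
        finally have "q s' mod int p = (\<Sum>s\<in>F. augmentation (c s' (b s)) * q s) mod int p"
          using z[of "Inl s'"] by (simp add: mod_eq_dvd_iff)
        also have "\<dots> = finsum ?Z (\<lambda>s. c s' (b s) \<odot>\<^bsub>?Z\<^esub> (q s mod int p)) F"
          by (rule finsum_Zp[OF G assms(2) F(1), symmetric]) (use cR[OF _ s'] in \<open>simp add: group_ring_def\<close>)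
        finally show ?thesis unfolding u_def by simp
      qed
      have zero_Z: "finsum ?Z (\<lambda>s. e t (f (b s)) \<odot>\<^bsub>?Z\<^esub> u s) F = \<zero>\<^bsub>?Z\<^esub>" if t: "t \<in> T" for t
      proof -
        have "finsum ?Z (\<lambda>s. e t (f (b s)) \<odot>\<^bsub>?Z\<^esub> u s) F = (\<Sum>s\<in>F. augmentation (e t (f (b s))) * q s) mod int p"
          unfolding u_def by (rule finsum_Zp[OF G assms(2) F(1)]) (use eR[OF _ t] in \<open>simp add: group_ring_def\<close>)
        also have "\<dots> = 0" using z[of "Inr t"] unfolding E_Inr[OF t] by (rule dvd_imp_mod_0)
        finally show ?thesis by (simp add: Zp_right_module_def residue_ring_def)
      qed
      have "\<forall>s\<in>F. u s = \<zero>\<^bsub>?Z\<^esub>"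
        by (rule coordinates_injectiveD[OF Zinj, OF F uZ]) (erule idem_Z, erule zero_Z)
      moreover have "\<zero>\<^bsub>?Z\<^esub> = 0" by (simp add: Zp_right_module_def residue_ring_def)
      ultimately show ?thesis unfolding u_def dvd_eq_mod_eq_0 by simp
    qed
    have core: "matrix_injective \<pi> F E ?U ?K (0::rat)"
      by (rule matrix_injective_rational[OF assms(1,2,7,8,10) \<beta> F(1) E aug])
    have single: "Poly_Mapping.single x 1 \<in> carrier ?R" if "x \<in> carrier \<pi>" for x
      using that by (simp add: group_ring_def)
    have coord: "l (Poly_Mapping.lookup (w s $ j) h) = 0"
      if l: "\<And>x y. l (x + y) = l x + l y" and j: "j < k" and h: "h \<in> carrier H" and s: "s \<in> F"
      for l :: "'q \<Rightarrow> rat" and j h s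
    proof -
      define \<Lambda> where "\<Lambda> y = l (Poly_Mapping.lookup (y $ j) h)" for y
      define v where "v s x = \<Lambda> (Poly_Mapping.single x 1 \<odot>\<^bsub>A\<^esub> w s)" for s x
      have wA: "w s \<in> carrier A" if "s \<in> F" for s using w that by blast
      have \<Lambda>_add: "\<Lambda> (y \<oplus>\<^bsub>A\<^esub> z) = \<Lambda> y + \<Lambda> z" if "y \<in> carrier A" "z \<in> carrier A" for y z
        using that j by (auto simp: \<Lambda>_def A_def twisted_right_module_def Poly_Mapping.lookup_add l)
      have v_fun: "coset_function \<pi> ?U ?K 0 (v s)" if "s \<in> F" for s
        unfolding v_def \<Lambda>_def A_def
        by (rule twisted_lookup_coset_function[OF G H assms(8,9) _ \<alpha>U l j h wA[OF that, unfolded A_def]]) auto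
      have vE: "(\<Sum>s\<in>F. fun_act \<pi> (E s t) (v s) x) = 0" if x: "x \<in> carrier \<pi>" for t x
      proof -
        define \<Lambda>' where "\<Lambda>' y = \<Lambda> (Poly_Mapping.single x 1 \<odot>\<^bsub>A\<^esub> y)" for y
        have \<Lambda>'_add: "\<Lambda>' (y \<oplus>\<^bsub>A\<^esub> z) = \<Lambda>' y + \<Lambda>' z" if yz: "y \<in> carrier A" "z \<in> carrier A" for y z
          unfolding \<Lambda>'_def A.smult_r_distr[OF single[OF x] yz]
          by (rule \<Lambda>_add[OF A.smult_closed[OF single[OF x] yz(1)] A.smult_closed[OF single[OF x] yz(2)]])
        have act: "fun_act \<pi> r (v s) x = \<Lambda>' (r \<odot>\<^bsub>A\<^esub> w s)" if "r \<in> carrier ?R" "s \<in> F" for r s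
          unfolding v_def \<Lambda>'_def \<Lambda>_def A_def
          by (rule twisted_lookup_fun_act[OF G H hom assms(9) l j _ x wA[OF that(2), unfolded A_def]])
             (use that(1) in \<open>simp add: group_ring_def\<close>)
        have act_sum: "(\<Sum>s\<in>F. fun_act \<pi> (r s) (v s) x) = \<Lambda>' (finsum A (\<lambda>s. r s \<odot>\<^bsub>A\<^esub> w s) F)"
          if r: "\<And>s. s \<in> F \<Longrightarrow> r s \<in> carrier ?R" for r
        proof -
          have "(\<lambda>s. r s \<odot>\<^bsub>A\<^esub> w s) \<in> F \<rightarrow> carrier A" by (intro funcsetI A.smult_closed r wA)
          from A.M.additive_finsum[OF \<Lambda>'_add F(1) this]
          show ?thesis using act[OF r] by simp
        qed
        show ?thesis
        proof (cases t)
          case (Inr t')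
          show ?thesis
          proof (cases "t' \<in> T")
            case True
            have "\<Lambda>' \<zero>\<^bsub>A\<^esub> = 0"
              using \<Lambda>'_add[OF A.M.zero_closed A.M.zero_closed] A.M.l_zero[OF A.M.zero_closed] by simp
            then show ?thesis
              unfolding Inr E_Inr[OF True] using act_sum[OF eR[OF _ True]] zero True by simp
          qed (simp add: Inr E_def)
        next
          case (Inl s')
          show ?thesis
          proof (cases "s' \<in> F")
            case True
            have "(\<Sum>s\<in>F. fun_act \<pi> (E s t) (v s) x)
              = (\<Sum>s\<in>F. (if s = s' then v s x else 0)) - (\<Sum>s\<in>F. fun_act \<pi> (c s' (b s)) (v s) x)"
              unfolding Inl E_Inl[OF True] fun_act_diff sum_subtractf
              by (intro arg_cong2[of _ _ _ _ minus] sum.cong refl) (use x in \<open>simp add: fun_act_single\<close>)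
            also have "(\<Sum>s\<in>F. (if s = s' then v s x else 0)) = v s' x" using F(1) True by simp
            also have "(\<Sum>s\<in>F. fun_act \<pi> (c s' (b s)) (v s) x) = \<Lambda>' (w s')"
              using act_sum[OF cR[OF _ True]] idem True by simp
            also have "v s' x = \<Lambda>' (w s')" by (simp only: v_def \<Lambda>'_def)
            finally show ?thesis by (simp only: diff_self)
          qed (simp add: Inl E_def)
        qed
      qed
      have "0 dvd v s \<one>\<^bsub>\<pi>\<^esub>"
        by (rule matrix_injectiveD[OF core v_fun _ s G.one_closed]) (simp_all add: vE)
      then have "v s \<one>\<^bsub>\<pi>\<^esub> = 0" by simp
      moreover have "\<one>\<^bsub>?R\<^esub> \<odot>\<^bsub>A\<^esub> w s = w s" by (rule A.smult_one[OF wA[OF s]])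
      ultimately show ?thesis by (simp add: v_def \<Lambda>_def group_ring_def)
    qed
    show "\<forall>s\<in>F. w s = \<zero>\<^bsub>A\<^esub>"
    proof
      fix s assume s: "s \<in> F"
      have ws: "w s \<in> carrier_vec k" "\<And>j. j < k \<Longrightarrow> Poly_Mapping.keys (w s $ j) \<subseteq> carrier H"
        using w s by (auto simp: A_def twisted_right_module_def group_ring_def)
      have "w s = 0\<^sub>v k"
      proof (rule eq_vecI)
        fix j assume "j < dim_vec (0\<^sub>v k :: ('h \<Rightarrow>\<^sub>0 'q) vec)"
        then have j: "j < k" by simp
        have "w s $ j = 0"
        proof (rule poly_mapping_eqI)
          fix h
          show "Poly_Mapping.lookup (w s $ j) h = Poly_Mapping.lookup 0 h"
          proof (rule ccontr)
            assume "Poly_Mapping.lookup (w s $ j) h \<noteq> Poly_Mapping.lookup 0 h"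
            then have nz: "Poly_Mapping.lookup (w s $ j) h \<noteq> 0" by simp
            then have h: "h \<in> carrier H" using ws(2)[OF j] by (auto simp: in_keys_iff)
            obtain l :: "'q \<Rightarrow> rat"
              where l: "\<forall>x y. l (x + y) = l x + l y" "l (Poly_Mapping.lookup (w s $ j) h) \<noteq> 0"
              using rational_functional_separates[OF nz] by (elim exE conjE)
            have "l (Poly_Mapping.lookup (w s $ j) h) = 0"
              using l(1) by (intro coord[OF _ j h s]) (elim allE)
            with l(2) show False by (rule notE)
          qed
        qed
        then show "w s $ j = 0\<^sub>v k $ j" using j by simp
      qed (use ws(1) in simp)
      then show "w s = \<zero>\<^bsub>A\<^esub>" by (simp add: A_def twisted_right_module_def)
    qed
  qed
  then have "inj_on (id_tensor ?R A N f) (carrier (tensor_product ?R A M))"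
    by (rule id_tensor_inj_iff[OF tensor_pair.intro[OF A M] tensor_pair.intro[OF A N] assms(5) bas bas', THEN iffD2])
  then show ?thesis unfolding A_def .
qed

end
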